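(* Let $n\in\mathbb N$, let $A_j\in\mathcal C_p$ for $1\le j\le2^n$, and let $\varepsilon_{ij}$ be the entries of the Littlewood matrix $L_n$. Then $$\sum_{i=1}^{2^n}\Big\|\sum_{j=1}^{2^n}\varepsilon_{ij}A_j\Big\|_p^p\le2^{n(p-1)}\sum_{j=1}^{2^n}\|A_j\|_p^p,\qquad 2\le p<\infty;$$ $$\sum_{i=1}^{2^n}\Big\|\sum_{j=1}^{2^n}\varepsilon_{ij}A_j\Big\|_p^q\le2^n\Big(\sum_{j=1}^{2^n}\|A_j\|_p^p\Big)^{q/p},\qquad 1\le p\le2,\ q=\frac p{p-1}$$ (for $p=1$, $q=\infty$, this is read as $\max_i\|\sum_j\varepsilon_{ij}A_j\|_1\le\sum_j\|A_j\|_1$); and $$\sum_{i=1}^{2^n}\Big\|\sum_{j=1}^{2^n}\varepsilon_{ij}A_j\Big\|_p^p\le2^n\Big(\sum_{j=1}^{2^n}\|A_j\|_p^q\Big)^{p/q},\qquad 2\le p<\infty,\ q=\frac p{p-1}.$$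
   Context: For $1\le p<\infty$, $\|A\|_p=(\operatorname{tr}|A|^p)^{1/p}$ with $|A|=(A^*A)^{1/2}$, and $\mathcal C_p$ is the Schatten class of operators $A$ on a separable complex Hilbert space with $\|A\|_p<\infty$. The Littlewood matrices ($L_n$ is of size $2^n\times2^n$) are defined inductively by $$L_1=\begin{bmatrix}1&1\\1&-1\end{bmatrix},\qquad L_{n+1}=\begin{bmatrix}L_n&L_n\\L_n&-L_n\end{bmatrix}.$$ *)

theory Defs
  imports "HOL-Analysis.Analysis" "HOL-Computational_Algebra.Polynomial"
begin

section \<open>Complex Hilbert spaces\<close>

text \<open>The inner product is linear in its first argument. Completeness and the norm axioms come from
  the class \<open>banach\<close>; positive definiteness of the inner product is part of \<open>cinner_norm\<close>.\<close>

class complex_hilbert_space = banach +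
  fixes scaleC :: "complex \<Rightarrow> 'a \<Rightarrow> 'a"  (infixr \<open>*\<^sub>C\<close> 75)
    and cinner :: "'a \<Rightarrow> 'a \<Rightarrow> complex"
  assumes scaleC_add_right: "a *\<^sub>C (x + y) = a *\<^sub>C x + a *\<^sub>C y"
    and scaleC_add_left: "(a + b) *\<^sub>C x = a *\<^sub>C x + b *\<^sub>C x"
    and scaleC_scaleC: "a *\<^sub>C (b *\<^sub>C x) = (a * b) *\<^sub>C x"
    and scaleC_of_real: "complex_of_real r *\<^sub>C x = r *\<^sub>R x"
    and cinner_add_left: "cinner (x + y) z = cinner x z + cinner y z"
    and cinner_scaleC_left: "cinner (a *\<^sub>C x) y = a * cinner x y"
    and cinner_commute: "cinner y x = cnj (cinner x y)"
    and cinner_norm: "cinner x x = complex_of_real ((norm x)\<^sup>2)"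

instantiation complex :: complex_hilbert_space
begin

definition scaleC_complex :: "complex \<Rightarrow> complex \<Rightarrow> complex"
  where "scaleC_complex a x = a * x"

definition cinner_complex :: "complex \<Rightarrow> complex \<Rightarrow> complex"
  where "cinner_complex x y = x * cnj y"

instance
  by standard
    (simp_all add: scaleC_complex_def cinner_complex_def algebra_simps scaleR_conv_of_real
      complex_norm_square del: of_real_power)

end

text \<open>A maximal orthonormal set.\<close>

definition orthonormal_basis :: "'a::complex_hilbert_space set \<Rightarrow> bool"
  where "orthonormal_basis B \<longleftrightarrow>
    (\<forall>e\<in>B. norm e = 1) \<and> (\<forall>e\<in>B. \<forall>f\<in>B. e \<noteq> f \<longrightarrow> cinner e f = 0) \<and>
    (\<forall>x. (\<forall>e\<in>B. cinner x e = 0) \<longrightarrow> x = 0)"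

section \<open>Bounded operators\<close>

text \<open>The type \<open>'a \<Rightarrow>\<^sub>L 'a\<close> consists of the bounded real-linear maps; operators on the complex
  Hilbert space are those that satisfy \<open>complex_linear\<close>.\<close>

definition complex_linear :: "('a::complex_hilbert_space \<Rightarrow>\<^sub>L 'a) \<Rightarrow> bool"
  where "complex_linear A \<longleftrightarrow> (\<forall>c x. A (c *\<^sub>C x) = c *\<^sub>C A x)"

definition cadjoint :: "('a::complex_hilbert_space \<Rightarrow>\<^sub>L 'a) \<Rightarrow> 'a \<Rightarrow>\<^sub>L 'a"
  where "cadjoint A = (THE B :: 'a \<Rightarrow>\<^sub>L 'a. \<forall>x y. cinner (A x) y = cinner x (B y))"

definition op_poly :: "real poly \<Rightarrow> ('a::complex_hilbert_space \<Rightarrow>\<^sub>L 'a) \<Rightarrow> 'a \<Rightarrow>\<^sub>L 'a"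
  where "op_poly P T = (\<Sum>k\<le>degree P. coeff P k *\<^sub>R (((o\<^sub>L) T ^^ k) id_blinfun))"

text \<open>Continuous functional calculus for a positive operator \<open>T\<close>, whose spectrum lies in
  \<open>{0..norm T}\<close>: \<open>f(T)\<close> is the limit, in operator norm, of \<open>P\<^sub>k(T)\<close> for every sequence of
  polynomials converging to \<open>f\<close> uniformly on that interval. It is meant only for positive \<open>T\<close>
  and \<open>f\<close> continuous on the interval.\<close>

definition op_fun :: "(real \<Rightarrow> real) \<Rightarrow> ('a::complex_hilbert_space \<Rightarrow>\<^sub>L 'a) \<Rightarrow> 'a \<Rightarrow>\<^sub>L 'a"
  where "op_fun f T = (THE S. \<forall>P. uniform_limit {0..norm T} (\<lambda>k. poly (P k)) f sequentially
    \<longrightarrow> (\<lambda>k. op_poly (P k) T) \<longlonglongrightarrow> S)"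

text \<open>\<open>T\<^sup>r\<close> for positive \<open>T\<close> and \<open>r > 0\<close>; note \<open>0 powr r = 0\<close>.\<close>

definition op_powr :: "('a::complex_hilbert_space \<Rightarrow>\<^sub>L 'a) \<Rightarrow> real \<Rightarrow> 'a \<Rightarrow>\<^sub>L 'a"
  where "op_powr T r = op_fun (\<lambda>t. t powr r) T"

definition op_abs :: "('a::complex_hilbert_space \<Rightarrow>\<^sub>L 'a) \<Rightarrow> 'a \<Rightarrow>\<^sub>L 'a"
  where "op_abs A = op_powr (cadjoint A o\<^sub>L A) (1/2)"

text \<open>The trace of a positive operator, possibly infinite. For such an operator the sum does not
  depend on the basis, so any choice will do.\<close>

definition op_trace :: "('a::complex_hilbert_space \<Rightarrow>\<^sub>L 'a) \<Rightarrow> ennreal"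
  where "op_trace T =
    (\<Sum>\<^sub>\<infinity>e\<in>(SOME B. orthonormal_basis B). ennreal (Re (cinner (T e) e)))"

section \<open>Schatten classes\<close>

text \<open>Real powers on \<open>[0,\<infinity>]\<close>, for positive exponents only.\<close>

definition ennpowr :: "ennreal \<Rightarrow> real \<Rightarrow> ennreal"  (infixr \<open>powr\<^sub>\<infinity>\<close> 80)
  where "x powr\<^sub>\<infinity> r = (if x = \<infinity> then \<infinity> else ennreal (enn2real x powr r))"

text \<open>The Schatten norm takes the value \<open>\<infinity>\<close> outside the Schatten class.\<close>

definition schatten_norm :: "real \<Rightarrow> ('a::complex_hilbert_space \<Rightarrow>\<^sub>L 'a) \<Rightarrow> ennreal"
  where "schatten_norm p A = op_trace (op_powr (op_abs A) p) powr\<^sub>\<infinity> (1/p)"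

definition schatten_class :: "real \<Rightarrow> ('a::complex_hilbert_space \<Rightarrow>\<^sub>L 'a) set"
  where "schatten_class p = {A. complex_linear A \<and> schatten_norm p A < \<infinity>}"

section \<open>Littlewood matrices\<close>

text \<open>Matrices are given by their entries, with rows and columns numbered from 1.
  \<open>block_matrix m A B C D\<close> is the matrix with first row of blocks \<open>A\<close>, \<open>B\<close> and second row
  \<open>C\<close>, \<open>D\<close>, all blocks being of size \<open>m \<times> m\<close>.\<close>

definition block_matrix ::
  "nat \<Rightarrow> (nat \<Rightarrow> nat \<Rightarrow> real) \<Rightarrow> (nat \<Rightarrow> nat \<Rightarrow> real) \<Rightarrow> (nat \<Rightarrow> nat \<Rightarrow> real) \<Rightarrow>
    (nat \<Rightarrow> nat \<Rightarrow> real) \<Rightarrow> nat \<Rightarrow> nat \<Rightarrow> real"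
  where "block_matrix m A B C D i j =
    (if i \<le> m then if j \<le> m then A i j else B i (j - m)
     else if j \<le> m then C (i - m) j else D (i - m) (j - m))"

text \<open>The value at 0 is a filler: the matrices start with \<open>L\<^sub>1\<close>.\<close>

fun littlewood :: "nat \<Rightarrow> nat \<Rightarrow> nat \<Rightarrow> real"
  where
    "littlewood 0 = (\<lambda>i j. 1)"
  | "littlewood (Suc 0) = (\<lambda>i j. if i = 2 \<and> j = 2 then -1 else 1)"
  | "littlewood (Suc (Suc n)) =
      (let L = littlewood (Suc n) in block_matrix (2 ^ Suc n) L L L (\<lambda>i j. - L i j))"

end

theory Submission
  imports Defs "HOL-Complex_Analysis.Complex_Analysis"
    "HOL-Computational_Algebra.Fundamental_Theorem_Algebra"
begin

text \<open>
  Write \<open>B i = \<Sum>j. \<epsilon> i j A j\<close>. These are inequalities of Clarkson-McCarthy type, proved by duality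
  and complex interpolation. For \<open>p > 1\<close> they follow from one bilinear estimate for finite-rank
  operators: if \<open>1 < p \<le> 2\<close> and \<open>1/p + 1/q = 1\<close>, then
  \<open>\<bar>\<Sum>i j. \<epsilon> i j tr (A j X i)\<bar> \<le> 2\<^bsup>n/q\<^esup> (\<Sum>j. \<parallel>A j\<parallel>\<^sub>p\<^bsup>p\<^esup>)\<^bsup>1/p\<^esup> (\<Sum>i. \<parallel>X i\<parallel>\<^sub>q\<^bsup>p\<^esup>)\<^bsup>1/p\<^esup>\<close>.
  The second inequality of the theorem arises from it by testing \<open>B i\<close> against \<open>X i\<close>, the last by
  letting the two families change places. The first follows from the last by the power mean
  inequality, and the case \<open>p = 1\<close> is the triangle inequality for the trace norm.

  The bilinear estimate (\<open>form_interpolated\<close>) interpolates between two elementary cases. With trace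
  norms on one side and operator norms on the other, it is enough that the entries of the
  Littlewood matrix have modulus at most 1. With Hilbert-Schmidt norms on both sides it expresses
  that \<open>2\<^bsup>-n/2\<^esup> L\<^sub>n\<close> is orthogonal, which is the parallelogram law iterated along the blocks
  (\<open>littlewood_orthogonal\<close>). When the operators are given by singular values and singular vectors,
  the analytic family needed for the three lines theorem is a finite sum of exponentials in \<open>z\<close>.

  The passage from general operators to finite rank goes through compressions \<open>P \<bar>A\<bar> P\<close>, where \<open>P\<close>
  projects onto the span of finitely many basis vectors. They are diagonalised by maximising a
  quadratic form (\<open>diagonal_extension\<close>). The traces of their \<open>p\<close>-th powers are at most \<open>tr \<bar>A\<bar>\<^bsup>p\<^esup>\<close> by
  Jensen's inequality (\<open>compressed_le_trace_powr\<close>), and eventually exceed every number below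
  \<open>tr \<bar>A\<bar>\<^bsup>p\<^esup>\<close> because the functional calculus of the compressions converges strongly
  (\<open>trace_powr_le_compressed\<close>). The second fact holds for arbitrary bounded operators; applied to \<open>B i\<close>, it
  also shows that the norm of \<open>B i\<close> is finite. In place of the polar decomposition it suffices that
  \<open>A \<approx> V \<bar>A\<bar>\<close> for the contraction \<open>V = A (\<bar>A\<bar> + d)\<inverse>\<close> with small \<open>d\<close>.

  All of this rests on the continuous functional calculus. It is well defined because a polynomial
  that is nonnegative on \<open>[0, \<parallel>T\<parallel>]\<close> takes a positive operator \<open>T\<close> to a positive operator. Indeed,
  factorising the polynomial shows that it belongs to the cone generated by squares times \<open>1\<close>, \<open>t\<close>,
  \<open>c - t\<close> and \<open>t (c - t)\<close>, where \<open>c = \<parallel>T\<parallel>\<close> (\<open>psd_closed_if_nonneg\<close>).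
\<close>

section \<open>Complex Hilbert spaces\<close>

lemma cinner_add_right: "cinner x (y + z) = cinner x y + cinner x z"
  by (metis cinner_add_left cinner_commute complex_cnj_add)

lemma cinner_scaleC_right: "cinner x (a *\<^sub>C y) = cnj a * cinner x y"
  by (metis cinner_scaleC_left cinner_commute complex_cnj_mult)

lemma cinner_scaleR_left: "cinner (r *\<^sub>R x) y = of_real r * cinner x y"
  by (metis cinner_scaleC_left scaleC_of_real)

lemma cinner_scaleR_right: "cinner x (r *\<^sub>R y) = of_real r * cinner x y"
  by (metis cinner_scaleC_right scaleC_of_real complex_cnj_complex_of_real)

lemma cinner_zero_left [simp]: "cinner 0 y = 0"
  using cinner_scaleR_left[of 0 0 y] by simp

lemma cinner_zero_right [simp]: "cinner x 0 = 0"
  using cinner_scaleR_right[of x 0 0] by simp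

lemma cinner_minus_left [simp]: "cinner (- x) y = - cinner x y"
  using cinner_scaleR_left[of "-1" x y] by simp

lemma cinner_minus_right [simp]: "cinner x (- y) = - cinner x y"
  using cinner_scaleR_right[of x "-1" y] by simp

lemma cinner_diff_left: "cinner (x - y) z = cinner x z - cinner y z"
  using cinner_add_left[of x "- y" z] by simp

lemma cinner_diff_right: "cinner x (y - z) = cinner x y - cinner x z"
  using cinner_add_right[of x y "- z"] by simp

lemma cinner_sum_left: "cinner (\<Sum>i\<in>I. f i) y = (\<Sum>i\<in>I. cinner (f i) y)"
  by (induction I rule: infinite_finite_induct) (auto simp: cinner_add_left)

lemma cinner_sum_right: "cinner y (\<Sum>i\<in>I. f i) = (\<Sum>i\<in>I. cinner y (f i))"
  by (induction I rule: infinite_finite_induct) (auto simp: cinner_add_right)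

lemmas cinner_algebra = cinner_add_left cinner_add_right cinner_diff_left cinner_diff_right
  cinner_scaleC_left cinner_scaleC_right cinner_scaleR_left cinner_scaleR_right

lemma Re_cinner_commute: "Re (cinner y x) = Re (cinner x y)"
  by (subst cinner_commute) simp

lemma norm_cinner_commute: "cmod (cinner y x) = cmod (cinner x y)"
  by (subst cinner_commute) simp

lemma Re_cinner_self: "Re (cinner x x) = (norm x)\<^sup>2"
  by (simp add: cinner_norm)

lemma cinner_eqI: "(\<And>z. cinner x z = cinner y z) \<Longrightarrow> x = y"
  using cinner_norm[of "x - y"] by (simp add: cinner_diff_left)

lemma norm_add_square: "(norm (x + y))\<^sup>2 = (norm x)\<^sup>2 + 2 * Re (cinner x y) + (norm y)\<^sup>2"
  by (simp add: Re_cinner_self[symmetric] cinner_algebra Re_cinner_commute[of y x])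

lemma norm_diff_square: "(norm (x - y))\<^sup>2 = (norm x)\<^sup>2 - 2 * Re (cinner x y) + (norm y)\<^sup>2"
  by (simp add: Re_cinner_self[symmetric] cinner_algebra Re_cinner_commute[of y x])

lemma parallelogram:
  fixes x y :: "'a::complex_hilbert_space"
  shows "(norm (x + y))\<^sup>2 + (norm (x - y))\<^sup>2 = 2 * ((norm x)\<^sup>2 + (norm y)\<^sup>2)"
  by (simp add: norm_add_square norm_diff_square)

text \<open>The norm of \<open>banach\<close> is only known to be real-homogeneous; complex homogeneity comes from
  the inner product.\<close>

lemma norm_scaleC: "norm (a *\<^sub>C x) = cmod a * norm x"
proof -
  have "cinner (a *\<^sub>C x) (a *\<^sub>C x) = (a * cnj a) * cinner x x"
    by (simp add: cinner_algebra)
  then have "of_real ((norm (a *\<^sub>C x))\<^sup>2) = (of_real ((cmod a * norm x)\<^sup>2) :: complex)"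
    unfolding cinner_norm complex_norm_square[symmetric] power_mult_distrib of_real_mult .
  then have "(norm (a *\<^sub>C x))\<^sup>2 = (cmod a * norm x)\<^sup>2"
    using of_real_eq_iff by blast
  then show ?thesis by simp
qed

lemma scaleC_zero_left [simp]: "0 *\<^sub>C x = 0"
  using norm_scaleC[of 0 x] by simp

lemma scaleC_zero_right [simp]: "a *\<^sub>C 0 = 0"
  using norm_scaleC[of a 0] by simp

lemma scaleC_one [simp]: "1 *\<^sub>C x = x"
  using scaleC_of_real[of 1 x] by simp

lemma scaleC_diff_left: "(a - b) *\<^sub>C x = a *\<^sub>C x - b *\<^sub>C x"
  using scaleC_add_left[of "a - b" b x] by simp

lemma scaleC_sum_right: "a *\<^sub>C (\<Sum>i\<in>I. f i) = (\<Sum>i\<in>I. a *\<^sub>C f i)"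
  by (induction I rule: infinite_finite_induct) (auto simp: scaleC_add_right)

lemma bounded_linear_scaleC_left: "bounded_linear (\<lambda>a. a *\<^sub>C x)"
proof (rule bounded_linear_intro)
  show "(r *\<^sub>R a) *\<^sub>C x = r *\<^sub>R (a *\<^sub>C x)" for r and a :: complex
    by (simp add: scaleR_conv_of_real scaleC_scaleC[symmetric] scaleC_of_real)
  show "norm (a *\<^sub>C x) \<le> norm a * norm x" for a
    by (simp add: norm_scaleC)
qed (rule scaleC_add_left)

lemma norm_cinner_le: "cmod (cinner x y) \<le> norm x * norm y"
proof (cases "y = 0")
  case False
  then have y: "norm y > 0" by simp
  define a where "a = cinner x y / of_real ((norm y)\<^sup>2)"
  have "0 \<le> (norm (x - a *\<^sub>C y))\<^sup>2" by simp
  also have "\<dots> = (norm x)\<^sup>2 - 2 * Re (cnj a * cinner x y) + (cmod a * norm y)\<^sup>2"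
    by (simp add: norm_diff_square cinner_algebra norm_scaleC)
  also have "Re (cnj a * cinner x y) = (cmod (cinner x y))\<^sup>2 / (norm y)\<^sup>2"
    proof -
    have "cnj a * cinner x y = of_real ((cmod (cinner x y))\<^sup>2 / (norm y)\<^sup>2)"
      unfolding a_def of_real_divide complex_norm_square by (simp add: mult.commute)
    then show ?thesis by (metis Re_complex_of_real)
  qed
  also have "(cmod a * norm y)\<^sup>2 = (cmod (cinner x y))\<^sup>2 / (norm y)\<^sup>2"
    using y unfolding a_def norm_divide norm_of_real by (simp add: power2_eq_square)
  finally have "(cmod (cinner x y))\<^sup>2 / (norm y)\<^sup>2 \<le> (norm x)\<^sup>2" by simp
  then have "(cmod (cinner x y))\<^sup>2 \<le> (norm x * norm y)\<^sup>2"
    using y by (simp add: field_simps power_mult_distrib)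
  then show ?thesis
    by (rule power2_le_imp_le) simp
qed simp

lemma bounded_linear_cinner_left: "bounded_linear (\<lambda>x. cinner x y)"
  by (rule bounded_linear_intro[where K = "norm y"])
     (auto simp: cinner_algebra norm_cinner_le scaleR_conv_of_real)

lemma bounded_linear_cinner_right: "bounded_linear (\<lambda>y. cinner x y)"
  by (rule bounded_linear_intro[where K = "norm x"])
     (auto simp: cinner_algebra norm_cinner_le scaleR_conv_of_real mult.commute[of _ "norm x"])

lemmas tendsto_cinner_left = bounded_linear.tendsto[OF bounded_linear_cinner_left]
lemmas tendsto_cinner_right = bounded_linear.tendsto[OF bounded_linear_cinner_right]
lemmas continuous_on_cinner_left = bounded_linear.continuous_on[OF bounded_linear_cinner_left]

section \<open>Orthonormal families\<close>

definition orthonormal :: "'a::complex_hilbert_space set \<Rightarrow> bool"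
  where "orthonormal B \<longleftrightarrow> (\<forall>e\<in>B. norm e = 1) \<and> (\<forall>e\<in>B. \<forall>f\<in>B. e \<noteq> f \<longrightarrow> cinner e f = 0)"

lemma orthonormal_cinner:
  "orthonormal B \<Longrightarrow> e \<in> B \<Longrightarrow> f \<in> B \<Longrightarrow> cinner e f = (if e = f then 1 else 0)"
  by (auto simp: orthonormal_def cinner_norm)

lemma orthonormal_subset: "orthonormal B \<Longrightarrow> C \<subseteq> B \<Longrightarrow> orthonormal C"
  by (auto simp: orthonormal_def)

lemma orthonormal_norm: "orthonormal B \<Longrightarrow> e \<in> B \<Longrightarrow> norm e = 1"
  by (auto simp: orthonormal_def)

lemma cinner_sum_orthonormal:
  assumes "orthonormal F" "finite F" "f \<in> F"
  shows "cinner (\<Sum>e\<in>F. c e *\<^sub>C e) f = c f"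
proof -
  have "cinner (\<Sum>e\<in>F. c e *\<^sub>C e) f = (\<Sum>e\<in>F. if e = f then c e else 0)"
    unfolding cinner_sum_left using assms
    by (intro sum.cong) (auto simp: cinner_algebra orthonormal_cinner)
  then show ?thesis using assms by simp
qed

lemma norm_sum_orthonormal:
  assumes "orthonormal F" "finite F"
  shows "(norm (\<Sum>e\<in>F. c e *\<^sub>C e))\<^sup>2 = (\<Sum>e\<in>F. (cmod (c e))\<^sup>2)"
proof -
  have "complex_of_real ((norm (\<Sum>e\<in>F. c e *\<^sub>C e))\<^sup>2) = (\<Sum>f\<in>F. cnj (c f) * c f)"
    unfolding cinner_norm[symmetric]
    by (subst cinner_sum_right) (simp add: cinner_scaleC_right cinner_sum_orthonormal assms)
  also have "\<dots> = of_real (\<Sum>e\<in>F. (cmod (c e))\<^sup>2)"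
    by (simp add: complex_norm_square mult.commute del: of_real_power)
  finally show ?thesis using of_real_eq_iff by blast
qed

text \<open>The orthogonal projection onto the span of a finite orthonormal set.\<close>

definition proj :: "'a::complex_hilbert_space set \<Rightarrow> 'a \<Rightarrow> 'a"
  where "proj F x = (\<Sum>e\<in>F. cinner x e *\<^sub>C e)"

lemma cinner_proj_left: "orthonormal F \<Longrightarrow> finite F \<Longrightarrow> f \<in> F \<Longrightarrow> cinner (proj F x) f = cinner x f"
  unfolding proj_def by (rule cinner_sum_orthonormal)

lemma cinner_proj_commute: "cinner (proj F x) y = cinner x (proj F y)"
  unfolding proj_def cinner_sum_left cinner_sum_right
  by (intro sum.cong refl) (simp add: cinner_algebra cinner_commute[of _ y, symmetric] mult.commute)

lemma proj_diff: "proj F (x - y) = proj F x - proj F y"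
  by (simp add: proj_def cinner_algebra sum_subtractf[symmetric] scaleC_diff_left)

lemma norm_proj: "orthonormal F \<Longrightarrow> finite F \<Longrightarrow> (norm (proj F x))\<^sup>2 = (\<Sum>e\<in>F. (cmod (cinner x e))\<^sup>2)"
  unfolding proj_def by (rule norm_sum_orthonormal)

lemma proj_orthogonal:
  assumes "orthonormal F" "finite F"
  shows "cinner (x - proj F x) (proj F x) = 0"
  unfolding proj_def[of F x] cinner_sum_right
  by (auto intro!: sum.neutral simp: cinner_algebra proj_def[symmetric] cinner_proj_left assms)

lemma norm_proj_le:
  assumes "orthonormal F" "finite F"
  shows "norm (proj F x) \<le> norm x"
proof -
  have "(norm x)\<^sup>2 = (norm ((x - proj F x) + proj F x))\<^sup>2" by simp
  also have "\<dots> = (norm (x - proj F x))\<^sup>2 + (norm (proj F x))\<^sup>2"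
    by (subst norm_add_square) (simp add: proj_orthogonal assms)
  finally have "(norm (proj F x))\<^sup>2 \<le> (norm x)\<^sup>2" by simp
  then show ?thesis by (rule power2_le_imp_le) simp
qed

lemma Bessel:
  assumes "orthonormal F" "finite F"
  shows "(\<Sum>e\<in>F. (cmod (cinner x e))\<^sup>2) \<le> (norm x)\<^sup>2"
  using norm_proj_le[OF assms, of x] norm_proj[OF assms, of x] by (metis norm_ge_zero power_mono)

text \<open>By Pythagoras the distance between two finite partial sums is the square root of a tail of
  the bounded series \<open>\<Sum>\<bar>c e\<bar>\<^sup>2\<close>, so the net of partial sums is Cauchy and completeness applies.\<close>

lemma square_summable_imp_summable:
  fixes E :: "'a::complex_hilbert_space set"
  assumes E: "orthonormal E"
    and bound: "\<And>F. finite F \<Longrightarrow> F \<subseteq> E \<Longrightarrow> (\<Sum>e\<in>F. (cmod (c e))\<^sup>2) \<le> C"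
  shows "(\<lambda>e. c e *\<^sub>C e) summable_on E"
proof -
  define g where "g e = (cmod (c e))\<^sup>2" for e
  have "g summable_on E"
    by (rule nonneg_bdd_above_summable_on) (auto simp: g_def bdd_above_def intro!: exI[of _ C] bound)
  then obtain L where L: "(g has_sum L) E" by (auto simp: summable_on_def)
  define f where "f e = c e *\<^sub>C e" for e
  have "\<exists>P. eventually P (finite_subsets_at_top E) \<and>
      (\<forall>F F'. P F \<and> P F' \<longrightarrow> dist (sum f F) (sum f F') < r)" if "r > 0" for r
  proof -
    define P where "P F \<longleftrightarrow> finite F \<and> F \<subseteq> E \<and> dist (sum g F) L < (r/2)\<^sup>2" for F
    have ev: "eventually P (finite_subsets_at_top E)"
      using L[unfolded has_sum_def tendsto_iff, rule_format, of "(r/2)\<^sup>2"] \<open>r > 0\<close>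
      unfolding P_def by (auto simp: eventually_conj_iff eventually_finite_subsets_at_top_weakI)
    have half: "norm (sum f (F - F')) < r/2" if "P F'" "finite F" "F' \<subseteq> F" "F \<subseteq> E" for F F'
    proof -
      have *: "sum g F \<le> L"
        using L that by (intro finite_sum_le_has_sum[OF L]) (auto simp: g_def)
      have "(norm (sum f (F - F')))\<^sup>2 = sum g (F - F')"
        unfolding f_def g_def using that
        by (intro norm_sum_orthonormal) (auto intro: orthonormal_subset[OF E])
      also have "\<dots> = sum g F - sum g F'"
        using that finite_subset[of F' F] by (simp add: sum_diff)
      also have "\<dots> < (r/2)\<^sup>2"
        using * that(1) by (auto simp: P_def dist_real_def)
      finally show ?thesis
        using \<open>r > 0\<close> by (intro power2_less_imp_less[of _ "r/2"]) auto
    qed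
    have "dist (sum f F1) (sum f F2) < r" if "P F1" "P F2" for F1 F2
    proof -
      let ?F = "F1 \<union> F2"
      have fin: "finite F1" "finite F2" "F1 \<subseteq> E" "F2 \<subseteq> E" using that by (auto simp: P_def)
      have "sum f ?F = sum f F1 + sum f (?F - F1)" "sum f ?F = sum f F2 + sum f (?F - F2)"
        using fin by (auto simp: sum_diff)
      then have "sum f F1 + sum f (?F - F1) = sum f F2 + sum f (?F - F2)"
        by (rule trans[OF sym])
      then have "sum f F1 - sum f F2 = sum f (?F - F2) - sum f (?F - F1)"
        by (simp add: algebra_simps)
      then have "dist (sum f F1) (sum f F2) \<le> norm (sum f (?F - F2)) + norm (sum f (?F - F1))"
        by (simp add: dist_norm norm_triangle_ineq4)
      also have "\<dots> < r/2 + r/2"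
        using fin that by (intro add_strict_mono half) auto
      finally show ?thesis by simp
    qed
    with ev show ?thesis by blast
  qed
  then have "cauchy_filter (filtermap (sum f) (finite_subsets_at_top E))"
    by (simp add: cauchy_filter_metric_filtermap)
  moreover have "complete (UNIV::'a set)"
    by (meson Cauchy_convergent UNIV_I complete_def convergent_def)
  ultimately obtain L' where "(sum f \<longlongrightarrow> L') (finite_subsets_at_top E)"
    using complete_uniform[where S=UNIV] by (force simp add: filterlim_def)
  then show ?thesis
    unfolding summable_on_def has_sum_def f_def by blast
qed

lemma has_sum_cinner:
  assumes "orthonormal E" "((\<lambda>e. c e *\<^sub>C e) has_sum y) E" "f \<in> E"
  shows "cinner y f = c f"
proof -
  have "((\<lambda>F. cinner (\<Sum>e\<in>F. c e *\<^sub>C e) f) \<longlongrightarrow> cinner y f) (finite_subsets_at_top E)"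
    using assms(2) unfolding has_sum_def by (rule tendsto_cinner_left)
  moreover have "eventually (\<lambda>F. cinner (\<Sum>e\<in>F. c e *\<^sub>C e) f = c f) (finite_subsets_at_top E)"
    unfolding eventually_finite_subsets_at_top using assms(1,3)
    by (intro exI[of _ "{f}"]) (auto intro!: cinner_sum_orthonormal orthonormal_subset[OF assms(1)])
  ultimately show ?thesis
    by (intro tendsto_unique[OF finite_subsets_at_top_neq_bot _ tendsto_eventually])
qed

lemma orthonormal_basis_imp_orthonormal: "orthonormal_basis E \<Longrightarrow> orthonormal E"
  by (simp add: orthonormal_basis_def orthonormal_def)

text \<open>The Fourier series of \<open>x\<close> converges; its limit has the same coefficients as \<open>x\<close>, and
  maximality of the basis leaves no room for a difference. All limits below are taken along the
  finite subsets of a basis, so the projections \<open>proj F\<close> are the finite-dimensional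
  approximations of the identity.\<close>

lemma tendsto_proj:
  assumes E: "orthonormal_basis E"
  shows "((\<lambda>F. proj F x) \<longlongrightarrow> x) (finite_subsets_at_top E)"
proof -
  note on = orthonormal_basis_imp_orthonormal[OF E]
  have "(\<lambda>e. cinner x e *\<^sub>C e) summable_on E"
    by (rule square_summable_imp_summable[OF on Bessel[OF orthonormal_subset[OF on]]])
  then obtain y where y: "((\<lambda>e. cinner x e *\<^sub>C e) has_sum y) E" by (auto simp: summable_on_def)
  have "\<forall>e\<in>E. cinner (x - y) e = 0"
    using has_sum_cinner[OF on y] by (simp add: cinner_diff_left)
  moreover have "(\<forall>e\<in>E. cinner (x - y) e = 0) \<longrightarrow> x - y = 0"
    using E unfolding orthonormal_basis_def by (elim conjE allE)
  ultimately have "x - y = 0" by (rule rev_mp)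
  then show ?thesis using y by (simp add: has_sum_def proj_def)
qed

lemma orthonormal_basis_exists: "\<exists>E :: 'a::complex_hilbert_space set. orthonormal_basis E"
proof -
  have chain: "\<Union>C \<in> {B :: 'a set. orthonormal B}"
    if "subset.chain {B. orthonormal B} C" for C
  proof -
    note C = that[unfolded subset_chain_def]
    have on: "\<And>B. B \<in> C \<Longrightarrow> orthonormal B"
      using conjunct1[OF C] by blast
    have tot: "\<And>A B. A \<in> C \<Longrightarrow> B \<in> C \<Longrightarrow> A \<subseteq> B \<or> B \<subseteq> A"
      using conjunct2[OF C] by blast
    have "cinner e f = 0" if ef: "A \<in> C" "e \<in> A" "B \<in> C" "f \<in> B" "e \<noteq> f" for A B e f
    proof -
      from tot[OF ef(1,3)] ef obtain D where "D \<in> C" "e \<in> D" "f \<in> D" by blast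
      with on ef show ?thesis by (auto simp: orthonormal_def)
    qed
    then have "orthonormal (\<Union>C)" using on by (auto simp: orthonormal_def)
    then show "\<Union>C \<in> {B. orthonormal B}" by simp
  qed
  obtain M :: "'a set" where M: "orthonormal M" "\<And>X. orthonormal X \<Longrightarrow> M \<subseteq> X \<Longrightarrow> X = M"
    using subset_Zorn'[OF chain] by blast
  have "x = 0" if x: "\<forall>e\<in>M. cinner x e = 0" for x
  proof (rule ccontr)
    assume "x \<noteq> 0"
    define u where "u = (1 / norm x) *\<^sub>R x"
    have u: "norm u = 1" "\<And>e. e \<in> M \<Longrightarrow> cinner u e = 0"
      using \<open>x \<noteq> 0\<close> x by (auto simp: u_def cinner_algebra)
    then have "\<And>e. e \<in> M \<Longrightarrow> cinner e u = 0" by (metis cinner_commute complex_cnj_zero)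
    with u M(1) have "orthonormal (insert u M)" by (auto simp: orthonormal_def)
    then have "u \<in> M" using M(2) by blast
    then have "cinner u u = 0" using u by blast
    with u(1) show False by (simp add: cinner_norm)
  qed
  with M(1) have "orthonormal_basis M" by (auto simp: orthonormal_basis_def orthonormal_def)
  then show ?thesis ..
qed

section \<open>Adjoints\<close>

definition clinear :: "('a::complex_hilbert_space \<Rightarrow> 'a) \<Rightarrow> bool"
  where "clinear f \<longleftrightarrow> (\<forall>x y. f (x + y) = f x + f y) \<and> (\<forall>c x. f (c *\<^sub>C x) = c *\<^sub>C f x)"

lemma clinear_add: "clinear f \<Longrightarrow> f (x + y) = f x + f y"
  by (simp add: clinear_def)

lemma clinear_scaleC: "clinear f \<Longrightarrow> f (c *\<^sub>C x) = c *\<^sub>C f x"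
  by (simp add: clinear_def)

lemma clinear_zero: "clinear f \<Longrightarrow> f 0 = 0"
  using clinear_scaleC[of f 0 0] by simp

lemma clinear_sum: "clinear f \<Longrightarrow> f (\<Sum>i\<in>I. g i) = (\<Sum>i\<in>I. f (g i))"
  by (induction I rule: infinite_finite_induct) (simp_all add: clinear_zero clinear_add)

lemma clinear_sum_scaleC: "clinear f \<Longrightarrow> f (\<Sum>i\<in>I. c i *\<^sub>C g i) = (\<Sum>i\<in>I. c i *\<^sub>C f (g i))"
  by (simp add: clinear_sum clinear_scaleC)

lemma clinear_id: "clinear (\<lambda>x. x)"
  by (simp add: clinear_def)

lemma clinear_proj: "clinear (proj F)"
  unfolding clinear_def proj_def
  by (simp add: cinner_algebra scaleC_add_left sum.distrib scaleC_sum_right scaleC_scaleC)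

text \<open>The representing vector is assembled from the only possible coordinates \<open>cnj (\<phi> e)\<close>. They
  are square summable because \<open>\<phi>\<close>, applied to \<open>\<Sum> cnj (\<phi> e) e\<close> over a finite set, returns the sum
  of their squares, which boundedness compares with its square root.\<close>

lemma Riesz_representation:
  fixes \<phi> :: "'a::complex_hilbert_space \<Rightarrow> complex"
  assumes bl: "bounded_linear \<phi>" and hom: "\<And>c x. \<phi> (c *\<^sub>C x) = c * \<phi> x"
  shows "\<exists>y. \<forall>x. \<phi> x = cinner x y"
proof -
  interpret \<phi>: bounded_linear \<phi> by fact
  obtain K where K: "\<And>x. norm (\<phi> x) \<le> norm x * K" using \<phi>.bounded by blast
  obtain E :: "'a set" where E: "orthonormal_basis E" using orthonormal_basis_exists by blast
  note on = orthonormal_basis_imp_orthonormal[OF E]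
  have "(\<Sum>e\<in>F. (cmod (cnj (\<phi> e)))\<^sup>2) \<le> K\<^sup>2" if F: "finite F" "F \<subseteq> E" for F
  proof -
    define z where "z = (\<Sum>e\<in>F. cnj (\<phi> e) *\<^sub>C e)"
    define s where "s = (\<Sum>e\<in>F. (cmod (cnj (\<phi> e)))\<^sup>2)"
    have z: "(norm z)\<^sup>2 = s"
      unfolding z_def s_def by (rule norm_sum_orthonormal[OF orthonormal_subset[OF on F(2)] F(1)])
    have "\<phi> z = of_real s"
      unfolding z_def s_def
      by (simp add: \<phi>.sum hom complex_norm_square mult.commute del: of_real_power)
    moreover have "s \<ge> 0" unfolding s_def by (intro sum_nonneg) auto
    ultimately have "(norm z)\<^sup>2 \<le> norm z * K" using K[of z] z by simp
    then have "z \<noteq> 0 \<longrightarrow> norm z \<le> K" by (simp add: power2_eq_square mult_le_cancel_left)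
    then have "norm z \<le> \<bar>K\<bar>" by (cases "z = 0") auto
    then have "(norm z)\<^sup>2 \<le> K\<^sup>2" by (simp add: abs_le_square_iff[symmetric])
    then show ?thesis using z s_def by simp
  qed
  then have "(\<lambda>e. cnj (\<phi> e) *\<^sub>C e) summable_on E"
    by (rule square_summable_imp_summable[OF on])
  then obtain y where y: "((\<lambda>e. cnj (\<phi> e) *\<^sub>C e) has_sum y) E" by (auto simp: summable_on_def)
  have ey: "cinner e y = \<phi> e" if "e \<in> E" for e
    using has_sum_cinner[OF on y that] cinner_commute[of e y] by simp
  have "\<phi> x = cinner x y" for x
  proof (rule tendsto_unique[OF finite_subsets_at_top_neq_bot])
    show "((\<lambda>F. \<phi> (proj F x)) \<longlongrightarrow> \<phi> x) (finite_subsets_at_top E)"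
      by (rule \<phi>.tendsto[OF tendsto_proj[OF E]])
    have "eventually (\<lambda>F. \<phi> (proj F x) = cinner (proj F x) y) (finite_subsets_at_top E)"
      by (rule eventually_finite_subsets_at_top_weakI)
        (auto simp: proj_def \<phi>.sum hom cinner_sum_left cinner_algebra ey intro!: sum.cong)
    moreover have "((\<lambda>F. cinner (proj F x) y) \<longlongrightarrow> cinner x y) (finite_subsets_at_top E)"
      by (rule tendsto_cinner_left[OF tendsto_proj[OF E]])
    ultimately show "((\<lambda>F. \<phi> (proj F x)) \<longlongrightarrow> cinner x y) (finite_subsets_at_top E)"
      by (rule tendsto_cong[THEN iffD2])
  qed
  then show ?thesis by blast
qed

text \<open>Riesz representation provides an operator with the defining property, and nondegeneracy of
  the inner product makes it the only one, so the definite description in the definition is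
  meaningful.\<close>

lemma cinner_cadjoint:
  fixes A :: "'a::complex_hilbert_space \<Rightarrow>\<^sub>L 'a"
  assumes A: "complex_linear A"
  shows "cinner (A x) y = cinner x (cadjoint A y)"
proof -
  have "\<exists>z. \<forall>x. cinner (A x) y = cinner x z" for y
  proof (rule Riesz_representation)
    show "bounded_linear (\<lambda>x. cinner (A x) y)"
      by (rule bounded_linear_compose[OF bounded_linear_cinner_left blinfun.bounded_linear_right])
    show "cinner (A (c *\<^sub>C x)) y = c * cinner (A x) y" for c x
      using A by (simp add: complex_linear_def cinner_scaleC_left)
  qed
  then obtain f where f: "\<And>x y. cinner (A x) y = cinner x (f y)" by metis
  have eqI: "u = v" if "\<And>x. cinner x u = cinner x v" for u v :: 'a
    by (rule cinner_eqI) (simp add: that cinner_commute[of u] cinner_commute[of v])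
  have "bounded_linear f"
  proof (rule bounded_linear_intro)
    show "f (x + y) = f x + f y" for x y
      by (rule eqI) (simp add: f[symmetric] cinner_algebra)
    show "f (r *\<^sub>R x) = r *\<^sub>R f x" for r x
      by (rule eqI) (simp add: f[symmetric] cinner_algebra)
    show "norm (f x) \<le> norm x * norm A" for x
    proof -
      have "(norm (f x))\<^sup>2 = cmod (cinner (A (f x)) x)"
        unfolding f cinner_norm norm_of_real by simp
      also have "\<dots> \<le> (norm A * norm (f x)) * norm x"
        by (rule order_trans[OF norm_cinner_le mult_right_mono[OF norm_blinfun]]) simp
      finally have "norm (f x) * norm (f x) \<le> norm (f x) * (norm x * norm A)"
        by (simp add: power2_eq_square mult_ac)
      then show ?thesis
        by (cases "norm (f x) = 0") (simp_all add: mult_le_cancel_left)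
    qed
  qed
  then have Bf: "blinfun_apply (Blinfun f) = f" by (rule bounded_linear_Blinfun_apply)
  have "cadjoint A = Blinfun f"
    unfolding cadjoint_def
  proof (rule the_equality)
    show "\<forall>x y. cinner (A x) y = cinner x (Blinfun f y)" by (simp add: Bf f)
    show "B = Blinfun f" if B: "\<forall>x y. cinner (A x) y = cinner x (B y)" for B :: "'a \<Rightarrow>\<^sub>L 'a"
    proof (rule blinfun_eqI, rule eqI)
      show "cinner x (B y) = cinner x (Blinfun f y)" for x y
        using B by (simp add: Bf f[symmetric])
    qed
  qed
  then show ?thesis by (simp add: Bf f)
qed

section \<open>Bases of finite-dimensional subspaces\<close>

text \<open>Two finite orthonormal sets \<open>F\<close> and \<open>G\<close> are bases of the same subspace iff
  \<open>proj F = proj G\<close>, and \<open>x\<close> lies in the subspace spanned by \<open>F\<close> iff \<open>proj F x = x\<close>.\<close>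

lemma proj_self: "orthonormal F \<Longrightarrow> finite F \<Longrightarrow> e \<in> F \<Longrightarrow> proj F e = e"
proof -
  assume F: "orthonormal F" "finite F" "e \<in> F"
  then have "proj F e = (\<Sum>f\<in>F. if e = f then f else 0)"
    unfolding proj_def by (intro sum.cong) (auto simp: orthonormal_cinner)
  then show ?thesis using F by simp
qed

lemma proj_proj: "orthonormal F \<Longrightarrow> finite F \<Longrightarrow> proj F (proj F x) = proj F x"
  by (subst (2) proj_def, subst (2) proj_def)
    (simp add: clinear_sum_scaleC[OF clinear_proj] proj_self cong: sum.cong)

text \<open>Expanding \<open>e\<close> in the basis \<open>G\<close>, exchanging the sums, and recognising the expansion of \<open>g\<close>
  in the basis \<open>F\<close>.\<close>

lemma trace_basis_independent:
  assumes F: "orthonormal F" "finite F" and G: "orthonormal G" "finite G"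
    and eq: "proj F = proj G" and T: "clinear T" and U: "clinear U"
  shows "(\<Sum>e\<in>F. cinner (T e) (U e)) = (\<Sum>g\<in>G. cinner (T g) (U g))"
proof -
  have "(\<Sum>e\<in>F. cinner (T e) (U e)) = (\<Sum>e\<in>F. cinner (T (proj G e)) (U e))"
    by (intro sum.cong) (auto simp: eq[symmetric] proj_self[OF F])
  also have "\<dots> = (\<Sum>e\<in>F. \<Sum>g\<in>G. cinner e g * cinner (T g) (U e))"
    unfolding proj_def by (simp add: clinear_sum_scaleC[OF T] cinner_sum_left cinner_algebra)
  also have "\<dots> = (\<Sum>g\<in>G. \<Sum>e\<in>F. cinner e g * cinner (T g) (U e))"
    by (rule sum.swap)
  also have "\<dots> = (\<Sum>g\<in>G. cinner (T g) (U (proj F g)))"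
    unfolding proj_def
    by (simp add: clinear_sum_scaleC[OF U] cinner_sum_right cinner_algebra
        cinner_commute[symmetric])
  also have "\<dots> = (\<Sum>g\<in>G. cinner (T g) (U g))"
    by (intro sum.cong) (auto simp: eq proj_self[OF G])
  finally show ?thesis .
qed

lemma square_norms_basis_independent:
  assumes F: "orthonormal F" "finite F" and G: "orthonormal G" "finite G"
    and eq: "proj F = proj G" and T: "clinear T"
  shows "(\<Sum>e\<in>F. (norm (T e))\<^sup>2) = (\<Sum>g\<in>G. (norm (T g))\<^sup>2)"
  using trace_basis_independent[OF F G eq T T]
  by (simp only: cinner_norm of_real_sum[symmetric] of_real_eq_iff)

text \<open>Both cardinalities are compared with the double sum of \<open>\<bar>\<langle>b, e\<rangle>\<bar>\<^sup>2\<close>: it equals the number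
  of elements of \<open>B\<close> by Parseval, and is at most that of \<open>F\<close> by Bessel.\<close>

lemma card_orthonormal_le:
  assumes F: "orthonormal F" "finite F" and B: "orthonormal B" "finite B"
    and sub: "\<And>b. b \<in> B \<Longrightarrow> proj F b = b"
  shows "card B \<le> card F"
proof -
  have "real (card B) = (\<Sum>b\<in>B. (norm (proj F b))\<^sup>2)"
    using B by (simp add: sub orthonormal_norm)
  also have "\<dots> = (\<Sum>e\<in>F. \<Sum>b\<in>B. (cmod (cinner b e))\<^sup>2)"
    by (simp only: norm_proj[OF F]) (rule sum.swap)
  also have "\<dots> \<le> (\<Sum>e\<in>F. (norm e)\<^sup>2)"
    by (rule sum_mono) (subst norm_cinner_commute, rule Bessel[OF B])
  also have "\<dots> = real (card F)"
    using F by (simp add: orthonormal_norm)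
  finally show ?thesis by simp
qed

lemma compact_coefficient_box:
  fixes F :: "'a::complex_hilbert_space set"
  assumes "finite F"
  shows "compact {\<Sum>e\<in>F. c e *\<^sub>C e |c. \<forall>e\<in>F. cmod (c e) \<le> 1}"
  using assms
proof induction
  case empty
  then show ?case by simp
next
  case (insert f F)
  have "{\<Sum>e\<in>insert f F. c e *\<^sub>C e |c. \<forall>e\<in>insert f F. cmod (c e) \<le> 1} =
    {x + y |x y. x \<in> (\<lambda>a. a *\<^sub>C f) ` cball 0 1 \<and>
      y \<in> {\<Sum>e\<in>F. c e *\<^sub>C e |c. \<forall>e\<in>F. cmod (c e) \<le> 1}}" (is "?L = ?R")
  proof (intro set_eqI iffI)
    fix z assume "z \<in> ?L"
    then obtain c where "z = (\<Sum>e\<in>insert f F. c e *\<^sub>C e)" "\<forall>e\<in>insert f F. cmod (c e) \<le> 1" by blast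
    then have "z = c f *\<^sub>C f + (\<Sum>e\<in>F. c e *\<^sub>C e)" "c f \<in> cball 0 1" "\<forall>e\<in>F. cmod (c e) \<le> 1"
      using insert by auto
    then show "z \<in> ?R" by blast
  next
    fix z assume "z \<in> ?R"
    then obtain a c where z: "z = a *\<^sub>C f + (\<Sum>e\<in>F. c e *\<^sub>C e)" "cmod a \<le> 1" "\<forall>e\<in>F. cmod (c e) \<le> 1"
      by auto
    have "z = (\<Sum>e\<in>insert f F. (c(f := a)) e *\<^sub>C e)"
      using insert z by (auto intro!: sum.cong)
    moreover have "\<forall>e\<in>insert f F. cmod ((c(f := a)) e) \<le> 1" using z by auto
    ultimately show "z \<in> ?L" by blast
  qed
  moreover have "compact ((\<lambda>a. a *\<^sub>C f) ` cball 0 1)"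
    by (intro compact_continuous_image bounded_linear.continuous_on[OF bounded_linear_scaleC_left])
      auto
  ultimately show ?case by (simp only: compact_sums insert.IH)
qed

lemma continuous_on_proj: "continuous_on UNIV (proj F)"
  unfolding proj_def
  by (intro continuous_on_sum bounded_linear.continuous_on[OF bounded_linear_scaleC_left]
      continuous_on_cinner_left continuous_on_id)

lemma compact_unit_sphere:
  assumes F: "orthonormal F" "finite F"
  shows "compact {x. proj F x = x \<and> (\<forall>b\<in>B. cinner x b = 0) \<and> norm x = 1}" (is "compact ?S")
proof -
  define K where "K = {\<Sum>e\<in>F. c e *\<^sub>C e |c. \<forall>e\<in>F. cmod (c e) \<le> 1}"
  have "x \<in> K" if x: "proj F x = x" "norm x = 1" for x
  proof -
    have "cmod (cinner x e) \<le> 1" if "e \<in> F" for e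
      using norm_cinner_le[of x e] orthonormal_norm[OF F(1) that] x by simp
    moreover have "x = (\<Sum>e\<in>F. cinner x e *\<^sub>C e)" using x by (simp add: proj_def)
    ultimately show ?thesis unfolding K_def by blast
  qed
  then have sub: "?S \<subseteq> K" by (simp add: subset_iff)
  have *: "?S = {x. proj F x = x} \<inter> (\<Inter>b\<in>B. {x. cinner x b = 0}) \<inter> {x. norm x = 1}"
    by (simp add: set_eq_iff conj_assoc)
  have "closed {x. proj F x = x}"
    by (rule closed_Collect_eq[OF continuous_on_proj continuous_on_id])
  moreover have "closed {x. cinner x b = 0}" for b :: 'a
    by (rule closed_Collect_eq[OF continuous_on_cinner_left[OF continuous_on_id] continuous_on_const])
  moreover have "closed {x :: 'a. norm x = 1}"
    by (rule closed_Collect_eq[OF continuous_on_norm[OF continuous_on_id] continuous_on_const])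
  ultimately have "closed ?S"
    unfolding * by (intro closed_Int closed_INT) simp_all
  then have "compact (K \<inter> ?S)"
    unfolding K_def by (rule compact_Int_closed[OF compact_coefficient_box[OF F(2)]])
  then show ?thesis unfolding Int_absorb1[OF sub] .
qed

section \<open>Diagonalisation of compressions\<close>

definition hermitian :: "('a::complex_hilbert_space \<Rightarrow>\<^sub>L 'a) \<Rightarrow> bool"
  where "hermitian S \<longleftrightarrow> (\<forall>x y. cinner (S x) y = cinner x (S y))"

lemma hermitianD: "hermitian S \<Longrightarrow> cinner (S x) y = cinner x (S y)"
  by (simp add: hermitian_def)

lemma hermitian_clinear: "hermitian S \<Longrightarrow> clinear (blinfun_apply S)"
  unfolding clinear_def
  by (intro conjI allI, simp add: blinfun.add_right)
     (rule cinner_eqI, simp add: cinner_algebra hermitianD)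

lemma nonpos_if_linear_le_quadratic:
  assumes "\<And>t::real. t > 0 \<Longrightarrow> 2 * t * a \<le> t\<^sup>2 * D"
  shows "a \<le> 0"
proof (rule ccontr)
  assume "\<not> a \<le> 0"
  then have a: "a > 0" by simp
  define t where "t = a / (\<bar>D\<bar> + 1)"
  have t: "t > 0" using a by (auto simp: t_def)
  have "t * D \<le> t * (\<bar>D\<bar> + 1)" using t by (intro mult_left_mono) auto
  also have "\<dots> = a" unfolding t_def by (simp add: field_simps)
  finally have "t * (t * D) \<le> t * a" using t by simp
  moreover have "2 * (t * a) \<le> t * (t * D)"
    using assms[OF t] by (simp add: power2_eq_square mult.assoc)
  moreover have "t * a > 0" using t a by simp
  ultimately show False by linarith
qed

text \<open>A unit vector \<open>v\<close> that maximises \<open>\<langle>S v, v\<rangle>\<close> within a finite-dimensional subspace is an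
  eigenvector of the compression of \<open>S\<close> to the subspace: moving from \<open>v\<close> by \<open>t a w\<close>, where \<open>w\<close>
  is orthogonal to \<open>v\<close> and \<open>a = \<langle>S v, w\<rangle>\<close>, changes the quadratic form by \<open>2 t \<bar>a\<bar>\<^sup>2\<close> to first
  order but the squared norm only to second order. The maximum is taken in the orthogonal
  complement of \<open>B\<close>, so that the step can be iterated.\<close>

lemma quadratic_form_maximiser:
  assumes S: "hermitian S" and F: "orthonormal F" "finite F"
    and z: "proj F z = z" "\<forall>b\<in>B. cinner z b = 0" "z \<noteq> 0"
  shows "\<exists>v. proj F v = v \<and> (\<forall>b\<in>B. cinner v b = 0) \<and> norm v = 1 \<and>
    (\<forall>w. proj F w = w \<and> (\<forall>b\<in>B. cinner w b = 0) \<and> cinner w v = 0 \<longrightarrow> cinner (S v) w = 0)"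
proof -
  define U where "U = {x. proj F x = x \<and> (\<forall>b\<in>B. cinner x b = 0)}"
  have U_scale: "c *\<^sub>C x \<in> U" if "x \<in> U" for c x
    using that by (auto simp: U_def clinear_scaleC[OF clinear_proj] cinner_algebra)
  have U_add: "x + y \<in> U" if "x \<in> U" "y \<in> U" for x y
    using that by (auto simp: U_def clinear_add[OF clinear_proj] cinner_algebra)
  define X where "X = {x. proj F x = x \<and> (\<forall>b\<in>B. cinner x b = 0) \<and> norm x = 1}"
  have XU: "x \<in> X \<longleftrightarrow> x \<in> U \<and> norm x = 1" for x by (auto simp: X_def U_def)
  have norm1: "of_real (1 / norm x) *\<^sub>C x \<in> X" if "x \<in> U" "x \<noteq> 0" for x
    using that by (auto simp: XU U_scale norm_scaleC norm_divide)
  have cont: "continuous_on X (\<lambda>x. Re (cinner (S x) x))"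
  proof -
    have "Re (cinner (S x) x) = ((norm (S x + x))\<^sup>2 - (norm (S x - x))\<^sup>2) / 4" for x
      by (simp add: norm_add_square norm_diff_square)
    then show ?thesis by (simp only:) (intro continuous_intros ballI, simp)
  qed
  have ne: "X \<noteq> {}" using norm1[of z] z by (auto simp only: U_def mem_Collect_eq simp_thms)
  have cpt: "compact X" unfolding X_def by (rule compact_unit_sphere[OF F])
  obtain v where v: "v \<in> X" and max: "\<forall>x\<in>X. Re (cinner (S x) x) \<le> Re (cinner (S v) v)"
    using continuous_attains_sup[OF cpt ne cont] by (elim bexE)
  define l where "l = Re (cinner (S v) v)"
  have form: "Re (cinner (S u) u) \<le> l * (norm u)\<^sup>2" if u: "u \<in> U" for u
  proof (cases "u = 0")
    case False
    have "Re (cinner (S (of_real (1 / norm u) *\<^sub>C u)) (of_real (1 / norm u) *\<^sub>C u)) \<le> l"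
      unfolding l_def by (rule bspec[OF max norm1[OF u False]])
    then show ?thesis
      using False unfolding scaleC_of_real
      by (simp add: blinfun.scaleR_right cinner_algebra power2_eq_square field_simps)
  qed simp
  have "cinner (S v) w = 0" if w: "w \<in> U" "cinner w v = 0" for w
  proof -
    define a where "a = cinner (S v) w"
    define D where "D = (cmod a)\<^sup>2 * (l * (norm w)\<^sup>2 - Re (cinner (S w) w))"
    have "2 * t * (cmod a)\<^sup>2 \<le> t\<^sup>2 * D" if "t > 0" for t :: real
    proof -
      define u where "u = v + (of_real t * a) *\<^sub>C w"
      have vw: "cinner v w = 0" using w(2) by (metis cinner_commute complex_cnj_zero)
      have Swv: "cinner (S w) v = cnj a"
        unfolding a_def using hermitianD[OF S, of w v] cinner_commute[of w "S v"] by simp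
      have "u \<in> U" unfolding u_def using v w by (auto simp: XU intro!: U_add U_scale)
      then have "Re (cinner (S u) u) \<le> l * (norm u)\<^sup>2" by (rule form)
      moreover have "(norm u)\<^sup>2 = 1 + t\<^sup>2 * (cmod a)\<^sup>2 * (norm w)\<^sup>2"
        unfolding u_def using v
        by (simp add: norm_add_square vw cinner_algebra norm_scaleC XU norm_mult power_mult_distrib)
      moreover have "Re (cinner (S u) u) = l + 2 * t * (cmod a)\<^sup>2 + t\<^sup>2 * (cmod a)\<^sup>2 * Re (cinner (S w) w)"
      proof -
        have "cinner (S u) u = cinner (S v) v + (of_real t * cnj a) * a + (of_real t * a) * cnj a
            + (of_real t)\<^sup>2 * (a * cnj a) * cinner (S w) w"
          unfolding u_def
          by (simp add: clinear_add[OF hermitian_clinear[OF S]]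
              clinear_scaleC[OF hermitian_clinear[OF S]] cinner_algebra Swv a_def[symmetric]
              algebra_simps power2_eq_square)
        also have "\<dots> = cinner (S v) v + of_real (2 * t * (cmod a)\<^sup>2)
            + of_real (t\<^sup>2 * (cmod a)\<^sup>2) * cinner (S w) w"
          by (simp add: complex_norm_square del: of_real_power)
            (simp add: algebra_simps power2_eq_square)
        finally show ?thesis by (simp add: l_def)
      qed
      ultimately show ?thesis by (simp add: D_def algebra_simps)
    qed
    then have "(cmod a)\<^sup>2 \<le> 0" by (rule nonpos_if_linear_le_quadratic)
    then show ?thesis by (simp add: a_def)
  qed
  with v show ?thesis by (intro exI[of _ v]) (simp add: XU U_def)
qed

text \<open>As long as the orthogonal complement of \<open>B\<close> in the span of \<open>F\<close> is nonzero, a maximiser of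
  the quadratic form on it can be added to \<open>B\<close>; the size of an orthonormal set being bounded by
  the dimension, this ends, with a basis. The start \<open>B = {}\<close> gives the spectral theorem for the
  compression of \<open>S\<close>, and \<open>S = 0\<close> gives the extension of orthonormal sets to bases.\<close>

lemma diagonal_extension:
  assumes S: "hermitian S" and F: "orthonormal F" "finite F"
    and B: "orthonormal B" "finite B" "\<And>b. b \<in> B \<Longrightarrow> proj F b = b"
    and diag: "\<And>b c. b \<in> B \<Longrightarrow> c \<in> B \<Longrightarrow> b \<noteq> c \<Longrightarrow> cinner (S b) c = 0"
    and inv: "\<And>b w. b \<in> B \<Longrightarrow> proj F w = w \<Longrightarrow> \<forall>c\<in>B. cinner w c = 0 \<Longrightarrow> cinner (S b) w = 0"
  shows "\<exists>G. B \<subseteq> G \<and> orthonormal G \<and> finite G \<and> proj G = proj F \<and>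
    (\<forall>g\<in>G. \<forall>h\<in>G. g \<noteq> h \<longrightarrow> cinner (S g) h = 0)"
  using B diag inv
proof (induction "card F - card B" arbitrary: B rule: less_induct)
  case (less B)
  show ?case
  proof (cases "\<exists>z. proj F z = z \<and> (\<forall>b\<in>B. cinner z b = 0) \<and> z \<noteq> 0")
    case True
    then obtain z where z: "proj F z = z" "\<forall>b\<in>B. cinner z b = 0" "z \<noteq> 0" by (elim exE conjE)
    obtain v where v: "proj F v = v" "\<forall>b\<in>B. cinner v b = 0" "norm v = 1"
      and inv_v: "\<forall>w. proj F w = w \<and> (\<forall>b\<in>B. cinner w b = 0) \<and> cinner w v = 0 \<longrightarrow> cinner (S v) w = 0"
      using quadratic_form_maximiser[OF S F z] by (elim exE conjE)
    have v': "\<forall>b\<in>B. cinner b v = 0" using v(2) by (metis cinner_commute complex_cnj_zero)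
    have vB: "v \<notin> B" using v(2,3) by (auto simp: cinner_norm dest: bspec[of _ _ v])
    have Sb: "\<forall>b\<in>B. cinner (S b) v = 0" using less.prems(5)[OF _ v(1,2)] by blast
    have Sv: "\<forall>b\<in>B. cinner (S v) b = 0"
    proof
      fix b assume "b \<in> B"
      then show "cinner (S v) b = 0" using Sb cinner_commute[of v "S b"] by (simp add: hermitianD[OF S])
    qed
    have on: "orthonormal (insert v B)"
      using less.prems(1) v v' by (auto simp: orthonormal_def)
    have sub: "\<And>b. b \<in> insert v B \<Longrightarrow> proj F b = b" using v less.prems by auto
    have "card (insert v B) \<le> card F"
      using less.prems by (intro card_orthonormal_le[OF F on _ sub]) auto
    then have "card F - card (insert v B) < card F - card B"
      using vB less.prems by simp
    then have "\<exists>G. insert v B \<subseteq> G \<and> orthonormal G \<and> finite G \<and> proj G = proj F \<and>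
        (\<forall>g\<in>G. \<forall>h\<in>G. g \<noteq> h \<longrightarrow> cinner (S g) h = 0)"
      using less.prems Sb Sv inv_v by (intro less.hyps on sub) auto
    then obtain G where "insert v B \<subseteq> G" "orthonormal G" "finite G" "proj G = proj F"
        "\<forall>g\<in>G. \<forall>h\<in>G. g \<noteq> h \<longrightarrow> cinner (S g) h = 0" by (elim exE conjE)
    then show ?thesis by (intro exI[of _ G] conjI) simp_all
  next
    case False
    have "proj B x = proj F x" for x
    proof -
      define y where "y = proj F x - proj B (proj F x)"
      have PB: "proj F (proj B u) = proj B u" for u
        unfolding proj_def[of B] using less.prems
        by (simp add: clinear_sum_scaleC[OF clinear_proj])
      have "proj F y = y" unfolding y_def by (simp add: proj_diff proj_proj[OF F] PB)
      moreover have "\<forall>b\<in>B. cinner y b = 0"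
        unfolding y_def using less.prems by (simp add: cinner_algebra cinner_proj_left)
      ultimately have "y = 0" using False by blast
      then have "proj F x = proj B (proj F x)" by (simp add: y_def)
      also have "\<dots> = proj B x"
        unfolding proj_def[of B] using less.prems
        by (intro sum.cong refl) (simp add: cinner_proj_commute)
      finally show ?thesis by simp
    qed
    then have "proj B = proj F" by (rule ext)
    then show ?thesis using less.prems(1,2,4) by (intro exI[of _ B]) simp
  qed
qed

text \<open>For hermitian \<open>S\<close>, the basis \<open>G\<close> of the span of \<open>F\<close> consists of eigenvectors of the
  compression of \<open>S\<close> to that span; the eigenvalues are the numbers \<open>\<langle>S g, g\<rangle>\<close>.\<close>

definition diagonalising :: "('a::complex_hilbert_space \<Rightarrow>\<^sub>L 'a) \<Rightarrow> 'a set \<Rightarrow> 'a set \<Rightarrow> bool"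
  where "diagonalising S F G \<longleftrightarrow> orthonormal G \<and> finite G \<and> proj G = proj F \<and>
    (\<forall>g\<in>G. \<forall>h\<in>G. g \<noteq> h \<longrightarrow> cinner (S g) h = 0)"

lemma diagonalising_exists:
  assumes "hermitian S" "orthonormal F" "finite F"
  shows "\<exists>G. diagonalising S F G"
  using diagonal_extension[OF assms, of "{}"] unfolding diagonalising_def orthonormal_def by simp

lemma orthonormal_extension:
  assumes "orthonormal F" "finite F" "orthonormal B" "finite B" "\<And>b. b \<in> B \<Longrightarrow> proj F b = b"
  shows "\<exists>G. B \<subseteq> G \<and> orthonormal G \<and> finite G \<and> proj G = proj F"
  using diagonal_extension[of 0, OF _ assms] by (simp add: hermitian_def)

section \<open>Polynomials of a bounded operator\<close>

lemma blinfun_power_apply: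
  fixes T :: "'a::real_normed_vector \<Rightarrow>\<^sub>L 'a"
  shows "blinfun_apply (((o\<^sub>L) T ^^ k) id_blinfun) x = (blinfun_apply T ^^ k) x"
  by (induction k) simp_all

lemma op_poly_apply: "op_poly P T x = (\<Sum>k\<le>degree P. coeff P k *\<^sub>R (blinfun_apply T ^^ k) x)"
  by (simp add: op_poly_def blinfun.sum_left blinfun.scaleR_left blinfun_power_apply)

lemma op_poly_apply_ge:
  assumes "degree P \<le> n"
  shows "op_poly P T x = (\<Sum>k\<le>n. coeff P k *\<^sub>R (blinfun_apply T ^^ k) x)"
  unfolding op_poly_apply using assms
  by (intro sum.mono_neutral_left) (auto simp: coeff_eq_0)

lemma op_poly_add: "op_poly (P + Q) T x = op_poly P T x + op_poly Q T x"
proof -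
  let ?n = "max (degree P) (degree Q)"
  have "degree (P + Q) \<le> ?n" by (rule degree_add_le_max)
  then show ?thesis
    by (simp add: op_poly_apply_ge[of _ ?n] scaleR_left_distrib sum.distrib)
qed

lemma op_poly_smult: "op_poly (smult a P) T x = a *\<^sub>R op_poly P T x"
  by (simp add: op_poly_apply_ge[of _ "degree P"] scaleR_sum_right)

lemma op_poly_diff: "op_poly (P - Q) T x = op_poly P T x - op_poly Q T x"
  using op_poly_add[of "P - Q" Q T x] by simp

lemma op_poly_pCons: "op_poly (pCons a P) T x = a *\<^sub>R x + T (op_poly P T x)"
proof -
  have "op_poly (pCons a P) T x =
      (\<Sum>k\<le>Suc (degree P). coeff (pCons a P) k *\<^sub>R (blinfun_apply T ^^ k) x)"
    by (rule op_poly_apply_ge) (rule degree_pCons_le)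
  then show ?thesis
    by (simp add: sum.atMost_Suc_shift op_poly_apply blinfun.sum_right blinfun.scaleR_right
        del: sum.atMost_Suc)
qed

lemma op_poly_0 [simp]: "op_poly 0 T x = 0"
  by (simp add: op_poly_apply)

lemma op_poly_mult: "op_poly (P * Q) T x = op_poly P T (op_poly Q T x)"
  by (induction P arbitrary: x) (simp_all add: op_poly_pCons op_poly_add op_poly_smult)

lemma op_poly_const: "op_poly [:a:] T x = a *\<^sub>R x"
  by (simp add: op_poly_pCons)

lemma op_poly_1 [simp]: "op_poly 1 T x = x"
  using op_poly_const[of 1 T x] by (simp add: one_pCons)

lemma op_poly_linear: "op_poly [:a, b:] T x = a *\<^sub>R x + b *\<^sub>R T x"
  by (simp add: op_poly_pCons blinfun.scaleR_right)

lemma hermitian_power: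
  fixes T :: "'a::complex_hilbert_space \<Rightarrow>\<^sub>L 'a"
  shows "hermitian T \<Longrightarrow> cinner ((blinfun_apply T ^^ k) x) y = cinner x ((blinfun_apply T ^^ k) y)"
  by (induction k arbitrary: x y) (simp_all add: hermitianD funpow_swap1)

lemma hermitian_op_poly: "hermitian T \<Longrightarrow> hermitian (op_poly P T)"
  unfolding hermitian_def
  by (simp add: op_poly_apply cinner_sum_left cinner_sum_right cinner_algebra
      hermitian_power[unfolded hermitian_def])

section \<open>Polynomials that are nonnegative on the spectral interval\<close>

definition positive :: "('a::complex_hilbert_space \<Rightarrow>\<^sub>L 'a) \<Rightarrow> bool"
  where "positive T \<longleftrightarrow> hermitian T \<and> (\<forall>x. 0 \<le> Re (cinner (T x) x))"

lemma positive_hermitian: "positive T \<Longrightarrow> hermitian T"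
  by (simp add: positive_def)

lemma positiveD: "positive T \<Longrightarrow> 0 \<le> Re (cinner (T x) x)"
  by (simp add: positive_def)

lemma Re_cinner_le: "Re (cinner x y) \<le> norm x * norm y"
  using norm_cinner_le[of x y] complex_Re_le_cmod[of "cinner x y"] by linarith

lemma Re_cinner_blinfun_le:
  fixes T :: "'a::complex_hilbert_space \<Rightarrow>\<^sub>L 'a"
  shows "Re (cinner (T x) x) \<le> norm T * (norm x)\<^sup>2"
  using Re_cinner_le[of "T x" x] mult_right_mono[OF norm_blinfun[of T x] norm_ge_zero[of x]]
  by (simp add: power2_eq_square mult.assoc)

definition psd_poly :: "('a::complex_hilbert_space \<Rightarrow>\<^sub>L 'a) \<Rightarrow> real poly \<Rightarrow> bool"
  where "psd_poly T P \<longleftrightarrow> (\<forall>x. 0 \<le> Re (cinner (op_poly P T x) x))"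

lemma psd_poly_add: "psd_poly T P \<Longrightarrow> psd_poly T Q \<Longrightarrow> psd_poly T (P + Q)"
  by (simp add: psd_poly_def op_poly_add cinner_add_left)

lemma psd_poly_square_mult:
  assumes "hermitian T" "psd_poly T P"
  shows "psd_poly T (S * S * P)"
proof -
  have "op_poly (S * S * P) T x = op_poly S T (op_poly P T (op_poly S T x))" for x
    unfolding op_poly_mult[symmetric] by (simp add: mult_ac)
  then have "cinner (op_poly (S * S * P) T x) x =
      cinner (op_poly P T (op_poly S T x)) (op_poly S T x)" for x
    by (simp only: hermitianD[OF hermitian_op_poly[OF assms(1)], of S])
  then show ?thesis
    using assms(2) by (simp add: psd_poly_def)
qed

text \<open>The quadratic module generated by \<open>t\<close>, \<open>c - t\<close> and \<open>t (c - t)\<close>, seen through its effect on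
  the operator: the four conditions make the set closed under multiplication by \<open>t\<close>, by \<open>c - t\<close>
  and by squares.\<close>

definition psd_closed :: "('a::complex_hilbert_space \<Rightarrow>\<^sub>L 'a) \<Rightarrow> real \<Rightarrow> real poly \<Rightarrow> bool"
  where "psd_closed T c P \<longleftrightarrow> psd_poly T P \<and> psd_poly T ([:0,1:] * P) \<and>
    psd_poly T ([:c,-1:] * P) \<and> psd_poly T ([:0,1:] * [:c,-1:] * P)"

lemma psd_closed_add: "psd_closed T c P \<Longrightarrow> psd_closed T c Q \<Longrightarrow> psd_closed T c (P + Q)"
  unfolding psd_closed_def by (simp add: psd_poly_add distrib_left del: mult_pCons_left)

lemma psd_closed_square_mult:
  assumes T: "hermitian T" and P: "psd_closed T c P"
  shows "psd_closed T c (S * S * P)"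
proof -
  have *: "Q * (S * S * P) = S * S * (Q * P)" for Q by (simp only: mult_ac)
  show ?thesis
    using P unfolding psd_closed_def *
    by (auto simp del: mult_pCons_left intro!: psd_poly_square_mult[OF T])
qed

lemma psd_closed_mult:
  assumes T: "hermitian T" and P: "psd_closed T c P"
  shows "psd_closed T c ([:0,1:] * P)" "psd_closed T c ([:c,-1:] * P)"
proof -
  define X Y where "X = [:0,1::real:]" and "Y = [:c,-1:]"
  have P: "psd_poly T P" "psd_poly T (X * P)" "psd_poly T (Y * P)" "psd_poly T (X * Y * P)"
    using P by (simp_all only: psd_closed_def X_def Y_def)
  note sq = psd_poly_square_mult[OF T]
  have "psd_poly T (X * (X * P))" "psd_poly T (X * Y * (X * P))"
    "psd_poly T (Y * (Y * P))" "psd_poly T (X * Y * (Y * P))"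
    using sq[OF P(1), of X] sq[OF P(3), of X] sq[OF P(1), of Y] sq[OF P(2), of Y]
    by (simp_all only: mult_ac)
  moreover have "psd_poly T (Y * (X * P))" "psd_poly T (X * (Y * P))"
    using P(4) by (simp_all only: mult_ac)
  ultimately have "psd_closed T c (X * P)" "psd_closed T c (Y * P)"
    using P by (simp_all only: psd_closed_def X_def[symmetric] Y_def[symmetric] simp_thms)
  then show "psd_closed T c ([:0,1:] * P)" "psd_closed T c ([:c,-1:] * P)"
    by (simp_all only: X_def Y_def)
qed

text \<open>The only condition that is not immediate is positivity of \<open>T (c - T)\<close>, a product of
  commuting positive operators. It follows from \<open>c T (c - T) = T (c - T) T + (c - T) T (c - T)\<close>,
  without recourse to square roots.\<close>

lemma psd_closed_1:
  assumes T: "positive T" and c: "norm T = c" "c > 0"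
  shows "psd_closed T c 1"
proof -
  note h = positive_hermitian[OF T]
  define X Y where "X = [:0,1::real:]" and "Y = [:c,-1:]"
  have X: "psd_poly T X"
    using T by (simp add: psd_poly_def X_def op_poly_linear positive_def)
  have Y: "psd_poly T Y"
    using Re_cinner_blinfun_le[of T] c
    by (simp add: psd_poly_def Y_def op_poly_linear cinner_algebra Re_cinner_self)
  have "psd_poly T (smult (1/c) (X * X * Y + Y * Y * X))"
    using psd_poly_add[OF psd_poly_square_mult[OF h Y, of X] psd_poly_square_mult[OF h X, of Y]] c
    by (simp add: psd_poly_def op_poly_smult cinner_algebra)
  also have "smult (1/c) (X * X * Y + Y * Y * X) = X * Y"
  proof -
    have "X + Y = [:c:]" by (simp add: X_def Y_def)
    moreover have "X * X * Y + Y * Y * X = (X + Y) * (X * Y)" by (simp only: algebra_simps)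
    ultimately have "X * X * Y + Y * Y * X = [:c:] * (X * Y)" by (simp only:)
    then show ?thesis using c by simp
  qed
  finally have XY: "psd_poly T (X * Y)" .
  have "psd_poly T 1" by (simp add: psd_poly_def Re_cinner_self)
  with X Y XY show ?thesis by (simp add: psd_closed_def X_def Y_def del: mult_pCons_left)
qed

lemma psd_closed_smult:
  assumes T: "positive T" and a: "a \<ge> 0" and P: "psd_closed T c P"
  shows "psd_closed T c (smult a P)"
proof -
  have "smult a P = [:sqrt a:] * [:sqrt a:] * P" using a by simp
  then show ?thesis
    by (simp only: psd_closed_square_mult[OF positive_hermitian[OF T] P])
qed

lemma poly_nonneg_off_point:
  fixes P :: "real poly"
  assumes c: "b < c" and P: "\<And>t. t \<in> {b..c} \<Longrightarrow> t \<noteq> a \<Longrightarrow> 0 \<le> poly P t" and t: "t \<in> {b..c}"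
  shows "0 \<le> poly P t"
proof (cases "t = a")
  case True
  have "t islimpt ({b..c} - {a})"
    using islimpt_Icc[OF c, of t] t islimpt_punctured[of t "{b..c}"] True by simp
  then have "t islimpt {s. 0 \<le> poly P s}"
    by (rule islimpt_subset) (use P in auto)
  moreover have "closed {s. 0 \<le> poly P s}"
    by (intro closed_Collect_le continuous_intros)
  ultimately show ?thesis by (auto simp: closed_limpt)
qed (use P t in auto)

text \<open>A root in the upper or lower half plane yields the real quadratic factor with the two
  conjugate roots: the remainder of the division by it has degree at most one and vanishes at a
  non-real point.\<close>

lemma complex_root_cases:
  fixes P :: "real poly"
  assumes deg: "degree P > 0"
  shows "(\<exists>a. poly P a = 0) \<or> (\<exists>a b. b \<noteq> 0 \<and> [:a\<^sup>2 + b\<^sup>2, - 2 * a, 1:] dvd P)"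
proof -
  let ?h = "map_poly complex_of_real"
  have hom_add: "?h (Q + R) = ?h Q + ?h R" for Q R
    by (rule poly_eqI) (simp add: coeff_map_poly)
  have hom_mult: "?h (Q * R) = ?h Q * ?h R" for Q R
    by (rule poly_eqI) (simp add: coeff_map_poly coeff_mult)
  have "degree (?h P) > 0" using deg by (simp add: degree_map_poly)
  from alg_closed_imp_poly_has_root[OF this] obtain z where z: "poly (?h P) z = 0" ..
  show ?thesis
  proof (cases "Im z = 0")
    case True
    have "poly (?h Q) (of_real x) = of_real (poly Q x)" for Q x
      by (induction Q) (simp_all add: map_poly_pCons)
    moreover have "z = of_real (Re z)" using True by (simp add: complex_eq_iff)
    ultimately have "complex_of_real (poly P (Re z)) = 0" using z by metis
    then show ?thesis by auto
  next
    case False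
    define D where "D = [:(Re z)\<^sup>2 + (Im z)\<^sup>2, - 2 * Re z, 1:]"
    define R where "R = P mod D"
    have "degree R < 2"
      using degree_mod_less[of D P] by (auto simp: R_def D_def)
    then have R: "R = [:coeff R 0, coeff R 1:]"
      by (intro poly_eqI) (auto simp: coeff_pCons coeff_eq_0 numeral_2_eq_2 split: nat.split)
    have "?h P = ?h (P div D * D + R)" by (simp add: R_def)
    then have "poly (?h P) z = poly (?h (P div D)) z * poly (?h D) z + poly (?h R) z"
      by (simp only: hom_add hom_mult poly_add poly_mult)
    moreover have "poly (?h D) z = 0"
      unfolding D_def by (simp add: map_poly_pCons complex_eq_iff power2_eq_square algebra_simps)
    ultimately have "poly (?h R) z = 0" using z by simp
    then have "complex_of_real (coeff R 0) + z * complex_of_real (coeff R 1) = 0"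
      by (subst (asm) R) (simp add: map_poly_pCons)
    then have "coeff R 1 = 0 \<and> coeff R 0 = 0" using False by (auto simp: complex_eq_iff)
    then have "R = 0" by (subst R) simp
    then have "D dvd P" by (simp add: R_def dvd_eq_mod_eq_0)
    then show ?thesis using False unfolding D_def by blast
  qed
qed

text \<open>Induction along a factorisation: complex pairs of roots give sums of squares, and roots
  outside the open interval give positive combinations of \<open>1\<close>, \<open>t\<close> and \<open>c - t\<close>; a root inside the interval is double,
  because the polynomial does not change sign there.\<close>

lemma psd_closed_if_nonneg:
  assumes T: "positive T" and c: "norm T = c" "c > 0"
    and P: "\<And>t. t \<in> {0..c} \<Longrightarrow> 0 \<le> poly P t"
  shows "psd_closed T c P"
  using P
proof (induction "degree P" arbitrary: P rule: less_induct)
  case (less P)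
  note h = positive_hermitian[OF T]
  show ?case
  proof (cases "degree P = 0")
    case True
    then obtain a where "P = [:a:]" by (rule degree_eq_zeroE)
    moreover from this have "a \<ge> 0" using less.prems[of 0] c by simp
    ultimately show ?thesis
      using psd_closed_smult[OF T _ psd_closed_1[OF T c], of a] by simp
  next
    case deg: False
    have deg_less: "degree Q < degree P" if "P = D * Q" "degree D > 0" for D Q
    proof -
      have "D \<noteq> 0" "Q \<noteq> 0" using deg that by auto
      then show ?thesis using that by (simp add: degree_mult_eq)
    qed
    consider (complex) a b where "b \<noteq> 0" "[:a\<^sup>2 + b\<^sup>2, - 2 * a, 1:] dvd P" | (real) a where "poly P a = 0"
      using complex_root_cases[of P] deg by blast
    then show ?thesis
    proof cases
      case complex
      then obtain Q where Q: "P = [:a\<^sup>2 + b\<^sup>2, - 2 * a, 1:] * Q" by (elim dvdE)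
      have "0 \<le> poly Q t" if t: "t \<in> {0..c}" for t
      proof -
        have "poly P t = ((t - a)\<^sup>2 + b\<^sup>2) * poly Q t"
          unfolding Q by (simp add: power2_eq_square algebra_simps)
        moreover have "(t - a)\<^sup>2 + b\<^sup>2 > 0" using complex by (simp add: add_nonneg_pos)
        ultimately show ?thesis using less.prems[OF t] by (simp add: zero_le_mult_iff)
      qed
      then have Qc: "psd_closed T c Q" by (intro less.hyps deg_less[OF Q]) auto
      have "P = [:-a,1:] * [:-a,1:] * Q + [:b:] * [:b:] * Q"
        unfolding Q distrib_right[symmetric] by (simp add: power2_eq_square)
      then show ?thesis
        by (simp only: psd_closed_add psd_closed_square_mult[OF h Qc])
    next
      case real
      then obtain Q where Q: "P = [:-a,1:] * Q" by (auto simp: poly_eq_0_iff_dvd elim: dvdE)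
      have val: "poly P t = (t - a) * poly Q t" for t unfolding Q by (simp add: algebra_simps)
      have dQ: "degree Q < degree P" by (rule deg_less[OF Q]) simp
      consider "a \<le> 0" | "a \<ge> c" | "0 < a" "a < c" by linarith
      then show ?thesis
      proof cases
        case 1
        have "0 \<le> poly Q t" if t: "t \<in> {0..c}" for t
        proof (rule poly_nonneg_off_point[OF c(2) _ t])
          fix s assume s: "s \<in> {0..c}" "s \<noteq> a"
          then have "s - a > 0" using 1 by auto
          then show "0 \<le> poly Q s" using less.prems[OF s(1)] by (simp add: val zero_le_mult_iff)
        qed
        then have Qc: "psd_closed T c Q" by (intro less.hyps dQ) auto
        have "P = [:0,1:] * Q + smult (-a) Q" unfolding Q by simp
        moreover have "psd_closed T c (smult (-a) Q)" using 1 by (intro psd_closed_smult[OF T _ Qc]) simp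
        ultimately show ?thesis
          by (simp only: psd_closed_add psd_closed_mult(1)[OF h Qc])
      next
        case 2
        have "0 \<le> poly (-Q) t" if t: "t \<in> {0..c}" for t
        proof (rule poly_nonneg_off_point[OF c(2) _ t])
          fix s assume s: "s \<in> {0..c}" "s \<noteq> a"
          then have "s - a < 0" using 2 by auto
          then show "0 \<le> poly (-Q) s" using less.prems[OF s(1)] by (simp add: val zero_le_mult_iff)
        qed
        then have Qc: "psd_closed T c (-Q)" using dQ by (intro less.hyps) auto
        have "P = [:c,-1:] * (-Q) + smult (a - c) (-Q)"
          unfolding Q by (simp add: algebra_simps smult_diff_left)
        moreover have "psd_closed T c (smult (a - c) (-Q))"
          using 2 by (intro psd_closed_smult[OF T _ Qc]) simp
        ultimately show ?thesis
          by (simp only: psd_closed_add psd_closed_mult(2)[OF h Qc])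
      next
        case 3
        have "0 \<le> poly Q a"
        proof (rule poly_nonneg_off_point[of a c a])
          show "0 \<le> poly Q s" if "s \<in> {a..c}" "s \<noteq> a" for s
            using less.prems[of s] that 3 by (simp add: val zero_le_mult_iff)
        qed (use 3 in simp_all)
        moreover have "0 \<le> poly (- Q) a"
        proof (rule poly_nonneg_off_point[of 0 a a])
          show "0 \<le> poly (- Q) s" if "s \<in> {0..a}" "s \<noteq> a" for s
            using less.prems[of s] that 3 by (simp add: val zero_le_mult_iff)
        qed (use 3 in simp_all)
        ultimately have "poly Q a = 0" by simp
        then obtain R where R: "Q = [:-a,1:] * R" by (auto simp: poly_eq_0_iff_dvd elim: dvdE)
        have PR: "P = [:-a,1:] * [:-a,1:] * R" unfolding Q R by (simp only: mult.assoc)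
        have "0 \<le> poly R t" if t: "t \<in> {0..c}" for t
        proof (rule poly_nonneg_off_point[OF c(2) _ t])
          fix s assume s: "s \<in> {0..c}" "s \<noteq> a"
          have "poly P s = (s - a)\<^sup>2 * poly R s" unfolding PR by (simp add: power2_eq_square algebra_simps)
          then show "0 \<le> poly R s" using less.prems[OF s(1)] s(2) by (simp add: zero_le_mult_iff)
        qed
        moreover have "degree R < degree P" by (rule deg_less[OF PR]) simp
        ultimately have "psd_closed T c R" by (intro less.hyps) auto
        then show ?thesis unfolding PR by (rule psd_closed_square_mult[OF h])
      qed
    qed
  qed
qed

lemma op_poly_nonneg:
  assumes T: "positive T" and P: "\<And>t. t \<in> {0..norm T} \<Longrightarrow> 0 \<le> poly P t"
  shows "0 \<le> Re (cinner (op_poly P T x) x)"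
proof (cases "norm T = 0")
  case True
  then have "T = 0" by simp
  moreover obtain a Q where "P = pCons a Q" by (cases P) auto
  moreover have "poly P 0 \<ge> 0" using P[of 0] by simp
  ultimately show ?thesis
    by (simp add: op_poly_pCons cinner_algebra Re_cinner_self)
next
  case False
  then have "norm T > 0" by simp
  from psd_closed_if_nonneg[OF T refl this P] show ?thesis
    by (simp add: psd_closed_def psd_poly_def)
qed

text \<open>The operator \<open>M\<^sup>2 - P(T)\<^sup>2\<close> is positive because the polynomial \<open>M\<^sup>2 - P\<^sup>2\<close> is nonnegative
  on the spectral interval. This estimate is what makes the continuous functional calculus well
  defined.\<close>

lemma norm_op_poly_le:
  assumes T: "positive T" and P: "\<And>t. t \<in> {0..norm T} \<Longrightarrow> \<bar>poly P t\<bar> \<le> M" and M: "M \<ge> 0"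
  shows "norm (op_poly P T) \<le> M"
proof (rule norm_blinfun_bound[OF M])
  fix x
  have "0 \<le> Re (cinner (op_poly ([:M\<^sup>2:] - P * P) T x) x)"
  proof (rule op_poly_nonneg[OF T])
    fix t assume "t \<in> {0..norm T}"
    then have "(poly P t)\<^sup>2 \<le> M\<^sup>2" using P by (simp add: abs_le_square_iff[symmetric] M)
    then show "0 \<le> poly ([:M\<^sup>2:] - P * P) t" by (simp add: power2_eq_square)
  qed
  also have "\<dots> = M\<^sup>2 * (norm x)\<^sup>2 - (norm (op_poly P T x))\<^sup>2"
    using hermitianD[OF hermitian_op_poly[OF positive_hermitian[OF T]], of P "op_poly P T x" x]
    by (simp add: op_poly_diff op_poly_const op_poly_mult cinner_algebra Re_cinner_self)
  finally have "(norm (op_poly P T x))\<^sup>2 \<le> (M * norm x)\<^sup>2" by (simp add: power_mult_distrib)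
  then show "norm (op_poly P T x) \<le> M * norm x"
    by (rule power2_le_imp_le) (simp add: M)
qed

section \<open>Continuous functional calculus for positive operators\<close>

lemma polynomial_approximation:
  fixes f :: "real \<Rightarrow> real"
  assumes f: "continuous_on {0..c} f"
  shows "\<exists>P. uniform_limit {0..c} (\<lambda>k. poly (P k)) f sequentially"
proof -
  have "\<exists>P. \<forall>t\<in>{0..c}. \<bar>f t - poly P t\<bar> < 1 / Suc k" for k
  proof -
    obtain g where g: "real_polynomial_function g" "\<And>t. t \<in> {0..c} \<Longrightarrow> \<bar>f t - g t\<bar> < 1 / Suc k"
      using Stone_Weierstrass_real_polynomial_function[OF compact_Icc f, of "1 / Suc k"] by auto
    from g(1) obtain a n where "g = (\<lambda>x. \<Sum>i\<le>n. a i * x ^ i)"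
      unfolding real_polynomial_function_iff_sum by (elim exE)
    then have "g t = poly (\<Sum>i\<le>n. monom (a i) i) t" for t by (simp add: poly_sum poly_monom)
    then show ?thesis using g(2) by (intro exI[of _ "\<Sum>i\<le>n. monom (a i) i"]) simp
  qed
  then obtain P where P: "\<And>k t. t \<in> {0..c} \<Longrightarrow> \<bar>f t - poly (P k) t\<bar> < 1 / Suc k" by metis
  have "uniform_limit {0..c} (\<lambda>k. poly (P k)) f sequentially"
  proof (rule uniform_limitI)
    fix e :: real assume "e > 0"
    then obtain N where N: "1 / Suc N < e" using nat_approx_posE by blast
    have "dist (poly (P k) t) (f t) < e" if "k \<ge> N" "t \<in> {0..c}" for k t
    proof -
      have "1 / real (Suc k) \<le> 1 / real (Suc N)" using that by (simp add: frac_le)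
      then show ?thesis using P[OF that(2), of k] N by (simp add: dist_real_def abs_minus_commute)
    qed
    then show "\<forall>\<^sub>F k in sequentially. \<forall>t\<in>{0..c}. dist (poly (P k) t) (f t) < e"
      unfolding eventually_sequentially by (intro exI[of _ N]) simp
  qed
  then show ?thesis by blast
qed

lemma norm_op_poly_diff_le:
  assumes T: "positive T" and "\<And>t. t \<in> {0..norm T} \<Longrightarrow> \<bar>poly P t - poly Q t\<bar> \<le> M" "M \<ge> 0"
  shows "norm (op_poly P T - op_poly Q T) \<le> M"
proof -
  have "op_poly P T - op_poly Q T = op_poly (P - Q) T"
    by (rule blinfun_eqI) (simp add: op_poly_diff blinfun.diff_left)
  then show ?thesis using norm_op_poly_le[OF T, of "P - Q" M] assms by simp
qed

lemma op_poly_close: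
  assumes T: "positive T"
    and P: "uniform_limit {0..norm T} (\<lambda>k. poly (P k)) f sequentially"
    and Q: "uniform_limit {0..norm T} (\<lambda>k. poly (Q k)) f sequentially" and e: "e > 0"
  shows "\<exists>N. \<forall>m\<ge>N. \<forall>n\<ge>N. norm (op_poly (P m) T - op_poly (Q n) T) < e"
proof -
  have "e / 3 > 0" using e by simp
  from eventually_conj[OF uniform_limitD[OF P this] uniform_limitD[OF Q this]]
  obtain N where "\<forall>n\<ge>N. (\<forall>t\<in>{0..norm T}. dist (poly (P n) t) (f t) < e / 3) \<and>
      (\<forall>t\<in>{0..norm T}. dist (poly (Q n) t) (f t) < e / 3)"
    unfolding eventually_sequentially ..
  then have N: "\<bar>poly (P n) t - f t\<bar> < e / 3" "\<bar>poly (Q n) t - f t\<bar> < e / 3"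
    if "n \<ge> N" "t \<in> {0..norm T}" for n t
    using that by (auto simp: dist_real_def)
  have "norm (op_poly (P m) T - op_poly (Q n) T) < e" if "m \<ge> N" "n \<ge> N" for m n
  proof -
    have "norm (op_poly (P m) T - op_poly (Q n) T) \<le> 2 * e / 3"
    proof (rule norm_op_poly_diff_le[OF T])
      fix t assume t: "t \<in> {0..norm T}"
      have "\<bar>poly (P m) t - f t\<bar> < e / 3" "\<bar>poly (Q n) t - f t\<bar> < e / 3"
        using N(1)[OF that(1) t] N(2)[OF that(2) t] by auto
      then show "\<bar>poly (P m) t - poly (Q n) t\<bar> \<le> 2 * e / 3" by linarith
    qed (use e in simp)
    then show ?thesis using e by linarith
  qed
  then show ?thesis by blast
qed

text \<open>Polynomials that are uniformly close give operators that are close, so all approximating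
  sequences yield Cauchy sequences with one common limit, the value described by \<open>op_fun\<close>.\<close>

lemma op_fun_tendsto:
  fixes T :: "'a::complex_hilbert_space \<Rightarrow>\<^sub>L 'a"
  assumes T: "positive T" and f: "continuous_on {0..norm T} f"
    and P: "uniform_limit {0..norm T} (\<lambda>k. poly (P k)) f sequentially"
  shows "(\<lambda>k. op_poly (P k) T) \<longlonglongrightarrow> op_fun f T"
proof -
  have "Cauchy (\<lambda>k. op_poly (P k) T)"
    by (rule CauchyI) (rule op_poly_close[OF T P P])
  then obtain S where S: "(\<lambda>k. op_poly (P k) T) \<longlonglongrightarrow> S"
    using Cauchy_convergent convergent_def by blast
  have all: "(\<lambda>k. op_poly (Q k) T) \<longlonglongrightarrow> S"
    if Q: "uniform_limit {0..norm T} (\<lambda>k. poly (Q k)) f sequentially" for Q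
  proof -
    have "(\<lambda>k. op_poly (Q k) T - op_poly (P k) T) \<longlonglongrightarrow> 0"
      by (rule LIMSEQ_I) (use op_poly_close[OF T Q P] in fastforce)
    from tendsto_add[OF this S] show ?thesis by simp
  qed
  have "op_fun f T = S"
    unfolding op_fun_def
  proof (rule the_equality)
    show "\<forall>P. uniform_limit {0..norm T} (\<lambda>k. poly (P k)) f sequentially \<longrightarrow>
        (\<lambda>k. op_poly (P k) T) \<longlonglongrightarrow> S"
      using all by simp
    show "R = S" if "\<forall>P. uniform_limit {0..norm T} (\<lambda>k. poly (P k)) f sequentially \<longrightarrow>
        (\<lambda>k. op_poly (P k) T) \<longlonglongrightarrow> R" for R
      by (rule LIMSEQ_unique[OF that[rule_format, OF P] S])
  qed
  with S show ?thesis by simp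
qed

lemma op_fun_tendsto_apply:
  assumes "positive T" "continuous_on {0..norm T} f"
    "uniform_limit {0..norm T} (\<lambda>k. poly (P k)) f sequentially"
  shows "(\<lambda>k. op_poly (P k) T x) \<longlonglongrightarrow> op_fun f T x"
  by (rule bounded_linear.tendsto[OF blinfun.bounded_linear_left op_fun_tendsto[OF assms]])

lemma le_if_le_add_mult_eps:
  fixes a b c :: real
  assumes "c \<ge> 0" and "\<And>e. e > 0 \<Longrightarrow> a \<le> b + e * c"
  shows "a \<le> b"
proof (rule field_le_epsilon)
  fix e :: real assume "e > 0"
  then have "a \<le> b + (e / (c + 1)) * c" using assms by (intro assms(2)) simp
  also have "(e / (c + 1)) * c \<le> e" using assms(1) \<open>e > 0\<close> by (simp add: field_simps)
  finally show "a \<le> b + e" by simp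
qed

text \<open>An approximating polynomial of \<open>f\<close> exceeds \<open>Q - e\<close> on the spectral interval; positivity of
  polynomials passes to the limit.\<close>

lemma op_fun_ge_poly:
  assumes T: "positive T" and f: "continuous_on {0..norm T} f"
    and Q: "\<And>t. t \<in> {0..norm T} \<Longrightarrow> poly Q t \<le> f t"
  shows "Re (cinner (op_poly Q T x) x) \<le> Re (cinner (op_fun f T x) x)"
proof (rule le_if_le_add_mult_eps[where c = "(norm x)\<^sup>2"])
  fix e :: real assume e: "e > 0"
  obtain P where P: "uniform_limit {0..norm T} (\<lambda>k. poly (P k)) f sequentially"
    using polynomial_approximation[OF f] by blast
  have lim: "(\<lambda>k. Re (cinner (op_poly (P k) T x) x)) \<longlonglongrightarrow> Re (cinner (op_fun f T x) x)"
    by (intro tendsto_Re tendsto_cinner_left op_fun_tendsto_apply T f P)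
  have "\<forall>\<^sub>F k in sequentially. \<forall>t\<in>{0..norm T}. dist (poly (P k) t) (f t) < e"
    by (rule uniform_limitD[OF P e])
  then have "\<forall>\<^sub>F k in sequentially.
      Re (cinner (op_poly Q T x) x) - e * (norm x)\<^sup>2 \<le> Re (cinner (op_poly (P k) T x) x)"
  proof eventually_elim
    case (elim k)
    have "0 \<le> Re (cinner (op_poly ([:e:] + P k - Q) T x) x)"
    proof (rule op_poly_nonneg[OF T])
      fix t assume t: "t \<in> {0..norm T}"
      then have "\<bar>poly (P k) t - f t\<bar> < e" using elim by (auto simp: dist_real_def)
      then show "0 \<le> poly ([:e:] + P k - Q) t" using Q[OF t] by simp
    qed
    then show ?case
      by (simp add: op_poly_add op_poly_diff op_poly_const cinner_algebra Re_cinner_self)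
  qed
  from tendsto_lowerbound[OF lim this]
  show "Re (cinner (op_poly Q T x) x) \<le> Re (cinner (op_fun f T x) x) + e * (norm x)\<^sup>2" by simp
qed simp

lemma norm_op_poly_diff_op_fun_le:
  assumes T: "positive T" and f: "continuous_on {0..norm T} f"
    and Q: "\<And>t. t \<in> {0..norm T} \<Longrightarrow> \<bar>poly Q t - f t\<bar> \<le> M" and M: "M \<ge> 0"
  shows "norm (op_poly Q T - op_fun f T) \<le> M"
proof (rule field_le_epsilon)
  fix e :: real assume e: "e > 0"
  obtain P where P: "uniform_limit {0..norm T} (\<lambda>k. poly (P k)) f sequentially"
    using polynomial_approximation[OF f] by blast
  have lim: "(\<lambda>k. norm (op_poly Q T - op_poly (P k) T)) \<longlonglongrightarrow> norm (op_poly Q T - op_fun f T)"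
    by (intro tendsto_norm tendsto_diff tendsto_const op_fun_tendsto T f P)
  have "\<forall>\<^sub>F k in sequentially. \<forall>t\<in>{0..norm T}. dist (poly (P k) t) (f t) < e"
    by (rule uniform_limitD[OF P e])
  then have "\<forall>\<^sub>F k in sequentially. norm (op_poly Q T - op_poly (P k) T) \<le> M + e"
  proof eventually_elim
    case (elim k)
    show ?case
    proof (rule norm_op_poly_diff_le[OF T])
      fix t assume t: "t \<in> {0..norm T}"
      then have "\<bar>poly (P k) t - f t\<bar> < e" using elim by (auto simp: dist_real_def)
      then show "\<bar>poly Q t - poly (P k) t\<bar> \<le> M + e" using Q[OF t] by linarith
    qed (use M e in simp)
  qed
  from tendsto_upperbound[OF lim this] show "norm (op_poly Q T - op_fun f T) \<le> M + e" by simp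
qed

lemma op_fun_poly:
  assumes T: "positive T" and Q: "\<And>t. t \<in> {0..norm T} \<Longrightarrow> f t = poly Q t"
  shows "op_fun f T = op_poly Q T"
proof -
  have "continuous_on {0..norm T} (poly Q)" by (intro continuous_intros)
  then have "continuous_on {0..norm T} f" by (rule continuous_on_eq) (simp add: Q)
  then have "norm (op_poly Q T - op_fun f T) \<le> 0"
    by (rule norm_op_poly_diff_op_fun_le[OF T]) (simp_all add: Q)
  then show ?thesis by simp
qed

lemma hermitian_op_fun:
  assumes T: "positive T" and f: "continuous_on {0..norm T} f"
  shows "hermitian (op_fun f T)"
  unfolding hermitian_def
proof (intro allI)
  fix x y
  obtain P where P: "uniform_limit {0..norm T} (\<lambda>k. poly (P k)) f sequentially"
    using polynomial_approximation[OF f] by blast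
  note lim = op_fun_tendsto_apply[OF T f P]
  have "(\<lambda>k. cinner (op_poly (P k) T x) y) \<longlonglongrightarrow> cinner x (op_fun f T y)"
    unfolding hermitianD[OF hermitian_op_poly[OF positive_hermitian[OF T]]]
    by (rule tendsto_cinner_right[OF lim])
  then show "cinner (op_fun f T x) y = cinner x (op_fun f T y)"
    by (rule LIMSEQ_unique[OF tendsto_cinner_left[OF lim]])
qed

lemma positive_op_fun:
  assumes T: "positive T" and f: "continuous_on {0..norm T} f"
    and nonneg: "\<And>t. t \<in> {0..norm T} \<Longrightarrow> 0 \<le> f t"
  shows "positive (op_fun f T)"
  using op_fun_ge_poly[OF T f, of 0] nonneg hermitian_op_fun[OF T f] by (simp add: positive_def)

lemma op_fun_mult:
  assumes T: "positive T" and f: "continuous_on {0..norm T} f" and g: "continuous_on {0..norm T} g"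
  shows "op_fun f T (op_fun g T x) = op_fun (\<lambda>t. f t * g t) T x"
proof -
  obtain P Q where P: "uniform_limit {0..norm T} (\<lambda>k. poly (P k)) f sequentially"
    and Q: "uniform_limit {0..norm T} (\<lambda>k. poly (Q k)) g sequentially"
    using polynomial_approximation[OF f] polynomial_approximation[OF g] by blast
  have "uniform_limit {0..norm T} (\<lambda>k t. poly (P k) t * poly (Q k) t) (\<lambda>t. f t * g t) sequentially"
    by (intro uniform_lim_mult P Q compact_imp_bounded compact_continuous_image f g compact_Icc)
  then have PQ: "uniform_limit {0..norm T} (\<lambda>k. poly (P k * Q k)) (\<lambda>t. f t * g t) sequentially"
    by (simp add: poly_mult[abs_def])
  have fg: "continuous_on {0..norm T} (\<lambda>t. f t * g t)" by (intro continuous_on_mult f g)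
  have "(\<lambda>k. op_poly (P k) T (op_poly (Q k) T x)) \<longlonglongrightarrow> op_fun f T (op_fun g T x)"
    by (rule bounded_bilinear.tendsto[OF bounded_bilinear_blinfun_apply
          op_fun_tendsto[OF T f P] op_fun_tendsto_apply[OF T g Q]])
  moreover have "(\<lambda>k. op_poly (P k) T (op_poly (Q k) T x)) \<longlonglongrightarrow> op_fun (\<lambda>t. f t * g t) T x"
    using op_fun_tendsto_apply[OF T fg PQ, of x] by (simp only: op_poly_mult)
  ultimately show ?thesis by (rule LIMSEQ_unique)
qed

section \<open>Absolute value and powers\<close>

lemma continuous_on_powr_nonneg: "r > 0 \<Longrightarrow> continuous_on {0..c} (\<lambda>t::real. t powr r)"
  by (intro continuous_on_powr' continuous_intros) auto

lemma positive_op_powr: "positive T \<Longrightarrow> r > 0 \<Longrightarrow> positive (op_powr T r)"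
  unfolding op_powr_def by (intro positive_op_fun continuous_on_powr_nonneg) auto

lemma op_abs:
  assumes A: "complex_linear A"
  shows positive_op_abs: "positive (op_abs A)"
    and cinner_op_abs: "cinner (op_abs A x) (op_abs A y) = cinner (A x) (A y)"
proof -
  define T where "T = cadjoint A o\<^sub>L A"
  have Txy: "cinner x (T y) = cinner (A x) (A y)" for x y
    by (simp add: T_def cinner_cadjoint[OF A])
  then have Txy': "cinner (T x) y = cinner (A x) (A y)" for x y
    by (metis cinner_commute)
  have T: "positive T"
    by (simp add: positive_def hermitian_def Txy Txy' Re_cinner_self)
  note c = continuous_on_powr_nonneg[of "1/2" "norm T"]
  have S: "op_abs A = op_fun (\<lambda>t. t powr (1/2)) T"
    by (simp add: op_abs_def op_powr_def T_def)
  show pos: "positive (op_abs A)"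
    unfolding S by (rule positive_op_fun[OF T]) (simp_all add: c)
  have "op_abs A (op_abs A x) = op_fun (\<lambda>t. t powr (1/2) * t powr (1/2)) T x"
    unfolding S by (rule op_fun_mult[OF T]) (simp_all add: c)
  also have "op_fun (\<lambda>t. t powr (1/2) * t powr (1/2)) T = op_poly [:0,1:] T"
    by (rule op_fun_poly[OF T]) (simp add: powr_add[symmetric])
  finally have "op_abs A (op_abs A x) = T x" by (simp add: op_poly_linear)
  then show "cinner (op_abs A x) (op_abs A y) = cinner (A x) (A y)"
    using hermitianD[OF positive_hermitian[OF pos], of "op_abs A x" y] by (simp add: Txy')
qed

lemma norm_op_abs: "complex_linear A \<Longrightarrow> norm (op_abs A x) = norm (A x)"
  using cinner_op_abs[of A x x] unfolding cinner_norm of_real_eq_iff by simp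

lemma powr_above_tangent:
  fixes t l p :: real
  assumes "t \<ge> 0" "l > 0" "p \<ge> 1"
  shows "l powr p + p * l powr (p - 1) * (t - l) \<le> t powr p"
proof (cases "t = 0")
  case True
  have "l powr (p - 1) * l = l powr p" using assms by (simp add: powr_diff)
  moreover have "p * l powr (p - 1) * (t - l) = - (p * (l powr (p - 1) * l))"
    using True by simp
  ultimately have "p * l powr (p - 1) * (t - l) = - (p * l powr p)" by (simp only:)
  moreover have "1 * l powr p \<le> p * l powr p" using assms by (intro mult_right_mono) auto
  moreover have "t powr p = 0" using True by simp
  ultimately show ?thesis by linarith
next
  case False
  have "p * l powr (p - 1) * (t - l) \<le> t powr p - l powr p"
  proof (rule convex_on_imp_above_tangent)
    show "convex_on {0<..} (\<lambda>x. x powr p)" using assms by (intro powr_convex) simp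
    show "((\<lambda>x. x powr p) has_real_derivative p * l powr (p - 1)) (at l within {0<..})"
      using assms by (auto intro!: derivative_eq_intros)
    show "l \<in> interior {0<..}" using assms by (simp add: interior_open)
  qed (use assms False in auto)
  then show ?thesis by simp
qed

text \<open>Jensen's inequality for the spectral measure of the unit vector \<open>v\<close>: the tangent of the convex
  function \<open>t\<^bsup>p\<^esup>\<close> at the mean \<open>\<langle>S v, v\<rangle>\<close> lies below the function, and its value at \<open>S\<close> has expectation
  \<open>\<langle>S v, v\<rangle>\<^bsup>p\<^esup>\<close> in the state \<open>v\<close>.\<close>

lemma op_powr_Jensen:
  assumes S: "positive S" and p: "p \<ge> 1" and v: "norm v = 1"
  shows "Re (cinner (S v) v) powr p \<le> Re (cinner (op_powr S p v) v)"
proof (cases "Re (cinner (S v) v) = 0")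
  case True
  then show ?thesis using positiveD[OF positive_op_powr[OF S, of p]] p by simp
next
  case False
  define l where "l = Re (cinner (S v) v)"
  have l: "l > 0" using False positiveD[OF S, of v] by (simp add: l_def)
  define m where "m = p * l powr (p - 1)"
  have "Re (cinner (op_poly [:l powr p - m * l, m:] S v) v) \<le> Re (cinner (op_powr S p v) v)"
    unfolding op_powr_def
  proof (rule op_fun_ge_poly[OF S])
    fix t assume "t \<in> {0..norm S}"
    then show "poly [:l powr p - m * l, m:] t \<le> t powr p"
      using powr_above_tangent[OF _ l p, of t] by (simp add: m_def algebra_simps)
  qed (use p in \<open>simp add: continuous_on_powr_nonneg\<close>)
  moreover have "Re (cinner (op_poly [:l powr p - m * l, m:] S v) v) = l powr p"
    by (simp add: op_poly_linear cinner_algebra Re_cinner_self v l_def[symmetric])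
  ultimately show ?thesis by (simp add: l_def)
qed

definition contraction :: "('a::complex_hilbert_space \<Rightarrow> 'a) \<Rightarrow> bool"
  where "contraction W \<longleftrightarrow> clinear W \<and> (\<forall>x. norm (W x) \<le> norm x)"

lemma contractionD: "contraction W \<Longrightarrow> clinear W" "contraction W \<Longrightarrow> norm (W x) \<le> norm x"
  by (simp_all add: contraction_def)

text \<open>The contraction \<open>W = B (\<bar>B\<bar> + d)\<inverse>\<close> does the work of the partial isometry in \<open>B = W \<bar>B\<bar>\<close> up
  to an error \<open>d\<close>, and is available from the functional calculus alone. It serves in two ways:
  \<open>W \<bar>B\<bar>\<close> approximates \<open>B\<close>, and pairing \<open>B x\<close> with \<open>W x\<close> recovers \<open>\<langle>\<bar>B\<bar> x, x\<rangle>\<close>.\<close>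

lemma approximate_polar_decomposition:
  fixes B :: "'a::complex_hilbert_space \<Rightarrow>\<^sub>L 'a"
  assumes B: "complex_linear B" and d: "d > 0"
  shows "\<exists>W. contraction W \<and>
    (\<forall>x. norm (W (op_abs B x) - B x) \<le> d * norm x) \<and>
    (\<forall>x. cmod (cinner (B x) (W x) - cinner (op_abs B x) x) \<le> d * (norm x)\<^sup>2)"
proof -
  define S where "S = op_abs B"
  have S: "positive S" unfolding S_def by (rule positive_op_abs[OF B])
  \<comment> \<open>\<open>H\<close> is the inverse of \<open>S + d\<close>, where \<open>S = \<bar>B\<bar>\<close>.\<close>
  define H where "H = op_fun (\<lambda>t. 1 / (t + d)) S"
  have cont: "continuous_on {0..norm S} (\<lambda>t. 1 / (t + d))"
    using d by (intro continuous_intros) auto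
  have contl: "continuous_on {0..norm S} (\<lambda>t. t + d)" by (intro continuous_intros)
  have lin: "op_fun (\<lambda>t. t + d) S x = S x + d *\<^sub>R x" for x
    using op_fun_poly[OF S, of "\<lambda>t. t + d" "[:d,1:]"] by (simp add: op_poly_linear add.commute)
  have one: "op_fun f S x = x" if "\<And>t. t \<in> {0..norm S} \<Longrightarrow> f t = 1" for f x
    using op_fun_poly[OF S, of f 1] that by simp
  have SH: "S (H x) + d *\<^sub>R H x = x" for x
    unfolding lin[symmetric] H_def op_fun_mult[OF S contl cont] using d by (intro one) auto
  have HS: "H (S x) = x - d *\<^sub>R H x" for x
  proof -
    have "H (S x + d *\<^sub>R x) = x"
      unfolding lin[symmetric] H_def op_fun_mult[OF S cont contl] using d by (intro one) auto
    then show ?thesis by (simp add: blinfun.add_right blinfun.scaleR_right eq_diff_eq)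
  qed
  have SH_le: "norm (S (H x)) \<le> norm x" for x
  proof -
    have "(norm (S (H x)))\<^sup>2 \<le> (norm (S (H x)))\<^sup>2 + 2 * (d * Re (cinner (S (H x)) (H x))) + (norm (d *\<^sub>R H x))\<^sup>2"
      using positiveD[OF S, of "H x"] d by simp
    also have "\<dots> = (norm (S (H x) + d *\<^sub>R H x))\<^sup>2"
      by (simp add: norm_add_square cinner_algebra)
    finally have "(norm (S (H x)))\<^sup>2 \<le> (norm x)\<^sup>2" by (simp only: SH)
    then show ?thesis by (rule power2_le_imp_le) simp
  qed
  define W where "W x = B (H x)" for x
  have W_le: "norm (W x) \<le> norm x" for x
    using SH_le[of x] by (simp add: W_def S_def norm_op_abs[OF B])
  have "clinear W"
    using hermitian_clinear[OF hermitian_op_fun[OF S cont]] B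
    unfolding W_def H_def[symmetric] clinear_def complex_linear_def by (simp add: blinfun.add_right)
  moreover have "norm (W (S x) - B x) \<le> d * norm x" for x
  proof -
    have "W (S x) - B x = - d *\<^sub>R W x"
      by (simp add: W_def HS blinfun.diff_right blinfun.scaleR_right)
    then have "norm (W (S x) - B x) = d * norm (W x)" using d by simp
    also have "\<dots> \<le> d * norm x" using W_le[of x] d by simp
    finally show ?thesis .
  qed
  moreover have "cmod (cinner (B x) (W x) - cinner (S x) x) \<le> d * (norm x)\<^sup>2" for x
  proof -
    have "S (H x) = x - d *\<^sub>R H x" using SH[of x] by (simp add: eq_diff_eq)
    then have "cinner (B x) (W x) = cinner (S x) (x - d *\<^sub>R H x)"
      using cinner_op_abs[OF B, of x "H x"] by (simp add: W_def S_def)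
    also have "\<dots> = cinner (S x) x - of_real d * cinner x (S (H x))"
      by (simp add: cinner_algebra hermitianD[OF positive_hermitian[OF S]])
    finally have "cmod (cinner (B x) (W x) - cinner (S x) x) = d * cmod (cinner x (S (H x)))"
      using d by (simp add: norm_mult)
    also have "\<dots> \<le> d * (norm x * norm x)"
      using d SH_le[of x] by (intro mult_left_mono order_trans[OF norm_cinner_le]) (auto intro: mult_left_mono)
    finally show ?thesis by (simp add: power2_eq_square)
  qed
  ultimately show ?thesis using W_le unfolding S_def contraction_def by blast
qed

section \<open>Three lines\<close>

text \<open>The factor \<open>exp (e (z\<^sup>2 - 1))\<close> decays along the strip and has modulus at most 1 in it. On
  a tall rectangle the damped function is therefore at most 1 on the whole boundary, hence
  inside; then \<open>e\<close> tends to 0.\<close>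

lemma three_lines_unit:
  assumes hol: "f holomorphic_on UNIV"
    and bound: "\<And>z. 0 \<le> Re z \<Longrightarrow> Re z \<le> 1 \<Longrightarrow> cmod (f z) \<le> C"
    and left: "\<And>z. Re z = 0 \<Longrightarrow> cmod (f z) \<le> 1" and right: "\<And>z. Re z = 1 \<Longrightarrow> cmod (f z) \<le> 1"
    and x: "0 \<le> x" "x \<le> 1"
  shows "cmod (f (of_real x)) \<le> 1"
proof -
  have main: "cmod (f (of_real x)) \<le> exp e" if e: "e > 0" for e
  proof -
    define g where "g z = f z * exp (of_real e * (z\<^sup>2 - 1))" for z
    have norm_g: "cmod (g z) = cmod (f z) * exp (e * ((Re z)\<^sup>2 - (Im z)\<^sup>2 - 1))" for z
      by (simp add: g_def norm_mult power2_eq_square)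
    \<comment> \<open>Half the height of the rectangle: it makes the damping factor at most \<open>exp (- \<bar>C\<bar>)\<close> on
      the horizontal sides.\<close>
    define R where "R = sqrt (\<bar>C\<bar> / e)"
    have R: "R \<ge> 0" "R\<^sup>2 = \<bar>C\<bar> / e" using e by (simp_all add: R_def)
    let ?S = "cbox (Complex 0 (- R)) (Complex 1 R)"
    have "cmod (g (of_real x)) \<le> 1"
    proof (rule maximum_modulus_frontier[of g ?S])
      have "g holomorphic_on UNIV" unfolding g_def by (intro holomorphic_intros hol)
      then show "g holomorphic_on interior ?S" "continuous_on (closure ?S) g"
        by (auto intro: holomorphic_on_subset holomorphic_on_imp_continuous_on)
      show "cmod (g z) \<le> 1" if z: "z \<in> frontier ?S" for z
      proof -
        have z: "0 \<le> Re z" "Re z \<le> 1" "\<bar>Im z\<bar> \<le> R" "Re z = 0 \<or> Re z = 1 \<or> \<bar>Im z\<bar> = R"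
          using z by (auto simp: frontier_cbox in_cbox_complex_iff in_box_complex_iff)
        have "(Re z)\<^sup>2 \<le> 1" using z by (simp add: abs_square_le_1)
        then have ex: "e * ((Re z)\<^sup>2 - (Im z)\<^sup>2 - 1) \<le> - (e * (Im z)\<^sup>2)"
          using e by (simp add: algebra_simps)
        show ?thesis
        proof (cases "\<bar>Im z\<bar> = R")
          case True
          then have "(Im z)\<^sup>2 = \<bar>C\<bar> / e" using R by (metis power2_abs)
          then have "exp (e * ((Re z)\<^sup>2 - (Im z)\<^sup>2 - 1)) \<le> exp (- \<bar>C\<bar>)"
            using ex e by simp
          then have "cmod (g z) \<le> \<bar>C\<bar> * exp (- \<bar>C\<bar>)"
            unfolding norm_g using bound[OF z(1,2)] by (intro mult_mono) auto
          also have "\<bar>C\<bar> \<le> exp \<bar>C\<bar>"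
            using exp_ge_add_one_self[of "\<bar>C\<bar>"] by linarith
          then have "\<bar>C\<bar> * exp (- \<bar>C\<bar>) \<le> exp \<bar>C\<bar> * exp (- \<bar>C\<bar>)"
            by (rule mult_right_mono) simp
          also have "\<dots> = 1" by (simp add: exp_minus)
          finally show ?thesis .
        next
          case False
          then have "cmod (f z) \<le> 1" using z left right by auto
          moreover have "e * ((Re z)\<^sup>2 - (Im z)\<^sup>2 - 1) \<le> 0"
            using ex e by (meson mult_nonneg_nonneg neg_le_0_iff_le less_imp_le order_trans zero_le_power2)
          then have "exp (e * ((Re z)\<^sup>2 - (Im z)\<^sup>2 - 1)) \<le> 1" by simp
          ultimately show ?thesis unfolding norm_g by (intro mult_le_one) auto
        qed
      qed
      show "of_real x \<in> ?S" using x R by (simp add: in_cbox_complex_iff)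
    qed (rule bounded_cbox)
    moreover have "cmod (g (of_real x)) = cmod (f (of_real x)) * exp (e * (x\<^sup>2 - 1))"
      by (simp add: norm_g)
    moreover have "exp (- e) \<le> exp (e * (x\<^sup>2 - 1))" using e by (simp add: algebra_simps)
    ultimately have "cmod (f (of_real x)) * exp (- e) \<le> 1"
      by (metis mult_left_mono norm_ge_zero order_trans)
    then show ?thesis by (simp add: exp_minus field_simps)
  qed
  show ?thesis
  proof (rule tendsto_lowerbound)
    show "((\<lambda>e. exp e) \<longlongrightarrow> 1) (at_right (0::real))"
      by (rule tendsto_eq_intros | simp)+
    show "\<forall>\<^sub>F e in at_right 0. cmod (f (of_real x)) \<le> exp e"
      using main by (auto simp: eventually_at_right_field intro: exI[of _ 1])
  qed simp
qed

lemma three_lines: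
  assumes hol: "f holomorphic_on UNIV"
    and bound: "\<And>z. 0 \<le> Re z \<Longrightarrow> Re z \<le> 1 \<Longrightarrow> cmod (f z) \<le> C"
    and left: "\<And>z. Re z = 0 \<Longrightarrow> cmod (f z) \<le> A" and right: "\<And>z. Re z = 1 \<Longrightarrow> cmod (f z) \<le> B"
    and pos: "A > 0" "B > 0" and x: "0 \<le> x" "x \<le> 1"
  shows "cmod (f (of_real x)) \<le> A powr (1 - x) * B powr x"
proof -
  define g where "g z = f z * (of_real (1 / A) powr (1 - z) * of_real (1 / B) powr z)" for z
  have norm_g: "cmod (g z) = cmod (f z) * ((1 / A) powr (1 - Re z) * (1 / B) powr Re z)" for z
    using pos by (simp add: g_def norm_mult norm_powr_real_powr)
  have le: "(1 / a) powr y \<le> 1 + 1 / a" if "a > 0" "0 \<le> y" "y \<le> 1" for a y :: real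
  proof (cases "1 / a \<le> 1")
    case True
    then have "(1 / a) powr y \<le> 1" using that by (intro powr_le1) auto
    then show ?thesis using that by (simp add: add_increasing2)
  next
    case False
    then have "(1 / a) powr y \<le> (1 / a) powr 1" using that by (intro powr_mono) auto
    then show ?thesis using that by simp
  qed
  have "cmod (g (of_real x)) \<le> 1"
  proof (rule three_lines_unit[OF _ _ _ _ x])
    show "g holomorphic_on UNIV" unfolding g_def by (intro holomorphic_intros hol)
    show "cmod (g z) \<le> C * ((1 + 1 / A) * (1 + 1 / B))" if "0 \<le> Re z" "Re z \<le> 1" for z
      unfolding norm_g using that pos bound[OF that]
      by (intro mult_mono le) (auto intro: order_trans[OF norm_ge_zero])
    show "cmod (g z) \<le> 1" if "Re z = 0" for z
      using left[OF that] pos by (simp add: norm_g that)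
    show "cmod (g z) \<le> 1" if "Re z = 1" for z
      using right[OF that] pos by (simp add: norm_g that)
  qed
  moreover have "(1 / A) powr (1 - x) * (1 / B) powr x = 1 / (A powr (1 - x) * B powr x)"
    using pos by (simp add: powr_divide)
  ultimately have "cmod (f (of_real x)) * (1 / (A powr (1 - x) * B powr x)) \<le> 1"
    by (simp only: norm_g Re_complex_of_real)
  then show ?thesis using pos by (simp add: pos_divide_le_eq)
qed

section \<open>The interpolated bilinear inequality\<close>

text \<open>The sum is the pairing of \<open>u\<close> with \<open>W y\<close>, where \<open>y\<close> has the coordinates
  \<open>cnj (t g \<langle>g, h\<rangle>)\<close>: an operator with singular values at most \<open>c\<close> has norm at most \<open>c\<close>.\<close>

lemma contraction_form_le:
  assumes G: "orthonormal G" "finite G" and W: "contraction W"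
    and t: "\<And>g. g \<in> G \<Longrightarrow> cmod (t g) \<le> c" and c: "c \<ge> 0" and h: "norm h \<le> 1" and u: "norm u \<le> 1"
  shows "cmod (\<Sum>g\<in>G. t g * (cinner g h * cinner u (W g))) \<le> c"
proof -
  define y where "y = (\<Sum>g\<in>G. cnj (t g * cinner g h) *\<^sub>C g)"
  have "(norm y)\<^sup>2 = (\<Sum>g\<in>G. (cmod (t g))\<^sup>2 * (cmod (cinner g h))\<^sup>2)"
    unfolding y_def norm_sum_orthonormal[OF G] by (simp add: norm_mult power_mult_distrib)
  also have "\<dots> \<le> (\<Sum>g\<in>G. c\<^sup>2 * (cmod (cinner h g))\<^sup>2)"
    using t by (intro sum_mono mult_mono) (auto simp: norm_cinner_commute[of h] power_mono)
  also have "\<dots> \<le> c\<^sup>2 * (norm h)\<^sup>2"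
    unfolding sum_distrib_left[symmetric] by (intro mult_left_mono Bessel G) simp
  also have "\<dots> \<le> c\<^sup>2" using h by (simp add: mult_left_le power_le_one)
  finally have y: "norm y \<le> c" by (rule power2_le_imp_le) (rule c)
  have "(\<Sum>g\<in>G. t g * (cinner g h * cinner u (W g))) = cinner u (W y)"
    unfolding y_def clinear_sum_scaleC[OF contractionD(1)[OF W]] cinner_sum_right
    by (simp add: cinner_scaleC_right mult.assoc)
  also have "cmod \<dots> \<le> norm u * norm (W y)" by (rule norm_cinner_le)
  also have "\<dots> \<le> 1 * c" using u contractionD(2)[OF W, of y] y by (intro mult_mono) auto
  finally show ?thesis by simp
qed

lemma powr_le_endpoint_sum:
  fixes s :: real
  assumes "s \<ge> 0" "a \<le> x" "x \<le> b"
  shows "s powr x \<le> s powr a + s powr b"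
proof (cases "s \<le> 1")
  case True
  then have "s powr x \<le> s powr a" using assms by (intro powr_mono') auto
  then show ?thesis by (simp add: add_increasing2)
next
  case False
  then have "s powr x \<le> s powr b" using assms by (intro powr_mono) auto
  then show ?thesis by (simp add: add_increasing)
qed

text \<open>The weights \<open>s j h\<close> and \<open>t i g\<close> play the role of the singular values of the finite-rank
  operators \<open>A j x = \<Sum>h\<in>H j. s j h \<langle>x, h\<rangle> V j h\<close> and \<open>X i x = \<Sum>g\<in>G i. t i g \<langle>x, W i g\<rangle> g\<close>, and
  \<open>form s t\<close> below is \<open>\<Sum>i j. \<epsilon> i j tr (A j X i)\<close>. Only the weights vary in the interpolation.
  The common subspace, the span of \<open>F\<close>, makes Hilbert-Schmidt norms comparable by a change of
  basis. The matrix \<open>\<epsilon>\<close> enters through the bound 1 on its entries, for the exponents 1 and \<open>\<infinity>\<close>,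
  and through the bound \<open>sqrt N\<close> on its norm, for the exponent 2.\<close>

locale orthogonal_form =
  fixes F :: "'h::complex_hilbert_space set" and I :: "'i set" and J :: "'j set"
    and \<epsilon> :: "'i \<Rightarrow> 'j \<Rightarrow> real" and N :: real
    and G :: "'i \<Rightarrow> 'h set" and H :: "'j \<Rightarrow> 'h set"
    and W :: "'i \<Rightarrow> 'h \<Rightarrow> 'h" and V :: "'j \<Rightarrow> 'h \<Rightarrow> 'h"
  assumes F: "orthonormal F" "finite F" and fin: "finite I" "finite J"
    and eps: "\<And>i j. i \<in> I \<Longrightarrow> j \<in> J \<Longrightarrow> \<bar>\<epsilon> i j\<bar> \<le> 1" and N: "N > 0"
    and eps_orth: "\<And>x :: 'j \<Rightarrow> 'h. (\<Sum>i\<in>I. (norm (\<Sum>j\<in>J. \<epsilon> i j *\<^sub>R x j))\<^sup>2) \<le> N * (\<Sum>j\<in>J. (norm (x j))\<^sup>2)"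
    and G: "\<And>i. i \<in> I \<Longrightarrow> orthonormal (G i)" "\<And>i. i \<in> I \<Longrightarrow> finite (G i)"
      "\<And>i g. i \<in> I \<Longrightarrow> g \<in> G i \<Longrightarrow> proj F g = g"
    and H: "\<And>j. j \<in> J \<Longrightarrow> orthonormal (H j)" "\<And>j. j \<in> J \<Longrightarrow> finite (H j)"
      "\<And>j h. j \<in> J \<Longrightarrow> h \<in> H j \<Longrightarrow> proj F h = h"
    and W: "\<And>i. i \<in> I \<Longrightarrow> contraction (W i)" and V: "\<And>j. j \<in> J \<Longrightarrow> contraction (V j)"
begin

definition form :: "('j \<Rightarrow> 'h \<Rightarrow> complex) \<Rightarrow> ('i \<Rightarrow> 'h \<Rightarrow> complex) \<Rightarrow> complex"
  where "form s t = (\<Sum>i\<in>I. \<Sum>j\<in>J. \<Sum>h\<in>H j. \<Sum>g\<in>G i.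
    of_real (\<epsilon> i j) * s j h * (t i g * (cinner g h * cinner (V j h) (W i g))))"

text \<open>The endpoint with trace norms for \<open>A j\<close> and operator norms for \<open>X i\<close>: each rank one term
  of \<open>A j\<close> contributes at most its weight times the norm of \<open>X i\<close>.\<close>

lemma form_le_trace_bound:
  assumes t: "\<And>i g. i \<in> I \<Longrightarrow> g \<in> G i \<Longrightarrow> cmod (t i g) \<le> c i" and c: "\<And>i. i \<in> I \<Longrightarrow> c i \<ge> 0"
  shows "cmod (form s t) \<le> (\<Sum>j\<in>J. \<Sum>h\<in>H j. cmod (s j h)) * (\<Sum>i\<in>I. c i)"
proof -
  have "cmod (form s t) \<le> (\<Sum>i\<in>I. \<Sum>j\<in>J. \<Sum>h\<in>H j. cmod (s j h) * c i)"
    unfolding form_def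
  proof (intro sum_norm_le)
    fix i j h assume i: "i \<in> I" and j: "j \<in> J" and h: "h \<in> H j"
    have "norm h = 1" using H(1)[OF j] h by (rule orthonormal_norm)
    moreover have "norm (V j h) \<le> 1" using contractionD(2)[OF V[OF j], of h] \<open>norm h = 1\<close> by simp
    ultimately have *: "cmod (\<Sum>g\<in>G i. t i g * (cinner g h * cinner (V j h) (W i g))) \<le> c i"
      using i by (intro contraction_form_le G W t c) auto
    have "cmod (\<Sum>g\<in>G i. of_real (\<epsilon> i j) * s j h * (t i g * (cinner g h * cinner (V j h) (W i g))))
        = \<bar>\<epsilon> i j\<bar> * cmod (s j h) * cmod (\<Sum>g\<in>G i. t i g * (cinner g h * cinner (V j h) (W i g)))"
      by (simp add: sum_distrib_left[symmetric] norm_mult)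
    also have "\<dots> \<le> (1 * cmod (s j h)) * c i"
      using eps[OF i j] * by (intro mult_mono) auto
    finally show "cmod (\<Sum>g\<in>G i. of_real (\<epsilon> i j) * s j h * (t i g * (cinner g h * cinner (V j h) (W i g))))
        \<le> cmod (s j h) * c i" by simp
  qed
  also have "\<dots> = (\<Sum>j\<in>J. \<Sum>h\<in>H j. cmod (s j h)) * (\<Sum>i\<in>I. c i)"
    by (simp add: sum_distrib_left sum_distrib_right)
  finally show ?thesis .
qed

definition op :: "('j \<Rightarrow> 'h \<Rightarrow> complex) \<Rightarrow> 'j \<Rightarrow> 'h \<Rightarrow> 'h"
  where "op s j x = (\<Sum>h\<in>H j. (s j h * cinner x h) *\<^sub>C V j h)"

lemma clinear_op: "clinear (op s j)"
  unfolding clinear_def op_def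
  by (simp add: cinner_algebra distrib_left scaleC_add_left sum.distrib scaleC_sum_right
      scaleC_scaleC mult.left_commute)

text \<open>In a basis of the span of \<open>F\<close> that extends \<open>H j\<close>, only the vectors of \<open>H j\<close> contribute.\<close>

lemma op_Hilbert_Schmidt:
  assumes j: "j \<in> J"
  shows "(\<Sum>e\<in>F. (norm (op s j e))\<^sup>2) \<le> (\<Sum>h\<in>H j. (cmod (s j h))\<^sup>2)"
proof -
  obtain B where B: "H j \<subseteq> B" "orthonormal B" "finite B" "proj B = proj F"
    using orthonormal_extension[OF F H(1)[OF j] H(2)[OF j] H(3)[OF j]] by auto
  have "(\<Sum>e\<in>F. (norm (op s j e))\<^sup>2) = (\<Sum>b\<in>B. (norm (op s j b))\<^sup>2)"
    by (rule square_norms_basis_independent[OF F B(2,3) B(4)[symmetric] clinear_op])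
  also have "\<dots> = (\<Sum>h\<in>H j. (norm (op s j h))\<^sup>2)"
  proof (rule sum.mono_neutral_right[OF B(3,1)], rule ballI)
    fix b assume b: "b \<in> B - H j"
    then have "cinner b h = 0" if "h \<in> H j" for h
      using that B(1) orthonormal_cinner[OF B(2), of b h] by auto
    then show "(norm (op s j b))\<^sup>2 = 0" by (simp add: op_def)
  qed
  also have "\<dots> \<le> (\<Sum>h\<in>H j. (cmod (s j h))\<^sup>2)"
  proof (rule sum_mono)
    fix h assume h: "h \<in> H j"
    have "op s j h = (\<Sum>k\<in>H j. if k = h then s j h *\<^sub>C V j h else 0)"
      unfolding op_def using h by (intro sum.cong) (auto simp: orthonormal_cinner[OF H(1)[OF j]])
    then have "op s j h = s j h *\<^sub>C V j h" using h H(2)[OF j] by simp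
    then have "norm (op s j h) \<le> cmod (s j h) * 1"
      using contractionD(2)[OF V[OF j], of h] orthonormal_norm[OF H(1)[OF j] h]
      by (simp only: norm_scaleC) (intro mult_left_mono, auto)
    then show "(norm (op s j h))\<^sup>2 \<le> (cmod (s j h))\<^sup>2" by simp
  qed
  finally show ?thesis .
qed

text \<open>The endpoint with Hilbert-Schmidt norms. By Cauchy-Schwarz the form is controlled by the
  operators \<open>b i = \<Sum>j. \<epsilon> i j A j\<close>, evaluated on \<open>G i\<close>. Passing from \<open>G i\<close> to the common basis
  \<open>F\<close> allows the norm of \<open>\<epsilon>\<close> to be used vector by vector.\<close>

lemma form_le_Hilbert_Schmidt_bound:
  "cmod (form s t) \<le> sqrt (N * (\<Sum>j\<in>J. \<Sum>h\<in>H j. (cmod (s j h))\<^sup>2)) * sqrt (\<Sum>i\<in>I. \<Sum>g\<in>G i. (cmod (t i g))\<^sup>2)"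
proof -
  define b where "b i x = (\<Sum>j\<in>J. \<epsilon> i j *\<^sub>R op s j x)" for i x
  have lin: "clinear (b i)" for i
    unfolding clinear_def b_def
    by (simp add: clinear_add[OF clinear_op] clinear_scaleC[OF clinear_op] scaleR_right_distrib
        sum.distrib scaleC_sum_right scaleC_of_real[symmetric] scaleC_scaleC scaleC_add_right mult.commute)
  have trace: "(\<Sum>g\<in>G i. (norm (b i g))\<^sup>2) \<le> (\<Sum>e\<in>F. (norm (b i e))\<^sup>2)" if i: "i \<in> I" for i
  proof -
    obtain B where B: "G i \<subseteq> B" "orthonormal B" "finite B" "proj B = proj F"
      using orthonormal_extension[OF F G(1)[OF i] G(2)[OF i] G(3)[OF i]] by auto
    have "(\<Sum>e\<in>F. (norm (b i e))\<^sup>2) = (\<Sum>g\<in>B. (norm (b i g))\<^sup>2)"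
      by (rule square_norms_basis_independent[OF F B(2,3) B(4)[symmetric] lin])
    also have "\<dots> \<ge> (\<Sum>g\<in>G i. (norm (b i g))\<^sup>2)"
      using B by (intro sum_mono2) auto
    finally show ?thesis .
  qed
  have "(\<Sum>i\<in>I. \<Sum>g\<in>G i. (norm (b i g))\<^sup>2) \<le> (\<Sum>i\<in>I. \<Sum>e\<in>F. (norm (b i e))\<^sup>2)"
    by (intro sum_mono trace)
  also have "\<dots> = (\<Sum>e\<in>F. \<Sum>i\<in>I. (norm (b i e))\<^sup>2)" by (rule sum.swap)
  also have "\<dots> \<le> (\<Sum>e\<in>F. N * (\<Sum>j\<in>J. (norm (op s j e))\<^sup>2))"
    unfolding b_def by (intro sum_mono eps_orth)
  also have "\<dots> = N * (\<Sum>j\<in>J. \<Sum>e\<in>F. (norm (op s j e))\<^sup>2)"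
    by (simp only: sum_distrib_left[symmetric] sum.swap[of _ F J])
  also have "\<dots> \<le> N * (\<Sum>j\<in>J. \<Sum>h\<in>H j. (cmod (s j h))\<^sup>2)"
    using N by (intro mult_left_mono sum_mono op_Hilbert_Schmidt) auto
  finally have HS: "(\<Sum>i\<in>I. \<Sum>g\<in>G i. (norm (b i g))\<^sup>2) \<le> N * (\<Sum>j\<in>J. \<Sum>h\<in>H j. (cmod (s j h))\<^sup>2)" .
  have "form s t = (\<Sum>i\<in>I. \<Sum>g\<in>G i. t i g * cinner (b i g) (W i g))"
  proof -
    have "(\<Sum>j\<in>J. \<Sum>h\<in>H j. \<Sum>g\<in>G i. of_real (\<epsilon> i j) * s j h * (t i g * (cinner g h * cinner (V j h) (W i g))))
        = (\<Sum>g\<in>G i. t i g * cinner (b i g) (W i g))" for i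
    proof -
      have "(\<Sum>j\<in>J. \<Sum>h\<in>H j. \<Sum>g\<in>G i. of_real (\<epsilon> i j) * s j h * (t i g * (cinner g h * cinner (V j h) (W i g))))
        = (\<Sum>g\<in>G i. \<Sum>j\<in>J. \<Sum>h\<in>H j. of_real (\<epsilon> i j) * s j h * (t i g * (cinner g h * cinner (V j h) (W i g))))"
        by (simp only: sum.swap[of _ "G i"])
      also have "\<dots> = (\<Sum>g\<in>G i. t i g * cinner (b i g) (W i g))"
        unfolding b_def op_def
        by (simp add: cinner_sum_left cinner_algebra sum_distrib_left mult_ac)
      finally show ?thesis .
    qed
    then show ?thesis by (simp add: form_def)
  qed
  also have "cmod \<dots> \<le> (\<Sum>i\<in>I. \<Sum>g\<in>G i. cmod (t i g) * norm (b i g))"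
  proof (intro sum_norm_le)
    fix i g assume i: "i \<in> I" and g: "g \<in> G i"
    have "norm (W i g) \<le> 1" using contractionD(2)[OF W[OF i], of g] orthonormal_norm[OF G(1)[OF i] g] by simp
    then have "norm (b i g) * norm (W i g) \<le> norm (b i g)" by (rule mult_left_le) simp
    then have "cmod (cinner (b i g) (W i g)) \<le> norm (b i g)"
      by (rule order_trans[OF norm_cinner_le])
    then show "cmod (t i g * cinner (b i g) (W i g)) \<le> cmod (t i g) * norm (b i g)"
      by (simp add: norm_mult mult_left_mono)
  qed
  also have "\<dots> = (\<Sum>(i, g)\<in>Sigma I G. cmod (t i g) * norm (b i g))"
    using fin G by (intro sum.Sigma) auto
  also have "\<dots> \<le> sqrt (\<Sum>(i, g)\<in>Sigma I G. (cmod (t i g))\<^sup>2) * sqrt (\<Sum>(i, g)\<in>Sigma I G. (norm (b i g))\<^sup>2)"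
    unfolding real_sqrt_mult[symmetric]
    by (rule real_le_rsqrt)
      (use Cauchy_Schwarz_ineq_sum[of "\<lambda>(i,g). cmod (t i g)" "\<lambda>(i,g). norm (b i g)" "Sigma I G"]
        in \<open>simp add: case_prod_unfold\<close>)
  also have "\<dots> = sqrt (\<Sum>i\<in>I. \<Sum>g\<in>G i. (cmod (t i g))\<^sup>2) * sqrt (\<Sum>i\<in>I. \<Sum>g\<in>G i. (norm (b i g))\<^sup>2)"
    using fin G by (subst (1 2) sum.Sigma) auto
  also have "\<dots> \<le> sqrt (\<Sum>i\<in>I. \<Sum>g\<in>G i. (cmod (t i g))\<^sup>2) * sqrt (N * (\<Sum>j\<in>J. \<Sum>h\<in>H j. (cmod (s j h))\<^sup>2))"
    by (intro mult_left_mono real_sqrt_le_mono HS) (simp add: sum_nonneg)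
  finally show ?thesis by (simp add: mult.commute)
qed

lemma form_crude_bound:
  assumes s: "\<And>j h. cmod (s j h) \<le> s' j h" and t: "\<And>i g. cmod (t i g) \<le> t' i g"
  shows "cmod (form s t) \<le> (\<Sum>i\<in>I. \<Sum>j\<in>J. \<Sum>h\<in>H j. \<Sum>g\<in>G i.
    \<bar>\<epsilon> i j\<bar> * s' j h * (t' i g * cmod (cinner g h * cinner (V j h) (W i g))))"
proof -
  have s0: "0 \<le> s' j h" for j h using s[of j h] norm_ge_zero order_trans by blast
  have t0: "0 \<le> t' i g" for i g using t[of i g] norm_ge_zero order_trans by blast
  have "cmod (of_real (\<epsilon> i j) * s j h * (t i g * k)) \<le> \<bar>\<epsilon> i j\<bar> * s' j h * (t' i g * cmod k)" for i j h g k
    unfolding norm_mult norm_of_real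
    by (intro mult_mono s t order_refl mult_nonneg_nonneg s0 t0 abs_ge_zero norm_ge_zero)
  then show ?thesis unfolding form_def by (intro sum_norm_le)
qed

text \<open>Thorin's method. For singular values as weights the analytic family is explicit: \<open>s\<close>
  becomes \<open>s\<^bsup>p (1 - z/2)\<^esup>\<close> and \<open>t\<close> becomes \<open>t\<^bsup>q z/2\<^esup> T\<^bsup>p (1 - z/2) - q z/2\<^esup>\<close> with \<open>T i\<close> the
  \<open>q\<close>-norm of \<open>t i\<close>. For \<open>Re z = 0\<close> the trace norm bound applies, for \<open>Re z = 1\<close> the
  Hilbert-Schmidt bound, and the original weights reappear at \<open>z = 2/q\<close>.\<close>

theorem form_interpolated:
  assumes p: "1 < p" "p \<le> 2" and q: "q = p / (p - 1)"
    and s: "\<And>j h. s j h \<ge> 0" and t: "\<And>i g. t i g \<ge> 0"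
  shows "cmod (form (\<lambda>j h. of_real (s j h)) (\<lambda>i g. of_real (t i g)))
    \<le> N powr (1 / q) * (\<Sum>j\<in>J. \<Sum>h\<in>H j. s j h powr p) powr (1 / p) *
      (\<Sum>i\<in>I. (\<Sum>g\<in>G i. t i g powr q) powr (p / q)) powr (1 / p)"
proof -
  define T where "T i = (\<Sum>g\<in>G i. t i g powr q) powr (1 / q)" for i
  define a where "a = (\<Sum>j\<in>J. \<Sum>h\<in>H j. s j h powr p)"
  define b where "b = (\<Sum>i\<in>I. T i powr p)"
  have q': "q \<ge> 2" "1 / p + 1 / q = 1" "q > 0" using p by (auto simp: q field_simps)
  have T0: "T i \<ge> 0" for i by (simp add: T_def)
  have Tp: "T i powr p = (\<Sum>g\<in>G i. t i g powr q) powr (p / q)" for i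
    by (simp add: T_def powr_powr)
  have Tq: "T i powr q = (\<Sum>g\<in>G i. t i g powr q)" for i
    using q' by (simp add: T_def powr_powr sum_nonneg)
  have ab: "a \<ge> 0" "b \<ge> 0" by (simp_all add: a_def b_def sum_nonneg)
  show ?thesis
  proof (cases "a = 0 \<or> b = 0")
    case True
    then have "form (\<lambda>j h. of_real (s j h)) (\<lambda>i g. of_real (t i g)) = 0"
    proof
      assume "a = 0"
      then have "\<forall>j\<in>J. \<forall>h\<in>H j. s j h = 0"
        using fin H by (simp add: a_def sum_nonneg_eq_0_iff sum_nonneg)
      then show ?thesis by (simp add: form_def)
    next
      assume "b = 0"
      then have "\<forall>i\<in>I. T i = 0" using fin by (simp add: b_def sum_nonneg_eq_0_iff)
      then have "\<forall>i\<in>I. (\<Sum>g\<in>G i. t i g powr q) = 0" using Tq q' by (metis powr_zero_eq_one powr_0)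
      then have "\<forall>i\<in>I. \<forall>g\<in>G i. t i g = 0" using G by (simp add: sum_nonneg_eq_0_iff)
      then show ?thesis by (simp add: form_def)
    qed
    then show ?thesis by simp
  next
    case False
    then have ab: "a > 0" "b > 0" using ab by auto
    define S where "S z j h = complex_of_real (s j h) powr (of_real p * (1 - z / 2))" for z j h
    define U where "U z i g = complex_of_real (t i g) powr (of_real q * z / 2) *
      of_real (T i) powr (of_real p * (1 - z / 2) - of_real q * z / 2)" for z i g
    have norm_S: "cmod (S z j h) = s j h powr (p * (1 - Re z / 2))" for z j h
      unfolding S_def by (subst norm_powr_real_powr) (simp_all add: s)
    have norm_U: "cmod (U z i g) = t i g powr (q * Re z / 2) * T i powr (p * (1 - Re z / 2) - q * Re z / 2)" for z i g
      unfolding U_def norm_mult by (subst (1 2) norm_powr_real_powr) (simp_all add: t T0)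
    define x where "x = 2 / q"
    have x: "0 \<le> x" "x \<le> 1" using q' by (simp_all add: x_def field_simps)
    have "cmod (form (S (of_real x)) (U (of_real x))) \<le> (a * b) powr (1 - x) * sqrt (N * a * b) powr x"
    proof (rule three_lines[OF _ _ _ _ _ _ x, of "\<lambda>z. form (S z) (U z)"])
      show "(\<lambda>z. form (S z) (U z)) holomorphic_on UNIV"
        unfolding form_def S_def U_def by (intro holomorphic_intros) simp_all
      show "cmod (form (S z) (U z)) \<le> (\<Sum>i\<in>I. \<Sum>j\<in>J. \<Sum>h\<in>H j. \<Sum>g\<in>G i. \<bar>\<epsilon> i j\<bar> *
          (s j h powr (p / 2) + s j h powr p) *
          (((t i g powr 0 + t i g powr (q / 2)) * (T i powr (p / 2 - q / 2) + T i powr p)) *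
            cmod (cinner g h * cinner (V j h) (W i g))))"
        if z: "0 \<le> Re z" "Re z \<le> 1" for z
      proof (rule form_crude_bound)
        show "cmod (S z j h) \<le> s j h powr (p / 2) + s j h powr p" for j h
          unfolding norm_S using z p by (intro powr_le_endpoint_sum s) (auto simp: field_simps)
        have "q * Re z \<le> q * 1" "p * Re z \<le> p * 1" "0 \<le> q * Re z" "0 \<le> p * Re z"
          using z p q' by (auto intro!: mult_left_mono)
        then show "cmod (U z i g) \<le> (t i g powr 0 + t i g powr (q / 2)) * (T i powr (p / 2 - q / 2) + T i powr p)" for i g
          unfolding norm_U
          by (intro mult_mono powr_le_endpoint_sum t T0) (auto simp: algebra_simps)
      qed
      show "cmod (form (S z) (U z)) \<le> a * b" if z: "Re z = 0" for z
      proof -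
        have "cmod (form (S z) (U z)) \<le> (\<Sum>j\<in>J. \<Sum>h\<in>H j. cmod (S z j h)) * (\<Sum>i\<in>I. T i powr p)"
          by (rule form_le_trace_bound) (simp_all add: norm_U z mult_left_le_one_le)
        then show ?thesis by (simp add: norm_S z a_def b_def)
      qed
      show "cmod (form (S z) (U z)) \<le> sqrt (N * a * b)" if z: "Re z = 1" for z
      proof -
        have "(s j h powr (p / 2))\<^sup>2 = s j h powr p" for j h
          by (simp add: power2_eq_square powr_add[symmetric])
        then have "(\<Sum>j\<in>J. \<Sum>h\<in>H j. (cmod (S z j h))\<^sup>2) = a"
          by (simp add: norm_S z a_def)
        moreover have "(\<Sum>g\<in>G i. (cmod (U z i g))\<^sup>2) = T i powr p" for i
        proof -
          have "(cmod (U z i g))\<^sup>2 = t i g powr q * T i powr (p - q)" for g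
            unfolding norm_U power_mult_distrib
            by (simp add: z power2_eq_square powr_add[symmetric])
          then have "(\<Sum>g\<in>G i. (cmod (U z i g))\<^sup>2) = T i powr q * T i powr (p - q)"
            by (simp add: Tq sum_distrib_right[symmetric])
          then show ?thesis by (simp add: powr_add[symmetric])
        qed
        ultimately show ?thesis
          using form_le_Hilbert_Schmidt_bound[of "S z" "U z"] by (simp add: b_def real_sqrt_mult)
      qed
    qed (use ab N in auto)
    also have "form (S (of_real x)) (U (of_real x)) = form (\<lambda>j h. of_real (s j h)) (\<lambda>i g. of_real (t i g))"
    proof -
      have px: "p * (1 - x / 2) = 1" "q * x / 2 = 1" using p q' by (auto simp: x_def q field_simps)
      have "S (of_real x) j h = of_real (s j h)" for j h
      proof -
        have "S (of_real x) j h = of_real (s j h) powr of_real (p * (1 - x / 2))"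
          by (simp add: S_def)
        then show ?thesis unfolding px by (simp add: powr_of_real s)
      qed
      moreover have "U (of_real x) i g = of_real (t i g)" if i: "i \<in> I" and g: "g \<in> G i" for i g
      proof -
        have "U (of_real x) i g = of_real (t i g) powr of_real (q * x / 2) *
            of_real (T i) powr of_real (p * (1 - x / 2) - q * x / 2)"
          by (simp add: U_def)
        also have "\<dots> = of_real (t i g * T i powr 0)"
          unfolding px diff_self powr_of_real[OF t] powr_of_real[OF T0] by (simp add: t)
        also have "t i g * T i powr 0 = t i g"
        proof (cases "T i = 0")
          case True
          then have "(\<Sum>g\<in>G i. t i g powr q) = 0" using Tq[of i] by simp
          then have "t i g = 0" using g G(2)[OF i] by (simp add: sum_nonneg_eq_0_iff)
          then show ?thesis by simp
        qed simp
        finally show ?thesis .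
      qed
      ultimately show ?thesis unfolding form_def by (auto intro!: sum.cong)
    qed
    also have "(a * b) powr (1 - x) * sqrt (N * a * b) powr x = N powr (1 / q) * a powr (1 / p) * b powr (1 / p)"
    proof -
      have e: "1 - x + x / 2 = 1 / p" "x / 2 = 1 / q" using q'(2) by (simp_all add: x_def)
      have "sqrt (N * a * b) powr x = (N * (a * b)) powr (x / 2)"
        using ab N by (simp add: powr_half_sqrt[symmetric] powr_powr mult.assoc)
      also have "\<dots> = N powr (x / 2) * (a * b) powr (x / 2)"
        using ab N by (simp add: powr_mult)
      finally have "(a * b) powr (1 - x) * sqrt (N * a * b) powr x
          = N powr (x / 2) * ((a * b) powr (1 - x) * (a * b) powr (x / 2))" by simp
      also have "\<dots> = N powr (1 / q) * (a * b) powr (1 / p)"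
        by (simp only: powr_add[symmetric] e(1)) (simp only: e(2))
      finally show ?thesis using ab by (simp add: powr_mult)
    qed
    finally show ?thesis unfolding a_def b_def Tp .
  qed
qed

end

section \<open>Compressions to finite-dimensional subspaces\<close>

abbreviation compress :: "('a::complex_hilbert_space \<Rightarrow>\<^sub>L 'a) \<Rightarrow> 'a set \<Rightarrow> 'a \<Rightarrow> 'a"
  where "compress S F x \<equiv> proj F (S (proj F x))"

abbreviation eigen :: "('a::complex_hilbert_space \<Rightarrow>\<^sub>L 'a) \<Rightarrow> 'a \<Rightarrow> real"
  where "eigen S g \<equiv> Re (cinner (S g) g)"

lemma diagonalisingD:
  assumes "diagonalising S F G"
  shows "orthonormal G" "finite G" "proj G = proj F"
    "\<And>g h. g \<in> G \<Longrightarrow> h \<in> G \<Longrightarrow> g \<noteq> h \<Longrightarrow> cinner (S g) h = 0"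
  using assms by (simp_all add: diagonalising_def)

lemma hermitian_real: "hermitian S \<Longrightarrow> cinner (S g) g = of_real (Re (cinner (S g) g))"
  by (metis hermitianD cinner_commute complex_is_Real_iff of_real_Re Reals_cnj_iff)

lemma compress_diagonal:
  assumes S: "hermitian S" and G: "diagonalising S F G"
  shows "compress S F x = (\<Sum>g\<in>G. (of_real (eigen S g) * cinner x g) *\<^sub>C g)"
proof -
  note D = diagonalisingD[OF G]
  have "proj G (S g) = of_real (eigen S g) *\<^sub>C g" if g: "g \<in> G" for g
  proof -
    have "proj G (S g) = (\<Sum>h\<in>G. if h = g then cinner (S g) g *\<^sub>C g else 0)"
      unfolding proj_def using D(4) g by (intro sum.cong) auto
    also have "\<dots> = cinner (S g) g *\<^sub>C g" using g D(2) by simp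
    also have "\<dots> = of_real (eigen S g) *\<^sub>C g"
      by (rule arg_cong[where f = "\<lambda>c. c *\<^sub>C g", OF hermitian_real[OF S]])
    finally show ?thesis .
  qed
  moreover have "compress S F x = (\<Sum>g\<in>G. cinner x g *\<^sub>C proj G (S g))"
    unfolding D(3)[symmetric]
    by (simp add: proj_def[of G x] clinear_sum_scaleC[OF clinear_proj]
        clinear_sum_scaleC[OF hermitian_clinear[OF S]])
  ultimately show ?thesis by (simp add: scaleC_scaleC mult.commute)
qed

lemma compress_power_diagonal:
  assumes S: "hermitian S" and G: "diagonalising S F G" and x: "proj F x = x"
  shows "(compress S F ^^ k) x = (\<Sum>g\<in>G. (of_real (eigen S g ^ k) * cinner x g) *\<^sub>C g)"
proof (induction k)
  case 0
  have "x = proj G x" using x diagonalisingD(3)[OF G] by simp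
  then show ?case by (simp add: proj_def)
next
  case (Suc k)
  note D = diagonalisingD[OF G]
  have "(compress S F ^^ Suc k) x = compress S F ((compress S F ^^ k) x)" by simp
  also have "\<dots> = (\<Sum>g\<in>G. (of_real (eigen S g) * cinner ((compress S F ^^ k) x) g) *\<^sub>C g)"
    by (rule compress_diagonal[OF S G])
  also have "\<dots> = (\<Sum>g\<in>G. (of_real (eigen S g ^ Suc k) * cinner x g) *\<^sub>C g)"
    unfolding Suc by (intro sum.cong refl) (simp add: cinner_sum_orthonormal[OF D(1,2)] mult.assoc)
  finally show ?case .
qed

lemma tendsto_proj_net:
  assumes E: "orthonormal_basis E" and y: "(y \<longlongrightarrow> l) (finite_subsets_at_top E)"
  shows "((\<lambda>F. proj F (y F)) \<longlongrightarrow> l) (finite_subsets_at_top E)"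
proof -
  note on = orthonormal_basis_imp_orthonormal[OF E]
  have "((\<lambda>F. proj F (y F) - proj F l) \<longlongrightarrow> 0) (finite_subsets_at_top E)"
  proof (rule Lim_null_comparison)
    show "\<forall>\<^sub>F F in finite_subsets_at_top E. norm (proj F (y F) - proj F l) \<le> norm (y F - l)"
      unfolding proj_diff[symmetric]
      by (rule eventually_finite_subsets_at_top_weakI)
        (rule norm_proj_le[OF orthonormal_subset[OF on]])
    show "((\<lambda>F. norm (y F - l)) \<longlongrightarrow> 0) (finite_subsets_at_top E)"
      using y by (simp add: LIM_zero tendsto_norm_zero)
  qed
  from tendsto_add[OF this tendsto_proj[OF E, of l]] show ?thesis by simp
qed

lemma tendsto_compress:
  assumes E: "orthonormal_basis E" and y: "(y \<longlongrightarrow> l) (finite_subsets_at_top E)"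
  shows "((\<lambda>F. compress S F (y F)) \<longlongrightarrow> S l) (finite_subsets_at_top E)"
  by (intro tendsto_proj_net[OF E] bounded_linear.tendsto[OF blinfun.bounded_linear_right] y)

lemma tendsto_compress_power:
  assumes E: "orthonormal_basis E"
  shows "((\<lambda>F. (compress S F ^^ k) x) \<longlongrightarrow> (blinfun_apply S ^^ k) x) (finite_subsets_at_top E)"
proof (induction k)
  case (Suc k)
  from tendsto_compress[OF E Suc, of S] show ?case by simp
qed simp

text \<open>Powers of the compressions converge strongly to powers of \<open>S\<close>, hence so do polynomials, and \<open>f\<close> is
  uniformly close to a polynomial. In a diagonalising basis the functional calculus of the
  compression is evaluated on the eigenvalues.\<close>

lemma op_fun_le_compressed_trace:
  assumes S: "positive S" and f: "continuous_on {0..norm S} f" and E: "orthonormal_basis E"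
    and e: "e \<in> E" and r: "r > 0"
  shows "\<forall>\<^sub>F F in finite_subsets_at_top E. \<forall>G. diagonalising S F G \<longrightarrow>
    Re (cinner (op_fun f S e) e) \<le> (\<Sum>g\<in>G. f (eigen S g) * (cmod (cinner e g))\<^sup>2) + r"
proof -
  note h = positive_hermitian[OF S]
  note on = orthonormal_basis_imp_orthonormal[OF E]
  obtain P' where P': "uniform_limit {0..norm S} (\<lambda>k. poly (P' k)) f sequentially"
    using polynomial_approximation[OF f] by blast
  \<comment> \<open>The error \<open>r\<close> is shared by replacing \<open>f\<close> by \<open>P\<close> for the compression, by the passage from
    the compression to \<open>S\<close>, and by returning from \<open>P\<close> to \<open>f\<close>.\<close>
  have "r / 3 > 0" using r by simp
  from uniform_limitD[OF P' this]
  obtain k where k: "\<forall>t\<in>{0..norm S}. dist (poly (P' k) t) (f t) < r / 3"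
    unfolding eventually_sequentially by auto
  define P where "P = P' k"
  have P: "\<bar>poly P t - f t\<bar> \<le> r / 3" if "t \<in> {0..norm S}" for t
    using k that by (force simp: P_def dist_real_def)
  define c where "c F = (\<Sum>k\<le>degree P. coeff P k *\<^sub>R (compress S F ^^ k) e)" for F
  have "(c \<longlongrightarrow> op_poly P S e) (finite_subsets_at_top E)"
    unfolding c_def op_poly_apply by (intro tendsto_intros tendsto_compress_power[OF E])
  then have "((\<lambda>F. Re (cinner (c F) e)) \<longlongrightarrow> Re (cinner (op_poly P S e) e)) (finite_subsets_at_top E)"
    by (intro tendsto_Re tendsto_cinner_left)
  then have "\<forall>\<^sub>F F in finite_subsets_at_top E. Re (cinner (c F) e) > Re (cinner (op_poly P S e) e) - r / 3"
    using r by (intro order_tendstoD) auto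
  moreover have "\<forall>\<^sub>F F in finite_subsets_at_top E. finite F \<and> {e} \<subseteq> F \<and> F \<subseteq> E"
    unfolding eventually_finite_subsets_at_top using e by (intro exI[of _ "{e}"]) auto
  ultimately show ?thesis
  proof eventually_elim
    case (elim F)
    have F: "orthonormal F" "finite F" "e \<in> F" using elim orthonormal_subset[OF on] by auto
    have ne: "norm e = 1" using orthonormal_norm[OF F(1,3)] .
    show ?case
    proof (intro allI impI)
      fix G assume G: "diagonalising S F G"
      note D = diagonalisingD[OF G]
      have "cinner (c F) e = (\<Sum>k\<le>degree P. \<Sum>g\<in>G. of_real (coeff P k * eigen S g ^ k * (cmod (cinner e g))\<^sup>2))"
        unfolding c_def cinner_sum_left cinner_scaleR_left
          compress_power_diagonal[OF h G proj_self[OF F]] sum_distrib_left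
      proof (intro sum.cong refl)
        fix k g
        have "cinner e g * cinner g e = of_real ((cmod (cinner e g))\<^sup>2)"
          unfolding complex_norm_square by (simp add: cinner_commute[symmetric])
        then show "of_real (coeff P k) * cinner ((of_real (eigen S g ^ k) * cinner e g) *\<^sub>C g) e
            = of_real (coeff P k * eigen S g ^ k * (cmod (cinner e g))\<^sup>2)"
          by (simp add: cinner_algebra mult.assoc)
      qed
      also have "\<dots> = (\<Sum>g\<in>G. of_real (poly P (eigen S g) * (cmod (cinner e g))\<^sup>2))"
        by (subst sum.swap) (simp add: poly_altdef sum_distrib_right)
      finally have cF: "Re (cinner (c F) e) = (\<Sum>g\<in>G. poly P (eigen S g) * (cmod (cinner e g))\<^sup>2)"
        by (simp only: of_real_sum[symmetric] Re_complex_of_real)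
      have "(\<Sum>g\<in>G. poly P (eigen S g) * (cmod (cinner e g))\<^sup>2)
          \<le> (\<Sum>g\<in>G. f (eigen S g) * (cmod (cinner e g))\<^sup>2 + r / 3 * (cmod (cinner e g))\<^sup>2)"
        unfolding distrib_right[symmetric]
      proof (intro sum_mono mult_right_mono)
        fix g assume "g \<in> G"
        then have "norm g = 1" by (rule orthonormal_norm[OF D(1)])
        then have "eigen S g \<in> {0..norm S}"
          using positiveD[OF S, of g] Re_cinner_blinfun_le[of S g] by simp
        from P[OF this] show "poly P (eigen S g) \<le> f (eigen S g) + r / 3" by linarith
      qed simp
      also have "\<dots> = (\<Sum>g\<in>G. f (eigen S g) * (cmod (cinner e g))\<^sup>2) + r / 3 * (\<Sum>g\<in>G. (cmod (cinner e g))\<^sup>2)"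
        by (simp add: sum.distrib sum_distrib_left)
      also have "r / 3 * (\<Sum>g\<in>G. (cmod (cinner e g))\<^sup>2) \<le> r / 3 * 1"
        using Bessel[OF D(1,2), of e] r ne by (intro mult_left_mono) auto
      finally have 1: "Re (cinner (c F) e) \<le> (\<Sum>g\<in>G. f (eigen S g) * (cmod (cinner e g))\<^sup>2) + r / 3"
        by (simp add: cF)
      have "norm (op_poly P S - op_fun f S) \<le> r / 3"
        using P r by (intro norm_op_poly_diff_op_fun_le[OF S f]) auto
      then have "norm (op_fun f S - op_poly P S) \<le> r / 3" by (simp add: norm_minus_commute)
      then have "Re (cinner ((op_fun f S - op_poly P S) e) e) \<le> r / 3"
        using Re_cinner_blinfun_le[of "op_fun f S - op_poly P S" e] ne by simp
      then have "Re (cinner (op_fun f S e) e) \<le> Re (cinner (op_poly P S e) e) + r / 3"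
        by (simp add: blinfun.diff_left cinner_algebra)
      with 1 elim(1) show "Re (cinner (op_fun f S e) e)
          \<le> (\<Sum>g\<in>G. f (eigen S g) * (cmod (cinner e g))\<^sup>2) + r"
        by linarith
    qed
  qed
qed

text \<open>Lower semicontinuity of the trace under compression; it takes the place of a spectral
  decomposition of \<open>S\<close>.\<close>

lemma trace_powr_le_compressed:
  assumes S: "positive S" and p: "p > 0" and E: "orthonormal_basis E"
    and F0: "finite F0" "F0 \<subseteq> E" and r: "r > 0"
  shows "\<forall>\<^sub>F F in finite_subsets_at_top E. \<forall>G. diagonalising S F G \<longrightarrow>
    (\<Sum>e\<in>F0. Re (cinner (op_powr S p e) e)) \<le> (\<Sum>g\<in>G. eigen S g powr p) + r"
proof -
  define r' where "r' = r / (real (card F0) + 1)"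
  have r': "r' > 0" "real (card F0) * r' \<le> r"
    using r by (simp_all add: r'_def field_simps)
  have "\<forall>\<^sub>F F in finite_subsets_at_top E. \<forall>e\<in>F0. \<forall>G. diagonalising S F G \<longrightarrow>
      Re (cinner (op_powr S p e) e) \<le> (\<Sum>g\<in>G. eigen S g powr p * (cmod (cinner e g))\<^sup>2) + r'"
    unfolding op_powr_def using F0 p
    by (intro eventually_ball_finite ballI op_fun_le_compressed_trace[OF S _ E]
        continuous_on_powr_nonneg r') auto
  moreover have "\<forall>\<^sub>F F in finite_subsets_at_top E. finite F \<and> F0 \<subseteq> F \<and> F \<subseteq> E"
    unfolding eventually_finite_subsets_at_top using F0 by (intro exI[of _ F0]) auto
  ultimately show ?thesis
  proof eventually_elim
    case (elim F)
    show ?case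
    proof (intro allI impI)
      fix G assume G: "diagonalising S F G"
      note D = diagonalisingD[OF G]
      have on: "orthonormal F0"
        by (rule orthonormal_subset[OF orthonormal_basis_imp_orthonormal[OF E] F0(2)])
      have "(\<Sum>e\<in>F0. Re (cinner (op_powr S p e) e))
          \<le> (\<Sum>e\<in>F0. (\<Sum>g\<in>G. eigen S g powr p * (cmod (cinner e g))\<^sup>2) + r')"
        using elim(1) G by (intro sum_mono) simp
      also have "\<dots> = (\<Sum>g\<in>G. eigen S g powr p * (\<Sum>e\<in>F0. (cmod (cinner e g))\<^sup>2)) + real (card F0) * r'"
        by (simp add: sum.distrib sum_distrib_left) (rule sum.swap)
      also have "\<dots> \<le> (\<Sum>g\<in>G. eigen S g powr p * 1) + r"
      proof (intro add_mono sum_mono mult_left_mono r'(2))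
        fix g assume "g \<in> G"
        then show "(\<Sum>e\<in>F0. (cmod (cinner e g))\<^sup>2) \<le> 1"
          using Bessel[OF on F0(1), of g] orthonormal_norm[OF D(1)]
          by (simp add: norm_cinner_commute[of g])
      qed simp
      finally show "(\<Sum>e\<in>F0. Re (cinner (op_powr S p e) e)) \<le> (\<Sum>g\<in>G. eigen S g powr p) + r"
        by simp
    qed
  qed
qed

lemma compressed_le_trace_powr:
  assumes S: "positive S" and p: "p \<ge> 1" and F: "orthonormal F" "finite F" and G: "diagonalising S F G"
  shows "(\<Sum>g\<in>G. eigen S g powr p) \<le> (\<Sum>e\<in>F. Re (cinner (op_powr S p e) e))"
proof -
  note D = diagonalisingD[OF G]
  have "(\<Sum>g\<in>G. eigen S g powr p) \<le> (\<Sum>g\<in>G. Re (cinner (op_powr S p g) g))"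
    by (intro sum_mono op_powr_Jensen S p orthonormal_norm[OF D(1)])
  also have "\<dots> = Re (\<Sum>g\<in>G. cinner (op_powr S p g) g)" by simp
  also have "(\<Sum>g\<in>G. cinner (op_powr S p g) g) = (\<Sum>e\<in>F. cinner (op_powr S p e) e)"
    using p by (intro trace_basis_independent D F clinear_id
        hermitian_clinear positive_hermitian positive_op_powr S) auto
  finally show ?thesis by simp
qed

section \<open>Duality with finite-rank operators\<close>

lemma proj_subset:
  assumes "orthonormal F" "finite F" "F1 \<subseteq> F" "proj F1 x = x"
  shows "proj F x = x"
proof -
  have "proj F (proj F1 x) = (\<Sum>e\<in>F1. cinner x e *\<^sub>C proj F e)"
    unfolding proj_def[of F1] by (rule clinear_sum_scaleC[OF clinear_proj])
  also have "\<dots> = (\<Sum>e\<in>F1. cinner x e *\<^sub>C e)"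
    using assms by (intro sum.cong refl) (auto simp: proj_self)
  finally show ?thesis using assms(4) by (simp add: proj_def[symmetric])
qed

text \<open>With \<open>V\<close> from the approximate polar decomposition, the finite-rank operators
  \<open>V (P \<bar>A\<bar> P)\<close>, \<open>P\<close> a projection, approximate \<open>A\<close> at each vector, while their singular values
  are controlled by the Schatten norm of \<open>A\<close> through Jensen's inequality.\<close>

lemma finite_rank_approximation:
  fixes A :: "'a::complex_hilbert_space \<Rightarrow>\<^sub>L 'a"
  assumes A: "complex_linear A" and E: "orthonormal_basis E" and d: "d > 0"
    and V: "contraction V" "\<And>x. norm (V (op_abs A x) - A x) \<le> d * norm x"
    and g: "norm g = 1"
  shows "\<forall>\<^sub>F F in finite_subsets_at_top E. norm (V (compress (op_abs A) F g) - A g) \<le> 2 * d"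
proof -
  have diff: "V x - V y = V (x - y)" for x y
    using clinear_add[OF contractionD(1)[OF V(1)], of "x - y" y] by simp
  have "((\<lambda>F. compress (op_abs A) F g) \<longlongrightarrow> op_abs A g) (finite_subsets_at_top E)"
    by (rule tendsto_compress[OF E tendsto_const])
  then have "\<forall>\<^sub>F F in finite_subsets_at_top E. dist (compress (op_abs A) F g) (op_abs A g) < d"
    using d by (rule tendstoD)
  then show ?thesis
  proof eventually_elim
    case (elim F)
    have "norm (V (compress (op_abs A) F g) - V (op_abs A g)) \<le> d"
      unfolding diff using contractionD(2)[OF V(1), of "compress (op_abs A) F g - op_abs A g"] elim by (simp add: dist_norm)
    moreover have "norm (V (op_abs A g) - A g) \<le> d" using V(2)[of g] g by simp
    ultimately show ?case
      using norm_triangle_ineq[of "V (compress (op_abs A) F g) - V (op_abs A g)" "V (op_abs A g) - A g"]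
      by simp
  qed
qed

lemma complex_linear_sum:
  assumes "\<And>j. j \<in> J \<Longrightarrow> complex_linear (A j)"
  shows "complex_linear (\<Sum>j\<in>J. c j *\<^sub>R A j)"
  using assms unfolding complex_linear_def
  by (simp add: blinfun.sum_left blinfun.scaleR_left scaleC_sum_right scaleC_of_real[symmetric]
      scaleC_scaleC mult.commute)

text \<open>The order of summation in which the form of the bilinear inequality arises from duality,
  with the tests as the outer sum.\<close>

definition tested_sum where
  "tested_sum I J \<epsilon> x G \<mu> H V W = (\<Sum>i\<in>I. \<Sum>g\<in>G i. of_real (x i g) * (\<Sum>j\<in>J. of_real (\<epsilon> i j) *
    (\<Sum>h\<in>H j. of_real (\<mu> j h) * (cinner g h * cinner (V j h) (W i g)))))"

text \<open>Duality in the form in which it is needed. To estimate the eigenvalues of the compressions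
  of \<open>\<bar>B i\<bar>\<close> against weights \<open>x i g\<close>, the operator \<open>B i\<close> is tested against the finite-rank
  operator with singular values \<open>x i g\<close> and singular vectors \<open>g\<close> and \<open>W i g\<close>. The test vectors
  are fixed first; only then a larger subspace, the span of \<open>F\<close>, is chosen on which \<open>A j\<close> may be
  replaced by a finite-rank operator with a small error at the finitely many test vectors.\<close>

lemma dual_bound:
  fixes A :: "'j \<Rightarrow> 'a::complex_hilbert_space \<Rightarrow>\<^sub>L 'a" and B :: "'i \<Rightarrow> 'a \<Rightarrow>\<^sub>L 'a"
  assumes E: "orthonormal_basis E" and fin: "finite I" "finite J"
    and A: "\<And>j. j \<in> J \<Longrightarrow> complex_linear (A j)"
    and B: "\<And>i. i \<in> I \<Longrightarrow> B i = (\<Sum>j\<in>J. \<epsilon> i j *\<^sub>R A j)"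
    and eps: "\<And>i j. i \<in> I \<Longrightarrow> j \<in> J \<Longrightarrow> \<bar>\<epsilon> i j\<bar> \<le> 1"
    and F1: "finite F1" "F1 \<subseteq> E"
    and G: "\<And>i. i \<in> I \<Longrightarrow> diagonalising (op_abs (B i)) F1 (G i)"
    and x: "\<And>i g. x i g \<ge> 0"
    and bound: "\<And>F W V H. finite F \<Longrightarrow> F1 \<subseteq> F \<Longrightarrow> F \<subseteq> E \<Longrightarrow>
      (\<And>i. i \<in> I \<Longrightarrow> contraction (W i)) \<Longrightarrow> (\<And>j. j \<in> J \<Longrightarrow> contraction (V j)) \<Longrightarrow>
      (\<And>j. j \<in> J \<Longrightarrow> diagonalising (op_abs (A j)) F (H j)) \<Longrightarrow>
      Re (tested_sum I J \<epsilon> x G (\<lambda>j. eigen (op_abs (A j))) H V W) \<le> C"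
  shows "(\<Sum>i\<in>I. \<Sum>g\<in>G i. x i g * eigen (op_abs (B i)) g) \<le> C"
proof (rule le_if_le_add_mult_eps)
  \<comment> \<open>The total error in multiples of \<open>d\<close>: each unit of weight costs 1 for passing from \<open>\<bar>B i\<bar>\<close>
    to \<open>B i\<close> and 2 for the approximation of each \<open>A j\<close>.\<close>
  define M where "M = (\<Sum>i\<in>I. \<Sum>g\<in>G i. x i g) * (1 + 2 * real (card J))"
  show "0 \<le> M" unfolding M_def using x by (intro mult_nonneg_nonneg sum_nonneg) auto
  fix d :: real assume d: "d > 0"
  note on = orthonormal_basis_imp_orthonormal[OF E]
  have B_lin: "complex_linear (B i)" if "i \<in> I" for i
    unfolding B[OF that] by (rule complex_linear_sum[OF A])
  have "\<forall>i\<in>I. \<exists>W. contraction W \<and>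
      (\<forall>x. cmod (cinner (B i x) (W x) - cinner (op_abs (B i) x) x) \<le> d * (norm x)\<^sup>2)"
    using approximate_polar_decomposition[OF B_lin d] by meson
  from bchoice[OF this] obtain W where "\<forall>i\<in>I. contraction (W i) \<and>
      (\<forall>x. cmod (cinner (B i x) (W i x) - cinner (op_abs (B i) x) x) \<le> d * (norm x)\<^sup>2)" ..
  then have W: "\<And>i. i \<in> I \<Longrightarrow> contraction (W i)"
    "\<And>i x. i \<in> I \<Longrightarrow> cmod (cinner (B i x) (W i x) - cinner (op_abs (B i) x) x) \<le> d * (norm x)\<^sup>2"
    by simp_all
  have "\<forall>j\<in>J. \<exists>V. contraction V \<and> (\<forall>x. norm (V (op_abs (A j) x) - A j x) \<le> d * norm x)"
    using approximate_polar_decomposition[OF A d] by meson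
  from bchoice[OF this] obtain V
    where "\<forall>j\<in>J. contraction (V j) \<and> (\<forall>x. norm (V j (op_abs (A j) x) - A j x) \<le> d * norm x)" ..
  then have V: "\<And>j. j \<in> J \<Longrightarrow> contraction (V j)"
    "\<And>j x. j \<in> J \<Longrightarrow> norm (V j (op_abs (A j) x) - A j x) \<le> d * norm x"
    by simp_all
  have normG: "norm g = 1" if "i \<in> I" "g \<in> G i" for i g
    using orthonormal_norm[OF diagonalisingD(1)[OF G]] that by blast
  have ev: "\<forall>\<^sub>F F in finite_subsets_at_top E. \<forall>i\<in>I. \<forall>g\<in>G i. \<forall>j\<in>J.
      norm (V j (compress (op_abs (A j)) F g) - A j g) \<le> 2 * d"
    using fin diagonalisingD(2)[OF G]
    by (intro eventually_ball_finite ballI finite_rank_approximation A E d V normG) auto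
  have ev': "\<forall>\<^sub>F F in finite_subsets_at_top E. finite F \<and> F1 \<subseteq> F \<and> F \<subseteq> E"
    unfolding eventually_finite_subsets_at_top using F1 by (intro exI[of _ F1]) auto
  obtain F where approx: "\<forall>i\<in>I. \<forall>g\<in>G i. \<forall>j\<in>J.
      norm (V j (compress (op_abs (A j)) F g) - A j g) \<le> 2 * d"
    and F: "finite F" "F1 \<subseteq> F" "F \<subseteq> E"
    using eventually_happens'[OF finite_subsets_at_top_neq_bot eventually_conj[OF ev ev']]
    by (elim exE conjE)
  have "\<forall>j\<in>J. \<exists>H. diagonalising (op_abs (A j)) F H"
    by (intro ballI diagonalising_exists positive_hermitian positive_op_abs A F orthonormal_subset[OF on])
  from bchoice[OF this] obtain H where "\<forall>j\<in>J. diagonalising (op_abs (A j)) F (H j)" ..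
  then have H: "\<And>j. j \<in> J \<Longrightarrow> diagonalising (op_abs (A j)) F (H j)" by simp
  define b where "b i g = (\<Sum>j\<in>J. of_real (\<epsilon> i j) * cinner (V j (compress (op_abs (A j)) F g)) (W i g))" for i g
  have b: "b i g = (\<Sum>j\<in>J. of_real (\<epsilon> i j) *
        (\<Sum>h\<in>H j. of_real (eigen (op_abs (A j)) h) * (cinner g h * cinner (V j h) (W i g))))" for i g
    unfolding b_def
  proof (intro sum.cong refl arg_cong2[of _ _ _ _ "(*)"])
    fix j assume j: "j \<in> J"
    show "cinner (V j (compress (op_abs (A j)) F g)) (W i g) =
        (\<Sum>h\<in>H j. of_real (eigen (op_abs (A j)) h) * (cinner g h * cinner (V j h) (W i g)))"
      unfolding compress_diagonal[OF positive_hermitian[OF positive_op_abs[OF A[OF j]]] H[OF j]]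
        clinear_sum_scaleC[OF contractionD(1)[OF V(1)[OF j]]] cinner_sum_left
      by (simp add: cinner_scaleC_left mult.assoc)
  qed
  have le: "eigen (op_abs (B i)) g \<le> Re (b i g) + d * (1 + 2 * real (card J))"
    if i: "i \<in> I" and g: "g \<in> G i" for i g
  proof -
    note ng = normG[OF i g]
    have Wg: "norm (W i g) \<le> 1" using contractionD(2)[OF W(1)[OF i], of g] ng by simp
    define r where "r j = A j g - V j (compress (op_abs (A j)) F g)" for j
    have "cinner (B i g) (W i g) - b i g = (\<Sum>j\<in>J. of_real (\<epsilon> i j) * cinner (r j) (W i g))"
      unfolding B[OF i] b_def r_def
      by (simp add: blinfun.sum_left blinfun.scaleR_left cinner_sum_left cinner_algebra
          sum_subtractf right_diff_distrib)
    also have "cmod \<dots> \<le> (\<Sum>j\<in>J. 2 * d)"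
    proof (rule sum_norm_le)
      fix j assume j: "j \<in> J"
      have n: "norm (r j) \<le> 2 * d" using approx i g j by (simp add: r_def norm_minus_commute)
      have "cmod (cinner (r j) (W i g)) \<le> 2 * d * 1"
        by (rule order_trans[OF norm_cinner_le mult_mono[OF n Wg]]) (use d in auto)
      then have "\<bar>\<epsilon> i j\<bar> * cmod (cinner (r j) (W i g)) \<le> 1 * (2 * d * 1)"
        using eps[OF i j] by (intro mult_mono) auto
      then show "cmod (of_real (\<epsilon> i j) * cinner (r j) (W i g)) \<le> 2 * d"
        by (simp add: norm_mult)
    qed
    finally have 1: "cmod (cinner (B i g) (W i g) - b i g) \<le> 2 * d * real (card J)"
      by (simp add: mult.commute)
    have 2: "cmod (cinner (B i g) (W i g) - cinner (op_abs (B i) g) g) \<le> d"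
      using W(2)[OF i, of g] ng by simp
    have "Re (cinner (op_abs (B i) g) g) - Re (b i g) =
        Re (cinner (B i g) (W i g) - b i g) - Re (cinner (B i g) (W i g) - cinner (op_abs (B i) g) g)"
      by simp
    also have "\<dots> \<le> 2 * d * real (card J) + d"
      using 1 2 abs_Re_le_cmod[of "cinner (B i g) (W i g) - b i g"]
        abs_Re_le_cmod[of "cinner (B i g) (W i g) - cinner (op_abs (B i) g) g"] by linarith
    finally show ?thesis by (simp add: algebra_simps)
  qed
  have "(\<Sum>i\<in>I. \<Sum>g\<in>G i. x i g * eigen (op_abs (B i)) g)
      \<le> (\<Sum>i\<in>I. \<Sum>g\<in>G i. x i g * (Re (b i g) + d * (1 + 2 * real (card J))))"
    by (intro sum_mono mult_left_mono le x)
  also have "\<dots> = Re (\<Sum>i\<in>I. \<Sum>g\<in>G i. of_real (x i g) * b i g) + d * M"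
    unfolding M_def
    by (simp add: distrib_left sum.distrib sum_distrib_left sum_distrib_right mult_ac)
  also have "Re (\<Sum>i\<in>I. \<Sum>g\<in>G i. of_real (x i g) * b i g) \<le> C"
    unfolding b tested_sum_def[symmetric] by (rule bound[OF F W(1) V(1) H])
  finally show "(\<Sum>i\<in>I. \<Sum>g\<in>G i. x i g * eigen (op_abs (B i)) g) \<le> C + d * M" by simp
qed

section \<open>Traces as limits of compressed traces\<close>

abbreviation trace_basis :: "'a::complex_hilbert_space set"
  where "trace_basis \<equiv> SOME B. orthonormal_basis B"

lemma orthonormal_basis_trace_basis: "orthonormal_basis trace_basis"
  by (rule someI_ex[OF orthonormal_basis_exists])

lemma orthonormal_if_subset_trace_basis: "F \<subseteq> trace_basis \<Longrightarrow> orthonormal F"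
  by (rule orthonormal_subset[OF orthonormal_basis_imp_orthonormal[OF orthonormal_basis_trace_basis]])

lemma finite_sum_le_op_trace:
  assumes T: "positive T" and F: "finite F" "F \<subseteq> trace_basis"
  shows "ennreal (\<Sum>e\<in>F. Re (cinner (T e) e)) \<le> op_trace T"
proof -
  have "ennreal (\<Sum>e\<in>F. Re (cinner (T e) e)) = (\<Sum>e\<in>F. ennreal (Re (cinner (T e) e)))"
    by (rule sum_ennreal[symmetric]) (rule positiveD[OF T])
  also have "\<dots> \<le> op_trace T"
    unfolding op_trace_def using F by (subst nonneg_infsum_complete) (auto intro!: SUP_upper)
  finally show ?thesis .
qed

lemma op_trace_eq_has_sum:
  fixes T :: "'a::complex_hilbert_space \<Rightarrow>\<^sub>L 'a"
  assumes T: "positive T" and t: "((\<lambda>e. Re (cinner (T e) e)) has_sum t) trace_basis"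
  shows "op_trace T = ennreal t"
proof -
  have "((\<lambda>F. ennreal (\<Sum>e\<in>F. Re (cinner (T e) e))) \<longlongrightarrow> ennreal t) (finite_subsets_at_top trace_basis)"
    using t unfolding has_sum_def by (rule tendsto_ennrealI)
  moreover have "ennreal (\<Sum>e\<in>F. Re (cinner (T e) e)) = (\<Sum>e\<in>F. ennreal (Re (cinner (T e) e)))" for F
    by (rule sum_ennreal[symmetric]) (rule positiveD[OF T])
  ultimately have "((\<lambda>e. ennreal (Re (cinner (T e) e))) has_sum ennreal t) trace_basis"
    unfolding has_sum_def by simp
  then show ?thesis unfolding op_trace_def by (rule infsumI)
qed

text \<open>Finite partial sums of the traces are at most the compressed traces up to any error, so a
  bound on the latter makes the traces finite and is inherited by them.\<close>

lemma op_trace_le_if_compressed_le: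
  fixes B :: "'i \<Rightarrow> 'a::complex_hilbert_space \<Rightarrow>\<^sub>L 'a"
  assumes I: "finite I" and B: "\<And>i. i \<in> I \<Longrightarrow> complex_linear (B i)" and p: "p > 0" and r: "r > 0"
    and bound: "\<And>F G. finite F \<Longrightarrow> F \<subseteq> trace_basis \<Longrightarrow>
      (\<And>i. i \<in> I \<Longrightarrow> diagonalising (op_abs (B i)) F (G i)) \<Longrightarrow>
      (\<Sum>i\<in>I. (\<Sum>g\<in>G i. eigen (op_abs (B i)) g powr p) powr r) \<le> R"
  shows "\<exists>\<tau>. (\<forall>i\<in>I. 0 \<le> \<tau> i \<and> op_trace (op_powr (op_abs (B i)) p) = ennreal (\<tau> i)) \<and>
    (\<Sum>i\<in>I. \<tau> i powr r) \<le> R"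
proof -
  define f where "f i e = Re (cinner (op_powr (op_abs (B i)) p e) e)" for i e
  note E = orthonormal_basis_trace_basis[where 'a = 'a]
  have S: "positive (op_abs (B i))" if "i \<in> I" for i
    by (rule positive_op_abs[OF B[OF that]])
  have f0: "0 \<le> f i e" if "i \<in> I" for i e
    unfolding f_def by (rule positiveD[OF positive_op_powr[OF S[OF that] p]])
  have partial: "(\<Sum>i\<in>I. (\<Sum>e\<in>F0. f i e) powr r) \<le> R" if F0: "finite F0" "F0 \<subseteq> trace_basis" for F0
  proof -
    have le: "(\<Sum>i\<in>I. max 0 ((\<Sum>e\<in>F0. f i e) - d) powr r) \<le> R" if d: "d > 0" for d
    proof -
      have ev: "\<forall>\<^sub>F F in finite_subsets_at_top trace_basis. \<forall>i\<in>I. \<forall>G. diagonalising (op_abs (B i)) F G \<longrightarrow>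
          (\<Sum>e\<in>F0. f i e) \<le> (\<Sum>g\<in>G. eigen (op_abs (B i)) g powr p) + d"
        unfolding f_def
        by (intro eventually_ball_finite[OF I] ballI trace_powr_le_compressed[OF S p E F0 d])
      have ev': "\<forall>\<^sub>F F in finite_subsets_at_top (trace_basis :: 'a set). finite F \<and> F \<subseteq> trace_basis"
        by (rule eventually_finite_subsets_at_top_weakI) simp
      obtain F where F: "\<forall>i\<in>I. \<forall>G. diagonalising (op_abs (B i)) F G \<longrightarrow>
          (\<Sum>e\<in>F0. f i e) \<le> (\<Sum>g\<in>G. eigen (op_abs (B i)) g powr p) + d" "finite F" "F \<subseteq> trace_basis"
        using eventually_happens'[OF finite_subsets_at_top_neq_bot eventually_conj[OF ev ev']]
        by (elim exE conjE)
      have "\<forall>i\<in>I. \<exists>G. diagonalising (op_abs (B i)) F G"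
        by (intro ballI diagonalising_exists positive_hermitian S F(2) orthonormal_if_subset_trace_basis F(3))
      from bchoice[OF this] obtain G where G: "\<forall>i\<in>I. diagonalising (op_abs (B i)) F (G i)" ..
      have "(\<Sum>i\<in>I. max 0 ((\<Sum>e\<in>F0. f i e) - d) powr r)
          \<le> (\<Sum>i\<in>I. (\<Sum>g\<in>G i. eigen (op_abs (B i)) g powr p) powr r)"
      proof (rule sum_mono)
        fix i assume i: "i \<in> I"
        have "(\<Sum>e\<in>F0. f i e) \<le> (\<Sum>g\<in>G i. eigen (op_abs (B i)) g powr p) + d"
          using F(1) G i by simp
        moreover have "0 \<le> (\<Sum>g\<in>G i. eigen (op_abs (B i)) g powr p)" by (intro sum_nonneg) simp
        ultimately have "max 0 ((\<Sum>e\<in>F0. f i e) - d) \<le> (\<Sum>g\<in>G i. eigen (op_abs (B i)) g powr p)"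
          by simp
        then show "max 0 ((\<Sum>e\<in>F0. f i e) - d) powr r \<le> (\<Sum>g\<in>G i. eigen (op_abs (B i)) g powr p) powr r"
          using r by (intro powr_mono2) auto
      qed
      also have "\<dots> \<le> R" using G by (intro bound[OF F(2,3)]) simp
      finally show ?thesis .
    qed
    have "((\<lambda>d. \<Sum>i\<in>I. max 0 ((\<Sum>e\<in>F0. f i e) - d) powr r) \<longlongrightarrow>
        (\<Sum>i\<in>I. max 0 ((\<Sum>e\<in>F0. f i e) - 0) powr r)) (at_right 0)"
      using r by (intro tendsto_sum tendsto_powr' tendsto_max tendsto_const tendsto_diff tendsto_ident_at) auto
    then have "(\<Sum>i\<in>I. max 0 ((\<Sum>e\<in>F0. f i e) - 0) powr r) \<le> R"
      by (rule tendsto_upperbound) (auto simp: eventually_at_right_field le intro!: exI[of _ 1])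
    moreover have "max 0 ((\<Sum>e\<in>F0. f i e) - 0) = (\<Sum>e\<in>F0. f i e)" if "i \<in> I" for i
      using f0[OF that] by (simp add: sum_nonneg)
    ultimately show ?thesis by simp
  qed
  have "\<exists>t. (f i has_sum t) trace_basis" if i: "i \<in> I" for i
  proof -
    have "(\<Sum>e\<in>F0. f i e) \<le> R powr (1 / r)" if F0: "finite F0" "F0 \<subseteq> trace_basis" for F0
    proof -
      have "(\<Sum>e\<in>F0. f i e) powr r \<le> (\<Sum>i\<in>I. (\<Sum>e\<in>F0. f i e) powr r)"
        using I i by (intro member_le_sum[of i I "\<lambda>i. (\<Sum>e\<in>F0. f i e) powr r"]) auto
      also note partial[OF F0]
      finally have "((\<Sum>e\<in>F0. f i e) powr r) powr (1 / r) \<le> R powr (1 / r)"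
        using r by (intro powr_mono2) auto
      then show ?thesis using r f0[OF i] by (simp add: powr_powr sum_nonneg)
    qed
    then have "f i summable_on trace_basis"
      using f0[OF i] by (intro nonneg_bdd_above_summable_on) (auto simp: bdd_above_def)
    then show ?thesis by (simp add: summable_on_def)
  qed
  then have "\<forall>i\<in>I. \<exists>t. (f i has_sum t) trace_basis" by simp
  from bchoice[OF this] obtain \<tau> where \<tau>: "\<forall>i\<in>I. (f i has_sum \<tau> i) trace_basis" ..
  have "0 \<le> \<tau> i \<and> op_trace (op_powr (op_abs (B i)) p) = ennreal (\<tau> i)" if i: "i \<in> I" for i
  proof
    have h: "(f i has_sum \<tau> i) trace_basis" using \<tau> i by simp
    show "0 \<le> \<tau> i" by (rule has_sum_nonneg[OF h]) (rule f0[OF i])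
    show "op_trace (op_powr (op_abs (B i)) p) = ennreal (\<tau> i)"
      by (rule op_trace_eq_has_sum[OF positive_op_powr[OF S[OF i] p] h[unfolded f_def]])
  qed
  moreover have "(\<Sum>i\<in>I. \<tau> i powr r) \<le> R"
  proof (rule tendsto_upperbound)
    show "((\<lambda>F. \<Sum>i\<in>I. (\<Sum>e\<in>F. f i e) powr r) \<longlongrightarrow> (\<Sum>i\<in>I. \<tau> i powr r)) (finite_subsets_at_top trace_basis)"
      using \<tau> r f0 unfolding has_sum_def
      by (intro tendsto_sum tendsto_powr' tendsto_const) (auto intro!: always_eventually sum_nonneg)
    show "\<forall>\<^sub>F F in finite_subsets_at_top trace_basis. (\<Sum>i\<in>I. (\<Sum>e\<in>F. f i e) powr r) \<le> R"
      by (rule eventually_finite_subsets_at_top_weakI) (rule partial)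
  qed simp
  ultimately show ?thesis by blast
qed

section \<open>Littlewood matrices\<close>

lemma sum_double:
  fixes f :: "nat \<Rightarrow> 'a::comm_monoid_add"
  shows "(\<Sum>i = 1..m + m. f i) = (\<Sum>i = 1..m. f i) + (\<Sum>i = 1..m. f (i + m))"
proof -
  have "(\<Sum>i = 1..m + m. f i) = (\<Sum>i = 1..m. f i) + (\<Sum>i = m + 1..m + m. f i)"
    by (rule sum.ub_add_nat) simp
  also have "(\<Sum>i = m + 1..m + m. f i) = (\<Sum>i = 1..m. f (i + m))"
    using sum.shift_bounds_cl_nat_ivl[of f 1 m m] by (simp add: add.commute)
  finally show ?thesis .
qed

lemma abs_littlewood: "\<bar>littlewood n i j\<bar> \<le> 1"
  by (induction n arbitrary: i j rule: littlewood.induct) (auto simp: block_matrix_def Let_def)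

lemma littlewood_symmetric: "littlewood n i j = littlewood n j i"
  by (induction n arbitrary: i j rule: littlewood.induct) (auto simp: block_matrix_def Let_def)

text \<open>The block structure turns the two halves \<open>u\<close> and \<open>v\<close> of the transformed vector into
  \<open>u + v\<close> and \<open>u - v\<close>; the parallelogram law gains the factor 2.\<close>

lemma littlewood_orthogonal:
  fixes x :: "nat \<Rightarrow> 'a::complex_hilbert_space"
  shows "(\<Sum>i = 1..2 ^ n. (norm (\<Sum>j = 1..2 ^ n. littlewood n i j *\<^sub>R x j))\<^sup>2) =
    2 ^ n * (\<Sum>j = 1..2 ^ n. (norm (x j))\<^sup>2)"
proof (induction n arbitrary: x rule: littlewood.induct)
  case 1
  then show ?case by simp
next
  case 2
  have "{1..2::nat} = {1, 2}" by auto
  then show ?case using parallelogram[of "x 1" "x 2"] by simp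
next
  case (3 n)
  define m :: nat where "m = 2 ^ Suc n"
  define L where "L = littlewood (Suc n)"
  have m: "2 ^ Suc (Suc n) = m + m" by (simp add: m_def)
  have L: "littlewood (Suc (Suc n)) = block_matrix m L L L (\<lambda>i j. - L i j)"
    by (simp add: L_def m_def Let_def)
  define u v where "u i = (\<Sum>j = 1..m. L i j *\<^sub>R x j)" and "v i = (\<Sum>j = 1..m. L i j *\<^sub>R x (j + m))" for i
  have top: "(\<Sum>j = 1..m + m. block_matrix m L L L (\<lambda>i j. - L i j) i j *\<^sub>R x j) = u i + v i"
    if "i \<in> {1..m}" for i
    using that unfolding sum_double u_def v_def
    by (intro arg_cong2[of _ _ _ _ "(+)"] sum.cong) (auto simp: block_matrix_def)
  have bottom: "(\<Sum>j = 1..m + m. block_matrix m L L L (\<lambda>i j. - L i j) (i + m) j *\<^sub>R x j) = u i - v i"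
    if "i \<in> {1..m}" for i
  proof -
    have "(\<Sum>j = 1..m + m. block_matrix m L L L (\<lambda>i j. - L i j) (i + m) j *\<^sub>R x j) = u i + - v i"
      using that unfolding sum_double u_def v_def sum_negf[symmetric]
      by (intro arg_cong2[of _ _ _ _ "(+)"] sum.cong) (auto simp: block_matrix_def)
    then show ?thesis by simp
  qed
  let ?T = "\<lambda>i. \<Sum>j = 1..m + m. block_matrix m L L L (\<lambda>i j. - L i j) i j *\<^sub>R x j"
  have "(\<Sum>i = 1..m + m. (norm (?T i))\<^sup>2) = (\<Sum>i = 1..m. (norm (?T i))\<^sup>2) + (\<Sum>i = 1..m. (norm (?T (i + m)))\<^sup>2)"
    by (rule sum_double)
  also have "\<dots> = (\<Sum>i = 1..m. (norm (u i + v i))\<^sup>2) + (\<Sum>i = 1..m. (norm (u i - v i))\<^sup>2)"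
    by (intro arg_cong2[of _ _ _ _ "(+)"] sum.cong refl) (simp_all only: top bottom)
  also have "\<dots> = (\<Sum>i = 1..m. (norm (u i + v i))\<^sup>2 + (norm (u i - v i))\<^sup>2)"
    by (rule sum.distrib[symmetric])
  also have "\<dots> = 2 * ((\<Sum>i = 1..m. (norm (u i))\<^sup>2) + (\<Sum>i = 1..m. (norm (v i))\<^sup>2))"
    by (simp only: parallelogram sum_distrib_left[symmetric] sum.distrib)
  also have "(\<Sum>i = 1..m. (norm (u i))\<^sup>2) = 2 ^ Suc n * (\<Sum>j = 1..m. (norm (x j))\<^sup>2)"
    unfolding u_def L_def m_def by (rule 3)
  also have "(\<Sum>i = 1..m. (norm (v i))\<^sup>2) = 2 ^ Suc n * (\<Sum>j = 1..m. (norm (x (j + m)))\<^sup>2)"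
    unfolding v_def L_def m_def by (rule 3)
  also have "2 * (2 ^ Suc n * (\<Sum>j = 1..m. (norm (x j))\<^sup>2) + 2 ^ Suc n * (\<Sum>j = 1..m. (norm (x (j + m)))\<^sup>2))
      = 2 ^ Suc (Suc n) * (\<Sum>j = 1..m + m. (norm (x j))\<^sup>2)"
    unfolding sum_double by (simp add: distrib_left)
  finally show ?case unfolding m L .
qed

section \<open>Clarkson-McCarthy inequalities for orthogonal matrices\<close>

lemma (in orthogonal_form) form_nested:
  "form s t = (\<Sum>i\<in>I. \<Sum>g\<in>G i. t i g * (\<Sum>j\<in>J. of_real (\<epsilon> i j) *
    (\<Sum>h\<in>H j. s j h * (cinner g h * cinner (V j h) (W i g)))))"
  unfolding form_def by (simp add: sum.swap[of _ "G _"] sum_distrib_left mult_ac)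

lemma eigen_op_abs_nonneg: "complex_linear A \<Longrightarrow> 0 \<le> eigen (op_abs A) g"
  by (rule positiveD[OF positive_op_abs])

lemma compressed_trace_le:
  assumes A: "complex_linear A" and p: "p \<ge> 1" and F: "finite F" "F \<subseteq> trace_basis"
    and tr: "op_trace (op_powr (op_abs A) p) = ennreal \<alpha>" and \<alpha>: "\<alpha> \<ge> 0"
    and H: "diagonalising (op_abs A) F H"
  shows "(\<Sum>h\<in>H. \<bar>eigen (op_abs A) h\<bar> powr p) \<le> \<alpha>"
proof -
  note S = positive_op_abs[OF A]
  have "(\<Sum>h\<in>H. eigen (op_abs A) h powr p) \<le> (\<Sum>e\<in>F. Re (cinner (op_powr (op_abs A) p e) e))"
    by (rule compressed_le_trace_powr[OF S p orthonormal_if_subset_trace_basis[OF F(2)] F(1) H])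
  moreover have "ennreal (\<Sum>e\<in>F. Re (cinner (op_powr (op_abs A) p e) e)) \<le> ennreal \<alpha>"
    using p by (intro order_trans[OF finite_sum_le_op_trace[OF positive_op_powr[OF S] F] eq_refl[OF tr]]) simp
  ultimately show ?thesis using eigen_op_abs_nonneg[OF A] \<alpha> by simp
qed

lemma diagonalising_subspace:
  assumes G: "diagonalising S F1 G" and g: "g \<in> G" and F: "finite F" "orthonormal F" "F1 \<subseteq> F"
  shows "proj F g = g"
  by (rule proj_subset[OF F(2,1,3)])
    (metis diagonalisingD(1,2,3)[OF G] proj_self g)

text \<open>For \<open>X > 0\<close> the factor \<open>X\<^bsup>1/p\<^esup>\<close> cancels and leaves \<open>X\<^bsup>1/q\<^esup> \<le> c\<close>.\<close>

lemma self_bound: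
  fixes X c p q :: real
  assumes X: "X \<ge> 0" and c: "c \<ge> 0" and pq: "1 / p + 1 / q = 1" "q > 0"
    and le: "X \<le> c * X powr (1 / p)"
  shows "X \<le> c powr q"
proof (cases "X = 0")
  case False
  then have X: "X > 0" using X by simp
  have "X powr (1 / q) * X powr (1 / p) \<le> c * X powr (1 / p)"
    using le X pq by (simp add: powr_add[symmetric] add.commute)
  then have "X powr (1 / q) \<le> c" using X by simp
  then have "(X powr (1 / q)) powr q \<le> c powr q" using pq by (intro powr_mono2) auto
  then show ?thesis using X pq by (simp add: powr_powr)
qed simp

text \<open>The compressed traces \<open>m i\<close> of \<open>\<bar>B i\<bar>\<^bsup>p\<^esup>\<close> are tested with weights for which Hoelder's
  inequality is an equality. Both sides of the interpolated inequality then involve the same sum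
  \<open>X = \<Sum>i. m i\<^bsup>q/p\<^esup>\<close>, which can be cancelled down to the power \<open>1/q\<close>.\<close>

lemma Clarkson_small_exponent:
  fixes A :: "'j \<Rightarrow> 'a::complex_hilbert_space \<Rightarrow>\<^sub>L 'a" and I :: "'i set"
  assumes fin: "finite I" "finite J" and A: "\<And>j. j \<in> J \<Longrightarrow> complex_linear (A j)"
    and eps: "\<And>i j. i \<in> I \<Longrightarrow> j \<in> J \<Longrightarrow> \<bar>\<epsilon> i j\<bar> \<le> 1" and N: "N > 0"
    and eps_orth: "\<And>x :: 'j \<Rightarrow> 'a. (\<Sum>i\<in>I. (norm (\<Sum>j\<in>J. \<epsilon> i j *\<^sub>R x j))\<^sup>2) \<le> N * (\<Sum>j\<in>J. (norm (x j))\<^sup>2)"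
    and p: "1 < p" "p \<le> 2" and q: "q = p / (p - 1)"
    and tr: "\<And>j. j \<in> J \<Longrightarrow> op_trace (op_powr (op_abs (A j)) p) = ennreal (\<alpha> j)"
    and \<alpha>: "\<And>j. j \<in> J \<Longrightarrow> \<alpha> j \<ge> 0"
  shows "\<exists>\<tau>. (\<forall>i\<in>I. 0 \<le> \<tau> i \<and> op_trace (op_powr (op_abs (\<Sum>j\<in>J. \<epsilon> i j *\<^sub>R A j)) p) = ennreal (\<tau> i)) \<and>
    (\<Sum>i\<in>I. \<tau> i powr (q / p)) \<le> N * (\<Sum>j\<in>J. \<alpha> j) powr (q / p)"
proof (rule op_trace_le_if_compressed_le[OF fin(1)])
  define B where "B i = (\<Sum>j\<in>J. \<epsilon> i j *\<^sub>R A j)" for i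
  have pq: "q > 0" "1 / p + 1 / q = 1"
    using p by (auto simp: q field_simps)
  show "complex_linear (\<Sum>j\<in>J. \<epsilon> i j *\<^sub>R A j)" for i
    by (rule complex_linear_sum[OF A])
  then have B_lin: "complex_linear (B i)" for i by (simp add: B_def)
  show "q / p > 0" "p > 0" using p pq(1) by auto
  fix F1 G
  assume F1: "finite F1" "F1 \<subseteq> (trace_basis :: 'a set)"
    and G: "\<And>i. i \<in> I \<Longrightarrow> diagonalising (op_abs (\<Sum>j\<in>J. \<epsilon> i j *\<^sub>R A j)) F1 (G i)"
  define \<mu> where "\<mu> i g = eigen (op_abs (B i)) g" for i g
  define m where "m i = (\<Sum>g\<in>G i. \<mu> i g powr p)" for i
  define X where "X = (\<Sum>i\<in>I. m i powr (q / p))"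
  define x where "x i g = m i powr (q / p - 1) * \<mu> i g powr (p - 1)" for i g
  have \<mu>0: "\<mu> i g \<ge> 0" for i g unfolding \<mu>_def by (rule eigen_op_abs_nonneg[OF B_lin])
  have m0: "m i \<ge> 0" for i by (simp add: m_def sum_nonneg)
  have X0: "X \<ge> 0" by (simp add: X_def sum_nonneg)
  have x0: "x i g \<ge> 0" for i g by (simp add: x_def)
  define C where "C = N powr (1 / q) * (\<Sum>j\<in>J. \<alpha> j) powr (1 / p) * X powr (1 / p)"
  have "(\<Sum>i\<in>I. \<Sum>g\<in>G i. x i g * eigen (op_abs (B i)) g) \<le> C"
  proof (rule dual_bound[OF orthonormal_basis_trace_basis fin A B_def eps F1 _ x0])
    show "diagonalising (op_abs (B i)) F1 (G i)" if "i \<in> I" for i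
      using G[OF that] by (simp add: B_def)
    fix F and W V :: "_ \<Rightarrow> 'a \<Rightarrow> 'a" and H
    assume F: "finite F" "F1 \<subseteq> F" "F \<subseteq> trace_basis"
      and W: "\<And>i. i \<in> I \<Longrightarrow> contraction (W i)" and V: "\<And>j. j \<in> J \<Longrightarrow> contraction (V j)"
      and H: "\<And>j. j \<in> J \<Longrightarrow> diagonalising (op_abs (A j)) F (H j)"
    note on = orthonormal_if_subset_trace_basis[OF F(3)]
    interpret L: orthogonal_form F I J \<epsilon> N G H W V
    proof
      show "proj F g = g" if "i \<in> I" "g \<in> G i" for i g
        by (rule diagonalising_subspace[OF G[OF that(1)] that(2) F(1) on F(2)])
      show "proj F h = h" if "j \<in> J" "h \<in> H j" for j h
        by (rule diagonalising_subspace[OF H[OF that(1)] that(2) F(1) on order_refl])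
    qed (use on F fin eps N eps_orth W V in \<open>auto dest: diagonalisingD(1,2)[OF G] diagonalisingD(1,2)[OF H]\<close>)
    define s where "s j h = \<bar>eigen (op_abs (A j)) h\<bar>" for j h
    let ?lhs = "tested_sum I J \<epsilon> x G (\<lambda>j. eigen (op_abs (A j))) H V W"
    let ?form = "L.form (\<lambda>j h. of_real (s j h)) (\<lambda>i g. of_real (x i g))"
    have eq: "?lhs = ?form"
      unfolding L.form_nested s_def tested_sum_def by (simp add: eigen_op_abs_nonneg A)
    have "Re ?lhs \<le> cmod ?form" unfolding eq by (rule complex_Re_le_cmod)
    also have "\<dots> \<le> N powr (1 / q) * (\<Sum>j\<in>J. \<Sum>h\<in>H j. s j h powr p) powr (1 / p) *
        (\<Sum>i\<in>I. (\<Sum>g\<in>G i. x i g powr q) powr (p / q)) powr (1 / p)"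
      by (rule L.form_interpolated[OF p q]) (simp_all add: s_def x0)
    also have "(\<Sum>i\<in>I. (\<Sum>g\<in>G i. x i g powr q) powr (p / q)) = X"
      unfolding X_def
    proof (rule sum.cong[OF refl])
      fix i
      have "(p - 1) * q = p" using p by (simp add: q)
      then have "x i g powr q = m i powr ((q / p - 1) * q) * \<mu> i g powr p" for g
        by (simp add: x_def powr_mult powr_powr)
      then have "(\<Sum>g\<in>G i. x i g powr q) = m i powr ((q / p - 1) * q) * m i"
        by (simp add: m_def sum_distrib_left)
      also have "\<dots> = m i powr ((q / p - 1) * q + 1)"
        using m0[of i] by (simp add: powr_add)
      finally have "(\<Sum>g\<in>G i. x i g powr q) powr (p / q) = m i powr (((q / p - 1) * q + 1) * (p / q))"
        by (simp add: powr_powr)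
      also have "((q / p - 1) * q + 1) * (p / q) = q / p"
      proof -
        define w where "w = p - 1"
        have w: "w > 0" "p = w + 1" using p by (simp_all add: w_def)
        then have "q / p = 1 / w" "p / q = w" "q = (w + 1) / w" by (simp_all add: q)
        moreover have "((1 / w - 1) * ((w + 1) / w) + 1) * w = 1 / w" using w(1) by (simp add: field_simps)
        ultimately show ?thesis by (simp only:)
      qed
      finally show "(\<Sum>g\<in>G i. x i g powr q) powr (p / q) = m i powr (q / p)" .
    qed
    also have "N powr (1 / q) * (\<Sum>j\<in>J. \<Sum>h\<in>H j. s j h powr p) powr (1 / p) * X powr (1 / p) \<le> C"
      unfolding C_def using p pq(1)
      by (intro mult_mono powr_mono2 sum_mono) (auto simp: s_def sum_nonneg \<alpha> X0 less_imp_le[OF N]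
          intro!: compressed_trace_le[OF A _ F(1,3) tr \<alpha> H])
    finally show "Re ?lhs \<le> C" .
  qed
  also have "(\<Sum>i\<in>I. \<Sum>g\<in>G i. x i g * eigen (op_abs (B i)) g) = X"
    unfolding X_def
  proof (rule sum.cong[OF refl])
    fix i
    have "x i g * eigen (op_abs (B i)) g = m i powr (q / p - 1) * \<mu> i g powr p" for g
      using \<mu>0[of i g] by (cases "\<mu> i g = 0") (auto simp: x_def \<mu>_def[symmetric] powr_diff)
    then have "(\<Sum>g\<in>G i. x i g * eigen (op_abs (B i)) g) = m i powr (q / p - 1) * m i"
      by (simp add: m_def sum_distrib_left)
    also have "\<dots> = m i powr (q / p)"
      using m0[of i] by (cases "m i = 0") (auto simp: powr_diff)
    finally show "(\<Sum>g\<in>G i. x i g * eigen (op_abs (B i)) g) = m i powr (q / p)" .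
  qed
  finally have "X \<le> (N powr (1 / q) * (\<Sum>j\<in>J. \<alpha> j) powr (1 / p)) powr q"
    unfolding C_def by (intro self_bound[OF X0 _ pq(2,1)]) simp_all
  also have "\<dots> = N * (\<Sum>j\<in>J. \<alpha> j) powr (q / p)"
    using N pq by (simp add: powr_mult powr_powr)
  finally show "(\<Sum>i\<in>I. (\<Sum>g\<in>G i. eigen (op_abs (\<Sum>j\<in>J. \<epsilon> i j *\<^sub>R A j)) g powr p) powr (q / p))
      \<le> N * (\<Sum>j\<in>J. \<alpha> j) powr (q / p)"
    by (simp add: X_def m_def \<mu>_def B_def)
qed

text \<open>Here the given operators have the exponent \<open>p \<ge> 2\<close> and the tests the exponent \<open>q \<le> 2\<close>, so
  the two families of operators change places in the bilinear inequality, which is applied to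
  the transposed matrix with \<open>p\<close> and \<open>q\<close> exchanged. The resulting form is the complex conjugate
  of the one that comes from duality.\<close>

lemma Clarkson_large_exponent:
  fixes A :: "'j \<Rightarrow> 'a::complex_hilbert_space \<Rightarrow>\<^sub>L 'a" and I :: "'i set"
  assumes fin: "finite I" "finite J" and A: "\<And>j. j \<in> J \<Longrightarrow> complex_linear (A j)"
    and eps: "\<And>i j. i \<in> I \<Longrightarrow> j \<in> J \<Longrightarrow> \<bar>\<epsilon> i j\<bar> \<le> 1" and N: "N > 0"
    and eps_orth: "\<And>x :: 'i \<Rightarrow> 'a. (\<Sum>j\<in>J. (norm (\<Sum>i\<in>I. \<epsilon> i j *\<^sub>R x i))\<^sup>2) \<le> N * (\<Sum>i\<in>I. (norm (x i))\<^sup>2)"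
    and p: "2 \<le> p" and q: "q = p / (p - 1)"
    and tr: "\<And>j. j \<in> J \<Longrightarrow> op_trace (op_powr (op_abs (A j)) p) = ennreal (\<alpha> j)"
    and \<alpha>: "\<And>j. j \<in> J \<Longrightarrow> \<alpha> j \<ge> 0"
  shows "\<exists>\<tau>. (\<forall>i\<in>I. 0 \<le> \<tau> i \<and> op_trace (op_powr (op_abs (\<Sum>j\<in>J. \<epsilon> i j *\<^sub>R A j)) p) = ennreal (\<tau> i)) \<and>
    (\<Sum>i\<in>I. \<tau> i powr 1) \<le> N * (\<Sum>j\<in>J. \<alpha> j powr (q / p)) powr (p / q)"
proof (rule op_trace_le_if_compressed_le[OF fin(1)])
  define B where "B i = (\<Sum>j\<in>J. \<epsilon> i j *\<^sub>R A j)" for i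
  have pq: "q > 0" "1 / q + 1 / p = 1" "1 < q" "q \<le> 2" "p = q / (q - 1)" "(p - 1) * q = p"
    using p by (auto simp: q field_simps)
  show "complex_linear (\<Sum>j\<in>J. \<epsilon> i j *\<^sub>R A j)" for i
    by (rule complex_linear_sum[OF A])
  then have B_lin: "complex_linear (B i)" for i by (simp add: B_def)
  show "p > 0" "(1::real) > 0" using p by auto
  fix F1 G
  assume F1: "finite F1" "F1 \<subseteq> (trace_basis :: 'a set)"
    and G: "\<And>i. i \<in> I \<Longrightarrow> diagonalising (op_abs (\<Sum>j\<in>J. \<epsilon> i j *\<^sub>R A j)) F1 (G i)"
  define \<mu> where "\<mu> i g = eigen (op_abs (B i)) g" for i g
  define X where "X = (\<Sum>i\<in>I. \<Sum>g\<in>G i. \<mu> i g powr p)"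
  define x where "x i g = \<mu> i g powr (p - 1)" for i g
  have \<mu>0: "\<mu> i g \<ge> 0" for i g unfolding \<mu>_def by (rule eigen_op_abs_nonneg[OF B_lin])
  have X0: "X \<ge> 0" by (simp add: X_def sum_nonneg)
  have x0: "x i g \<ge> 0" for i g by (simp add: x_def)
  define C where "C = N powr (1 / p) * X powr (1 / q) * (\<Sum>j\<in>J. \<alpha> j powr (q / p)) powr (1 / q)"
  have "(\<Sum>i\<in>I. \<Sum>g\<in>G i. x i g * eigen (op_abs (B i)) g) \<le> C"
  proof (rule dual_bound[OF orthonormal_basis_trace_basis fin A B_def eps F1 _ x0])
    show "diagonalising (op_abs (B i)) F1 (G i)" if "i \<in> I" for i
      using G[OF that] by (simp add: B_def)
    fix F and W V :: "_ \<Rightarrow> 'a \<Rightarrow> 'a" and H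
    assume F: "finite F" "F1 \<subseteq> F" "F \<subseteq> trace_basis"
      and W: "\<And>i. i \<in> I \<Longrightarrow> contraction (W i)" and V: "\<And>j. j \<in> J \<Longrightarrow> contraction (V j)"
      and H: "\<And>j. j \<in> J \<Longrightarrow> diagonalising (op_abs (A j)) F (H j)"
    note on = orthonormal_if_subset_trace_basis[OF F(3)]
    interpret L: orthogonal_form F J I "\<lambda>j i. \<epsilon> i j" N H G V W
    proof
      show "proj F g = g" if "i \<in> I" "g \<in> G i" for i g
        by (rule diagonalising_subspace[OF G[OF that(1)] that(2) F(1) on F(2)])
      show "proj F h = h" if "j \<in> J" "h \<in> H j" for j h
        by (rule diagonalising_subspace[OF H[OF that(1)] that(2) F(1) on order_refl])
    qed (use on F fin eps N eps_orth W V in \<open>auto dest: diagonalisingD(1,2)[OF G] diagonalisingD(1,2)[OF H]\<close>)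
    define s where "s j h = \<bar>eigen (op_abs (A j)) h\<bar>" for j h
    let ?form = "L.form (\<lambda>i g. of_real (x i g)) (\<lambda>j h. of_real (s j h))"
    let ?lhs = "tested_sum I J \<epsilon> x G (\<lambda>j. eigen (op_abs (A j))) H V W"
    have "?lhs = (\<Sum>i\<in>I. \<Sum>g\<in>G i. \<Sum>j\<in>J. \<Sum>h\<in>H j. cnj (of_real (\<epsilon> i j) * of_real (x i g) *
            (of_real (s j h) * (cinner h g * cinner (W i g) (V j h)))))"
      unfolding s_def tested_sum_def
      by (simp add: eigen_op_abs_nonneg A sum_distrib_left mult_ac cinner_commute[symmetric])
    also have "\<dots> = (\<Sum>i\<in>I. \<Sum>j\<in>J. \<Sum>g\<in>G i. \<Sum>h\<in>H j. cnj (of_real (\<epsilon> i j) * of_real (x i g) *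
            (of_real (s j h) * (cinner h g * cinner (W i g) (V j h)))))"
      by (intro sum.cong refl sum.swap)
    also have "\<dots> = cnj ?form"
      unfolding L.form_def cnj_sum by (rule sum.swap)
    finally have eq: "?lhs = cnj ?form" .
    have "Re ?lhs \<le> cmod ?form" unfolding eq using complex_Re_le_cmod[of ?form] by simp
    also have "cmod ?form \<le> N powr (1 / p) * (\<Sum>i\<in>I. \<Sum>g\<in>G i. x i g powr q) powr (1 / q) *
        (\<Sum>j\<in>J. (\<Sum>h\<in>H j. s j h powr p) powr (q / p)) powr (1 / q)"
      by (rule L.form_interpolated[OF pq(3,4,5)]) (simp_all add: s_def x0)
    also have "(\<Sum>i\<in>I. \<Sum>g\<in>G i. x i g powr q) = X"
      by (simp add: X_def x_def powr_powr pq(6))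
    also have "N powr (1 / p) * X powr (1 / q) * (\<Sum>j\<in>J. (\<Sum>h\<in>H j. s j h powr p) powr (q / p)) powr (1 / q) \<le> C"
      unfolding C_def using p pq(1)
      by (intro mult_mono powr_mono2 sum_mono) (auto simp: s_def sum_nonneg X0 less_imp_le[OF N]
          intro!: compressed_trace_le[OF A _ F(1,3) tr \<alpha> H])
    finally show "Re ?lhs \<le> C" .
  qed
  also have "(\<Sum>i\<in>I. \<Sum>g\<in>G i. x i g * eigen (op_abs (B i)) g) = X"
    unfolding X_def
  proof (intro sum.cong refl)
    fix i g
    show "x i g * eigen (op_abs (B i)) g = \<mu> i g powr p"
      using \<mu>0[of i g] by (cases "\<mu> i g = 0") (auto simp: x_def \<mu>_def[symmetric] powr_diff)
  qed
  finally have "X \<le> (N powr (1 / p) * (\<Sum>j\<in>J. \<alpha> j powr (q / p)) powr (1 / q)) powr p"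
    unfolding C_def using p by (intro self_bound[OF X0 _ pq(2)]) (simp_all add: mult_ac)
  also have "\<dots> = N * (\<Sum>j\<in>J. \<alpha> j powr (q / p)) powr (p / q)"
    using N p by (simp add: powr_mult powr_powr)
  finally show "(\<Sum>i\<in>I. (\<Sum>g\<in>G i. eigen (op_abs (\<Sum>j\<in>J. \<epsilon> i j *\<^sub>R A j)) g powr p) powr 1)
      \<le> N * (\<Sum>j\<in>J. \<alpha> j powr (q / p)) powr (p / q)"
    by (simp add: X_def \<mu>_def B_def sum_nonneg)
qed

text \<open>For \<open>p = 1\<close> the endpoint bound on the form suffices, with all test weights equal to 1.\<close>

lemma trace_norm_triangle:
  fixes A :: "'j \<Rightarrow> 'a::complex_hilbert_space \<Rightarrow>\<^sub>L 'a"
  assumes J: "finite J" and A: "\<And>j. j \<in> J \<Longrightarrow> complex_linear (A j)"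
    and eps: "\<And>j. j \<in> J \<Longrightarrow> \<bar>\<epsilon> j\<bar> \<le> 1"
    and tr: "\<And>j. j \<in> J \<Longrightarrow> op_trace (op_powr (op_abs (A j)) 1) = ennreal (\<alpha> j)"
    and \<alpha>: "\<And>j. j \<in> J \<Longrightarrow> \<alpha> j \<ge> 0"
  shows "\<exists>t\<ge>0. op_trace (op_powr (op_abs (\<Sum>j\<in>J. \<epsilon> j *\<^sub>R A j)) 1) = ennreal t \<and> t \<le> (\<Sum>j\<in>J. \<alpha> j)"
proof -
  define B where "B i = (\<Sum>j\<in>J. \<epsilon> j *\<^sub>R A j)" for i :: unit
  have B_lin: "complex_linear (B i)" for i unfolding B_def by (rule complex_linear_sum[OF A])
  have "\<exists>\<tau>. (\<forall>i\<in>{()}. 0 \<le> \<tau> i \<and> op_trace (op_powr (op_abs (B i)) 1) = ennreal (\<tau> i)) \<and>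
    (\<Sum>i\<in>{()}. \<tau> i powr 1) \<le> (\<Sum>j\<in>J. \<alpha> j)"
  proof (rule op_trace_le_if_compressed_le)
    fix F1 G
    assume F1: "finite F1" "F1 \<subseteq> (trace_basis :: 'a set)"
      and G: "\<And>i. i \<in> {()} \<Longrightarrow> diagonalising (op_abs (B i)) F1 (G i)"
    have "(\<Sum>i\<in>{()}. \<Sum>g\<in>G i. 1 * eigen (op_abs (B i)) g) \<le> (\<Sum>j\<in>J. \<alpha> j)"
    proof (rule dual_bound[OF orthonormal_basis_trace_basis _ J A B_def eps F1 G, where I = "{()}" and x = "\<lambda>_ _. 1"])
      fix F and W V :: "_ \<Rightarrow> 'a \<Rightarrow> 'a" and H
      assume F: "finite F" "F1 \<subseteq> F" "F \<subseteq> trace_basis"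
        and W: "\<And>i. i \<in> {()} \<Longrightarrow> contraction (W i)" and V: "\<And>j. j \<in> J \<Longrightarrow> contraction (V j)"
        and H: "\<And>j. j \<in> J \<Longrightarrow> diagonalising (op_abs (A j)) F (H j)"
      note on = orthonormal_if_subset_trace_basis[OF F(3)]
      \<comment> \<open>Cauchy-Schwarz gives the constant \<open>card J\<close>; the summand 1 keeps it positive.\<close>
      have eps_orth: "(\<Sum>i\<in>{()}. (norm (\<Sum>j\<in>J. \<epsilon> j *\<^sub>R x j))\<^sup>2) \<le> (real (card J) + 1) * (\<Sum>j\<in>J. (norm (x j))\<^sup>2)"
        for x :: "'j \<Rightarrow> 'a"
      proof -
        have "norm (\<Sum>j\<in>J. \<epsilon> j *\<^sub>R x j) \<le> (\<Sum>j\<in>J. 1 * norm (x j))"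
          using eps by (intro sum_norm_le) (simp add: mult_left_le_one_le)
        then have "(norm (\<Sum>j\<in>J. \<epsilon> j *\<^sub>R x j))\<^sup>2 \<le> (\<Sum>j\<in>J. 1 * norm (x j))\<^sup>2"
          by (rule power_mono) simp
        also have "\<dots> \<le> (\<Sum>j\<in>J. 1\<^sup>2) * (\<Sum>j\<in>J. (norm (x j))\<^sup>2)" by (rule Cauchy_Schwarz_ineq_sum)
        also have "\<dots> \<le> (real (card J) + 1) * (\<Sum>j\<in>J. (norm (x j))\<^sup>2)"
          by (intro mult_right_mono sum_nonneg) auto
        finally show ?thesis by simp
      qed
      interpret L: orthogonal_form F "{()}" J "\<lambda>_. \<epsilon>" "real (card J) + 1" G H W V
      proof
        show "proj F g = g" if "i \<in> {()}" "g \<in> G i" for i g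
          by (rule diagonalising_subspace[OF G[OF that(1)] that(2) F(1) on F(2)])
        show "proj F h = h" if "j \<in> J" "h \<in> H j" for j h
          by (rule diagonalising_subspace[OF H[OF that(1)] that(2) F(1) on order_refl])
      qed (use on F J eps eps_orth W V diagonalisingD(1,2)[OF G[OF singletonI]] in \<open>auto dest: diagonalisingD(1,2)[OF G] diagonalisingD(1,2)[OF H]\<close>)
      let ?lhs = "tested_sum {()} J (\<lambda>_. \<epsilon>) (\<lambda>_ _. 1) G (\<lambda>j. eigen (op_abs (A j))) H V W"
      let ?form = "L.form (\<lambda>j h. of_real (eigen (op_abs (A j)) h)) (\<lambda>i g. of_real 1)"
      have eq: "?lhs = ?form" unfolding L.form_nested tested_sum_def ..
      have "Re ?lhs \<le> cmod ?form" unfolding eq by (rule complex_Re_le_cmod)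
      also have "\<dots> \<le> (\<Sum>j\<in>J. \<Sum>h\<in>H j. cmod (of_real (eigen (op_abs (A j)) h))) * (\<Sum>i\<in>{()}. 1)"
        by (rule L.form_le_trace_bound) simp_all
      also have "\<dots> = (\<Sum>j\<in>J. \<Sum>h\<in>H j. \<bar>eigen (op_abs (A j)) h\<bar> powr 1)" by simp
      also have "\<dots> \<le> (\<Sum>j\<in>J. \<alpha> j)"
        by (intro sum_mono compressed_trace_le[OF A _ F(1,3) tr \<alpha> H]) simp_all
      finally show "Re ?lhs \<le> (\<Sum>j\<in>J. \<alpha> j)" .
    qed simp_all
    then show "(\<Sum>i\<in>{()}. (\<Sum>g\<in>G i. eigen (op_abs (B i)) g powr 1) powr 1) \<le> (\<Sum>j\<in>J. \<alpha> j)"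
      by (simp add: eigen_op_abs_nonneg[OF B_lin] sum_nonneg)
  qed (simp_all add: B_lin)
  then obtain \<tau> where "\<forall>i\<in>{()}. 0 \<le> \<tau> i \<and> op_trace (op_powr (op_abs (B i)) 1) = ennreal (\<tau> i)"
    "(\<Sum>i\<in>{()}. \<tau> i powr 1) \<le> (\<Sum>j\<in>J. \<alpha> j)" by (elim exE conjE)
  then show ?thesis by (intro exI[of _ "\<tau> ()"]) (simp add: B_def)
qed

text \<open>The tangent of \<open>t\<^bsup>s\<^esup>\<close> at the mean of the \<open>b j\<close>, summed over \<open>j\<close>: the linear terms cancel.\<close>

lemma power_mean:
  fixes b :: "'j \<Rightarrow> real"
  assumes J: "finite J" "J \<noteq> {}" and b: "\<And>j. j \<in> J \<Longrightarrow> b j \<ge> 0" and s: "s \<ge> 1"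
  shows "(\<Sum>j\<in>J. b j) powr s \<le> real (card J) powr (s - 1) * (\<Sum>j\<in>J. b j powr s)"
proof (cases "(\<Sum>j\<in>J. b j) = 0")
  case True
  then show ?thesis by (simp add: sum_nonneg)
next
  case False
  define M where "M = real (card J)"
  define l where "l = (\<Sum>j\<in>J. b j) / M"
  have M: "M > 0" using J by (simp add: M_def card_gt_0_iff)
  have sb: "(\<Sum>j\<in>J. b j) > 0" using False sum_nonneg[of J b] b by simp
  then have l: "l > 0" using M by (simp add: l_def)
  have "M * l powr s = (\<Sum>j\<in>J. l powr s + s * l powr (s - 1) * (b j - l))"
  proof -
    have "(\<Sum>j\<in>J. b j - l) = 0" using M by (simp add: sum_subtractf l_def M_def)
    then show ?thesis by (simp add: sum.distrib sum_distrib_left[symmetric] M_def)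
  qed
  also have "\<dots> \<le> (\<Sum>j\<in>J. b j powr s)"
    using b l s by (intro sum_mono powr_above_tangent) auto
  finally have "M powr (s - 1) * (M * l powr s) \<le> M powr (s - 1) * (\<Sum>j\<in>J. b j powr s)"
    by (intro mult_left_mono) auto
  also have "M powr (s - 1) * (M * l powr s) = (M * l) powr s"
    using M l by (simp add: powr_mult powr_diff)
  also have "M * l = (\<Sum>j\<in>J. b j)" using M by (simp add: l_def)
  finally show ?thesis by (simp add: M_def)
qed

section \<open>Schatten norms\<close>

lemma ennpowr_ennreal: "x \<ge> 0 \<Longrightarrow> ennreal x powr\<^sub>\<infinity> r = ennreal (x powr r)"
  by (simp add: ennpowr_def)

lemma schatten_norm_eq:
  "t \<ge> 0 \<Longrightarrow> op_trace (op_powr (op_abs A) p) = ennreal t \<Longrightarrow> schatten_norm p A = ennreal (t powr (1 / p))"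
  by (simp add: schatten_norm_def ennpowr_ennreal)

lemma schatten_class_trace:
  assumes "A \<in> schatten_class p"
  shows "complex_linear A"
    and "op_trace (op_powr (op_abs A) p) = ennreal (enn2real (op_trace (op_powr (op_abs A) p)))"
proof -
  show "complex_linear A" using assms by (simp add: schatten_class_def)
  have "op_trace (op_powr (op_abs A) p) \<noteq> \<infinity>"
    using assms by (auto simp: schatten_class_def schatten_norm_def ennpowr_def)
  then show "op_trace (op_powr (op_abs A) p) = ennreal (enn2real (op_trace (op_powr (op_abs A) p)))"
    by (simp add: less_top)
qed

theorem corollary4p2:
  fixes n :: nat and p :: real
    and A :: "nat \<Rightarrow> 'h::complex_hilbert_space \<Rightarrow>\<^sub>L 'h"
  assumes separable: "\<exists>D::'h set. countable D \<and> closure D = UNIV"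
    and n: "1 \<le> n"
    and p: "1 \<le> p"
    and A: "\<And>j. j \<in> {1..2 ^ n} \<Longrightarrow> A j \<in> schatten_class p"
  shows
    "(2 \<le> p \<longrightarrow>
        (\<Sum>i = 1..2 ^ n. schatten_norm p (\<Sum>j = 1..2 ^ n. littlewood n i j *\<^sub>R A j) powr\<^sub>\<infinity> p)
          \<le> ennreal (2 powr (real n * (p - 1))) * (\<Sum>j = 1..2 ^ n. schatten_norm p (A j) powr\<^sub>\<infinity> p)) \<and>
     (1 < p \<and> p \<le> 2 \<longrightarrow> (let q = p / (p - 1) in
        (\<Sum>i = 1..2 ^ n. schatten_norm p (\<Sum>j = 1..2 ^ n. littlewood n i j *\<^sub>R A j) powr\<^sub>\<infinity> q)
          \<le> 2 ^ n * (\<Sum>j = 1..2 ^ n. schatten_norm p (A j) powr\<^sub>\<infinity> p) powr\<^sub>\<infinity> (q / p))) \<and>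
     (p = 1 \<longrightarrow>
        (MAX i\<in>{1..2 ^ n}. schatten_norm 1 (\<Sum>j = 1..2 ^ n. littlewood n i j *\<^sub>R A j))
          \<le> (\<Sum>j = 1..2 ^ n. schatten_norm 1 (A j))) \<and>
     (2 \<le> p \<longrightarrow> (let q = p / (p - 1) in
        (\<Sum>i = 1..2 ^ n. schatten_norm p (\<Sum>j = 1..2 ^ n. littlewood n i j *\<^sub>R A j) powr\<^sub>\<infinity> p)
          \<le> 2 ^ n * (\<Sum>j = 1..2 ^ n. schatten_norm p (A j) powr\<^sub>\<infinity> q) powr\<^sub>\<infinity> (p / q)))"
proof -
  let ?M = "{1..2 ^ n :: nat}"
  let ?B = "\<lambda>i. \<Sum>j = 1..2 ^ n. littlewood n i j *\<^sub>R A j"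
  let ?SA = "\<lambda>r. (\<Sum>j = 1..2 ^ n. schatten_norm p (A j) powr\<^sub>\<infinity> r)"
  let ?SB = "\<lambda>r. (\<Sum>i = 1..2 ^ n. schatten_norm p (?B i) powr\<^sub>\<infinity> r)"
  let ?tr = "\<lambda>\<tau>. \<forall>i\<in>?M. 0 \<le> \<tau> i \<and> op_trace (op_powr (op_abs (?B i)) p) = ennreal (\<tau> i)"
  define \<alpha> where "\<alpha> j = enn2real (op_trace (op_powr (op_abs (A j)) p))" for j
  have \<alpha>0: "\<alpha> j \<ge> 0" for j by (simp add: \<alpha>_def)
  have A_lin: "complex_linear (A j)" if "j \<in> ?M" for j
    by (rule schatten_class_trace(1)[OF A[OF that]])
  have tr: "op_trace (op_powr (op_abs (A j)) p) = ennreal (\<alpha> j)" if "j \<in> ?M" for j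
    unfolding \<alpha>_def by (rule schatten_class_trace(2)[OF A[OF that]])
  have norm_A: "schatten_norm p (A j) = ennreal (\<alpha> j powr (1 / p))" if "j \<in> ?M" for j
    by (rule schatten_norm_eq[OF \<alpha>0 tr[OF that]])
  have sum_A: "?SA r = ennreal (\<Sum>j = 1..2 ^ n. \<alpha> j powr (r / p))" for r
    by (simp add: norm_A ennpowr_ennreal powr_powr)
  have sum_A_p: "(\<Sum>j = 1..2 ^ n. \<alpha> j powr (p / p)) = (\<Sum>j = 1..2 ^ n. \<alpha> j)"
    using p \<alpha>0 by simp
  have orth: "(\<Sum>i\<in>?M. (norm (\<Sum>j\<in>?M. littlewood n i j *\<^sub>R x j))\<^sup>2) \<le> 2 ^ n * (\<Sum>j\<in>?M. (norm (x j))\<^sup>2)"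
    for x :: "nat \<Rightarrow> 'h"
    by (rule eq_refl[OF littlewood_orthogonal])
  have orth': "(\<Sum>j\<in>?M. (norm (\<Sum>i\<in>?M. littlewood n i j *\<^sub>R x i))\<^sup>2) \<le> 2 ^ n * (\<Sum>i\<in>?M. (norm (x i))\<^sup>2)"
    for x :: "nat \<Rightarrow> 'h"
    using orth[of x] by (subst littlewood_symmetric)
  have sum_B: "?SB r = ennreal (\<Sum>i = 1..2 ^ n. \<tau> i powr (r / p))"
    if "?tr \<tau>" for \<tau> r
  proof -
    have "?SB r = (\<Sum>i = 1..2 ^ n. ennreal (\<tau> i powr (r / p)))"
    proof (rule sum.cong[OF refl])
      fix i assume "i \<in> ?M"
      then have t: "0 \<le> \<tau> i" "op_trace (op_powr (op_abs (?B i)) p) = ennreal (\<tau> i)" using that by blast+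
      show "schatten_norm p (?B i) powr\<^sub>\<infinity> r = ennreal (\<tau> i powr (r / p))"
        unfolding schatten_norm_eq[OF t] by (simp add: ennpowr_ennreal powr_powr)
    qed
    then show ?thesis by simp
  qed
  have two: "(2::ennreal) ^ n * ennreal x = ennreal (2 ^ n * x)" if "x \<ge> 0" for x
  proof -
    have "ennreal (2 ^ n) = 2 ^ n" by (simp add: ennreal_power[symmetric])
    then show ?thesis using that by (simp add: ennreal_mult)
  qed
  have small: "?SB q
      \<le> 2 ^ n * ?SA p powr\<^sub>\<infinity> (q / p)"
    if p': "1 < p" "p \<le> 2" and q: "q = p / (p - 1)" for q
  proof -
    have "\<exists>\<tau>. ?tr \<tau> \<and>
        (\<Sum>i\<in>?M. \<tau> i powr (q / p)) \<le> 2 ^ n * (\<Sum>j\<in>?M. \<alpha> j) powr (q / p)"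
      by (rule Clarkson_small_exponent[OF finite_atLeastAtMost finite_atLeastAtMost A_lin abs_littlewood _ orth p' q tr \<alpha>0])
        simp_all
    then obtain \<tau> where \<tau>: "?tr \<tau>"
      "(\<Sum>i\<in>?M. \<tau> i powr (q / p)) \<le> 2 ^ n * (\<Sum>j\<in>?M. \<alpha> j) powr (q / p)"
      by (elim exE conjE)
    show ?thesis
      unfolding sum_B[OF \<tau>(1)] sum_A sum_A_p
      using \<tau>(2) \<alpha>0 by (simp add: ennpowr_ennreal sum_nonneg two ennreal_leI)
  qed
  have large: "\<exists>\<tau>. ?tr \<tau> \<and>
      (\<Sum>i\<in>?M. \<tau> i powr 1) \<le> 2 ^ n * (\<Sum>j\<in>?M. \<alpha> j powr (q / p)) powr (p / q)"
    if p': "2 \<le> p" and q: "q = p / (p - 1)" for q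
    by (rule Clarkson_large_exponent[OF finite_atLeastAtMost finite_atLeastAtMost A_lin abs_littlewood _ orth' p' q tr \<alpha>0])
      simp_all
  have third: "?SB p
      \<le> 2 ^ n * ?SA q powr\<^sub>\<infinity> (p / q)"
    if p': "2 \<le> p" and q: "q = p / (p - 1)" for q
  proof -
    obtain \<tau> where \<tau>: "?tr \<tau>"
      "(\<Sum>i\<in>?M. \<tau> i powr 1) \<le> 2 ^ n * (\<Sum>j\<in>?M. \<alpha> j powr (q / p)) powr (p / q)"
      using large[OF p' q] by (elim exE conjE)
    have "p / p = 1" using p by simp
    then show ?thesis
      unfolding sum_B[OF \<tau>(1)] sum_A
      using \<tau>(2) by (simp add: ennpowr_ennreal sum_nonneg two ennreal_leI)
  qed
  \<comment> \<open>The first inequality is the third combined with the power mean inequality, since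
    \<open>p / q = p - 1 \<ge> 1\<close>.\<close>
  have first: "?SB p
      \<le> ennreal (2 powr (real n * (p - 1))) * ?SA p"
    if p': "2 \<le> p"
  proof -
    define q where "q = p / (p - 1)"
    have pq: "p / q = p - 1" "q / p * (p - 1) = 1" using p' by (simp_all add: q_def)
    obtain \<tau> where \<tau>: "?tr \<tau>"
      "(\<Sum>i\<in>?M. \<tau> i powr 1) \<le> 2 ^ n * (\<Sum>j\<in>?M. \<alpha> j powr (q / p)) powr (p / q)"
      using large[OF p' q_def] by (elim exE conjE)
    have "(\<Sum>j\<in>?M. \<alpha> j powr (q / p)) powr (p / q)
        \<le> real (card ?M) powr (p - 1 - 1) * (\<Sum>j\<in>?M. (\<alpha> j powr (q / p)) powr (p - 1))"
      unfolding pq(1) using p' by (intro power_mean) auto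
    also have "\<dots> = 2 powr (real n * (p - 2)) * (\<Sum>j\<in>?M. \<alpha> j)"
      unfolding powr_powr pq(2) using \<alpha>0 by (simp add: powr_powr powr_realpow[symmetric])
    finally have "2 ^ n * (\<Sum>j\<in>?M. \<alpha> j powr (q / p)) powr (p / q)
        \<le> 2 ^ n * (2 powr (real n * (p - 2)) * (\<Sum>j\<in>?M. \<alpha> j))"
      by (rule mult_left_mono) simp
    also have "\<dots> = 2 powr (real n * (p - 1)) * (\<Sum>j\<in>?M. \<alpha> j)"
      by (simp add: powr_realpow[symmetric] powr_add[symmetric] mult.assoc[symmetric] algebra_simps)
    finally have "(\<Sum>i\<in>?M. \<tau> i powr 1) \<le> 2 powr (real n * (p - 1)) * (\<Sum>j\<in>?M. \<alpha> j)"
      using \<tau>(2) by linarith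
    moreover have "p / p = 1" using p by simp
    ultimately show ?thesis
      unfolding sum_B[OF \<tau>(1)] sum_A sum_A_p
      using \<alpha>0 by (simp add: ennreal_mult[symmetric] sum_nonneg ennreal_leI)
  qed
  have trace: "(MAX i\<in>?M. schatten_norm 1 (?B i)) \<le> (\<Sum>j = 1..2 ^ n. schatten_norm 1 (A j))"
    if p': "p = 1"
  proof (rule Max.boundedI)
    fix y assume "y \<in> (\<lambda>i. schatten_norm 1 (?B i)) ` ?M"
    then obtain i where y: "y = schatten_norm 1 (?B i)" by blast
    have "\<exists>t\<ge>0. op_trace (op_powr (op_abs (?B i)) 1) = ennreal t \<and> t \<le> (\<Sum>j\<in>?M. \<alpha> j)"
      by (rule trace_norm_triangle[OF finite_atLeastAtMost A_lin abs_littlewood tr[unfolded p'] \<alpha>0])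
    then obtain t where t: "t \<ge> 0" "op_trace (op_powr (op_abs (?B i)) 1) = ennreal t" "t \<le> (\<Sum>j\<in>?M. \<alpha> j)"
      by (elim exE conjE)
    have "y = ennreal t" using schatten_norm_eq[OF t(1,2)] t(1) by (simp add: y)
    also have "\<dots> \<le> (\<Sum>j = 1..2 ^ n. schatten_norm 1 (A j))"
      using t(3) norm_A \<alpha>0 by (simp add: p' ennreal_leI)
    finally show "y \<le> (\<Sum>j = 1..2 ^ n. schatten_norm 1 (A j))" .
  qed simp_all
  show ?thesis
    unfolding Let_def using first small trace third by blast
qed

end
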